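(* Let $\ell\ge1$ and let $\mathcal{F}_0$ denote either $\mathcal{F}_{\ell,1}$ or $\mathcal{F}_{\ell,1}^{loc}$. Assume $\mathcal{E}$ is a unital $*$-subalgebra of $\mathcal{F}_0$ satisfying: (E0) $\pi^{(\ell)}_j\in\mathcal{E}$ for each positive integer $j\le\ell$; (E1) if all values of $f\in\mathcal{E}$ are invertible matrices and $(f)^{-1}\in\mathcal{F}_0$, then $(f)^{-1}\in\mathcal{E}$; (E2) whenever $f_n\in\mathcal{E}$ are uniformly bounded and converge pointwise to a function $f\in\mathcal{F}_0$, then $f\in\mathcal{E}$. Then $\mathcal{E}=\mathcal{F}_0$.
   Context: For $n\ge1$, $\mathbb{M}_n$ is the $C^*$-algebra of complex $n\times n$ matrices (operator norm), $\mathbb{U}_n$ its unitary group, $I_n$ its unit; $\mathbb{M}=\bigsqcup_n\mathbb{M}_n$ and $\mathbb{M}^{(\ell)}=\bigsqcup_{n}\mathbb{M}_n^{\ell}$ (topological disjoint unions). For $\mathbf{X}=(X_1,\dots,X_\ell)\in\mathbb{M}_n^\ell$: $d(\mathbf{X})=n$, $\|\mathbf{X}\|=\max_k\|X_k\|$, $U.\mathbf{X}=(UX_kU^{-1})_k$ for $U\in\mathbb{U}_n$, $\mathbf{X}\oplus\mathbf{Y}=(X_k\oplus Y_k)_k$ (block-diagonal). A function $f:\mathbb{M}^{(\ell)}\to\mathbb{M}$ is compatible if $d(f(\mathbf{X}))=d(\mathbf{X})$ and $f(U.(\bigoplus_{j=1}^s\mathbf{X}_j))=U.(\bigoplus_{j=1}^s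 f(\mathbf{X}_j))$ for all finite systems $\mathbf{X}_1,\dots,\mathbf{X}_s\in\mathbb{M}^{(\ell)}$ and $U\in\mathbb{U}_N$, $N=\sum_j d(\mathbf{X}_j)$. $\mathcal{F}_{\ell,1}$ is the unital $*$-algebra (pointwise matrix operations, unit $\mathbf{X}\mapsto I_{d(\mathbf{X})}$) of compatible Borel functions $\mathbb{M}^{(\ell)}\to\mathbb{M}$, and $\mathcal{F}_{\ell,1}^{loc}$ its subalgebra of locally bounded ones (bounded on each $\{\mathbf{X}:\|\mathbf{X}\|\le R\}$). $\pi^{(\ell)}_j(X_1,\dots,X_\ell)=X_j$. If all values of $f$ are invertible, $(f)^{-1}(\mathbf{X})=(f(\mathbf{X}))^{-1}$. "Uniformly bounded" means $\sup_n\sup_{\mathbf{X}}\|f_n(\mathbf{X})\|<\infty$. *)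

theory Defs
  imports "HOL-Analysis.Analysis" "Jordan_Normal_Form.Matrix"
begin

(* A point of M^(l) = disjoint union over n >= 1 of M_n^l is represented as a list of
   l square complex matrices of a common size n >= 1. *)

definition Mtup :: "nat \<Rightarrow> complex mat list set" where
  "Mtup l = {xs. length xs = l \<and> (\<exists>n\<ge>1. \<forall>A\<in>set xs. A \<in> carrier_mat n n)}"

definition tdim :: "complex mat list \<Rightarrow> nat" where
  "tdim xs = dim_row (hd xs)"

definition vnorm :: "complex vec \<Rightarrow> real" where
  "vnorm v = sqrt (\<Sum>i<dim_vec v. (cmod (v $ i))\<^sup>2)"

definition opnorm :: "complex mat \<Rightarrow> real" where
  "opnorm A = (SUP v \<in> {v \<in> carrier_vec (dim_col A). vnorm v \<le> 1}. vnorm (A *\<^sub>v v))"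

definition tnorm :: "complex mat list \<Rightarrow> real" where
  "tnorm xs = Max (opnorm ` set xs)"

definition adj :: "complex mat \<Rightarrow> complex mat" where
  "adj A = mat (dim_col A) (dim_row A) (\<lambda>(i,j). cnj (A $$ (j,i)))"

definition unitary :: "nat \<Rightarrow> complex mat \<Rightarrow> bool" where
  "unitary N U \<longleftrightarrow> U \<in> carrier_mat N N \<and> U * adj U = 1\<^sub>m N \<and> adj U * U = 1\<^sub>m N"

(* U.X = U X U^{-1}  (U unitary, so U^{-1} = U^* ) *)
definition conjm :: "complex mat \<Rightarrow> complex mat \<Rightarrow> complex mat" where
  "conjm U A = U * A * adj U"

definition conjt :: "complex mat \<Rightarrow> complex mat list \<Rightarrow> complex mat list" where
  "conjt U xs = map (conjm U) xs"

definition dsum :: "complex mat \<Rightarrow> complex mat \<Rightarrow> complex mat" where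
  "dsum A B = four_block_mat A (0\<^sub>m (dim_row A) (dim_col B)) (0\<^sub>m (dim_row B) (dim_col A)) B"

definition dsumt :: "complex mat list \<Rightarrow> complex mat list \<Rightarrow> complex mat list" where
  "dsumt xs ys = map2 dsum xs ys"

fun bigsumt :: "complex mat list list \<Rightarrow> complex mat list" where
  "bigsumt [x] = x"
| "bigsumt (x # xs) = dsumt x (bigsumt xs)"
| "bigsumt [] = []"

fun bigsum :: "complex mat list \<Rightarrow> complex mat" where
  "bigsum [A] = A"
| "bigsum (A # As) = dsum A (bigsum As)"
| "bigsum [] = 0\<^sub>m 0 0"

definition compatible :: "nat \<Rightarrow> (complex mat list \<Rightarrow> complex mat) \<Rightarrow> bool" where
  "compatible l f \<longleftrightarrow>
     (\<forall>X\<in>Mtup l. f X \<in> carrier_mat (tdim X) (tdim X)) \<and>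
     (\<forall>ps. ps \<noteq> [] \<longrightarrow> set ps \<subseteq> Mtup l \<longrightarrow>
        (\<forall>U. unitary (\<Sum>p\<leftarrow>ps. tdim p) U \<longrightarrow>
           f (conjt U (bigsumt ps)) = conjm U (bigsum (map f ps))))"

(* M_n^l is identified with C^(l*n*n), coordinates indexed by (k,i,j) *)
definition tup_of :: "nat \<Rightarrow> nat \<Rightarrow> (nat \<times> nat \<times> nat \<Rightarrow> complex) \<Rightarrow> complex mat list" where
  "tup_of l n x = map (\<lambda>k. mat n n (\<lambda>(i,j). x (k,i,j))) [0..<l]"

(* Borel measurability on the topological disjoint union = Borel on each piece M_n^l *)
definition borel_fun :: "nat \<Rightarrow> (complex mat list \<Rightarrow> complex mat) \<Rightarrow> bool" where
  "borel_fun l f \<longleftrightarrow> (\<forall>n\<ge>1. \<forall>i<n. \<forall>j<n.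
     (\<lambda>x. f (tup_of l n x) $$ (i,j)) \<in>
        borel_measurable (PiM ({..<l} \<times> {..<n} \<times> {..<n}) (\<lambda>_. borel)))"

(* functions are considered only on M^(l); outside they are fixed to undefined *)
definition ext_fun :: "nat \<Rightarrow> (complex mat list \<Rightarrow> complex mat) \<Rightarrow> bool" where
  "ext_fun l f \<longleftrightarrow> (\<forall>X. X \<notin> Mtup l \<longrightarrow> f X = undefined)"

definition restr :: "nat \<Rightarrow> (complex mat list \<Rightarrow> complex mat) \<Rightarrow> (complex mat list \<Rightarrow> complex mat)" where
  "restr l f = (\<lambda>X. if X \<in> Mtup l then f X else undefined)"

definition Falg :: "nat \<Rightarrow> (complex mat list \<Rightarrow> complex mat) set" where
  "Falg l = {f. ext_fun l f \<and> compatible l f \<and> borel_fun l f}"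

definition Floc :: "nat \<Rightarrow> (complex mat list \<Rightarrow> complex mat) set" where
  "Floc l = {f \<in> Falg l. \<forall>R. \<exists>C. \<forall>X\<in>Mtup l. tnorm X \<le> R \<longrightarrow> opnorm (f X) \<le> C}"

definition proj :: "nat \<Rightarrow> nat \<Rightarrow> (complex mat list \<Rightarrow> complex mat)" where
  "proj l j = restr l (\<lambda>X. X ! (j - 1))"

definition unitf :: "nat \<Rightarrow> (complex mat list \<Rightarrow> complex mat)" where
  "unitf l = restr l (\<lambda>X. 1\<^sub>m (tdim X))"

definition minv :: "complex mat \<Rightarrow> complex mat" where
  "minv A = (THE B. B \<in> carrier_mat (dim_row A) (dim_row A) \<and> A * B = 1\<^sub>m (dim_row A)
                   \<and> B * A = 1\<^sub>m (dim_row A))"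

definition finv :: "nat \<Rightarrow> (complex mat list \<Rightarrow> complex mat) \<Rightarrow> (complex mat list \<Rightarrow> complex mat)" where
  "finv l f = restr l (\<lambda>X. minv (f X))"

definition unital_star_subalg :: "nat \<Rightarrow> (complex mat list \<Rightarrow> complex mat) set
     \<Rightarrow> (complex mat list \<Rightarrow> complex mat) set \<Rightarrow> bool" where
  "unital_star_subalg l F0 E \<longleftrightarrow> E \<subseteq> F0 \<and> unitf l \<in> E \<and>
     (\<forall>f\<in>E. \<forall>g\<in>E. restr l (\<lambda>X. f X + g X) \<in> E) \<and>
     (\<forall>f\<in>E. \<forall>g\<in>E. restr l (\<lambda>X. f X * g X) \<in> E) \<and>
     (\<forall>c. \<forall>f\<in>E. restr l (\<lambda>X. c \<cdot>\<^sub>m f X) \<in> E) \<and>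
     (\<forall>f\<in>E. restr l (\<lambda>X. adj (f X)) \<in> E)"

end

theory Submission
  imports Defs "Jordan_Normal_Form.Spectral_Radius"
begin

text \<open>A compatible function is determined by its values on irreducible tuples, because every tuple
  is unitarily equivalent to a direct sum of irreducible ones. On an irreducible tuple \<open>Y\<close> of size
  \<open>n\<close>, functional calculus applied to \<open>*\<close>-polynomials produces, from a countable supply of elements of
  \<open>E\<close>, a projection of minimal rank, which must have rank one, and then by Gram-Schmidt
  partial isometries \<open>v\<^sub>1, \<dots>, v\<^sub>n\<close> such that the \<open>v\<^sub>i v\<^sub>j\<^sup>*\<close> are matrix units. The coefficients of \<open>Y\<close> with
  respect to them form a tuple \<open>C(Y)\<close> that is unitarily equivalent to \<open>Y\<close>, so
  \<open>f(Y) = \<Sum> f(C(Y))\<^sub>i\<^sub>j v\<^sub>i v\<^sub>j\<^sup>*\<close> for every compatible \<open>f\<close>. The coefficients of \<open>C(Y)\<close> are central elements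
  of \<open>E\<close>, and bounded Borel functions of these belong to \<open>E\<close> by a monotone class argument. Countably
  many choices of the \<open>v\<^sub>i\<close> cover all irreducible tuples, so \<open>E\<close> contains all bounded
  functions. An arbitrary \<open>f\<close> is the product of the bounded function \<open>f (1 + f\<^sup>* f)\<inverse>\<close> and the inverse of
  the bounded function \<open>(1 + f\<^sup>* f)\<inverse>\<close>.\<close>

text \<open>The functional calculus is made instead from bounded inverses \<open>1 / r\<close> with
  \<open>1 \<le> r\<close>, powers and limits. A function that is 1 where \<open>a\<close> vanishes
  and 0 elsewhere is in general not compatible, since a direct sum can mix both cases. On
  irreducible tuples such distinctions make sense, and a bounded limit of elements of
  \<open>E\<close> supplies the compatible extension; hence all constructions are specified on
  irreducible tuples only. A set of irreducible tuples counts as measurable if its indicator comes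
  from \<open>E\<close>. The Borel property of \<open>f\<close> enters where \<open>f\<close> is
  evaluated at the coefficient tuple, whose entries are measurable in this sense. The pieces on
  which \<open>f\<close> is reconstructed are glued by one sequence of limits, so there may be only
  countably many. This is why projections and partial isometries are values of terms, why spectral
  thresholds are rational, and why inverse square roots are cut off at
  \<open>1 / (m + 1)\<close>.\<close>

text \<open>Rewriting carrier membership into equations between dimensions keeps the side conditions
  of the ring laws free of extra variables, so that they can be used as plain rewrite rules.\<close>

declare carrier_matD [rule del, simp del] carrier_matI [rule del] carrier_vecD [simp del]
  mult_carrier_mat [simp del] add_carrier_mat [simp del] mult_mat_vec_carrier [simp del]
  assoc_mult_mat [simp del] assoc_mult_mat_vec [simp del] assoc_add_mat [simp del]
  add_carrier_vec [simp del] minus_carrier_vec [simp del] assoc_add_vec [simp del]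

section \<open>Ring laws, adjoints and entries of complex matrices\<close>

lemma carrier_mat_iff: "A \<in> carrier_mat n m \<longleftrightarrow> dim_row A = n \<and> dim_col A = m"
  by (auto simp: carrier_mat_def)

lemma carrier_vec_iff: "v \<in> carrier_vec n \<longleftrightarrow> dim_vec v = n"
  by (auto simp: carrier_vec_def)

declare carrier_mat_iff [simp] carrier_vec_iff [simp]

lemma mm_assoc:
  fixes A B C :: "complex mat"
  shows "dim_col A = dim_row B \<Longrightarrow> dim_col B = dim_row C \<Longrightarrow> A * B * C = A * (B * C)"
  by (rule assoc_mult_mat) auto

lemma mv_assoc:
  fixes A B :: "complex mat"
  shows "dim_col A = dim_row B \<Longrightarrow> dim_col B = dim_vec v \<Longrightarrow> A * B *\<^sub>v v = A *\<^sub>v (B *\<^sub>v v)"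
  by (rule assoc_mult_mat_vec) auto

lemma mm_distrib:
  fixes A B C :: "complex mat"
  shows
  "dim_row A = dim_row B \<Longrightarrow> dim_col A = dim_col B \<Longrightarrow> dim_col A = dim_row C \<Longrightarrow> (A + B) * C = A * C + B * C"
  "dim_row A = dim_row B \<Longrightarrow> dim_col A = dim_col B \<Longrightarrow> dim_col C = dim_row A \<Longrightarrow> C * (A + B) = C * A + C * B"
  "dim_row A = dim_row B \<Longrightarrow> dim_col A = dim_col B \<Longrightarrow> dim_col A = dim_row C \<Longrightarrow> (A - B) * C = A * C - B * C"
  "dim_row A = dim_row B \<Longrightarrow> dim_col A = dim_col B \<Longrightarrow> dim_col C = dim_row A \<Longrightarrow> C * (A - B) = C * A - C * B"
  by (rule add_mult_distrib_mat mult_add_distrib_mat minus_mult_distrib_mat mult_minus_distrib_mat; auto)+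

lemma mm_smult:
  fixes A B :: "complex mat"
  shows "dim_col A = dim_row B \<Longrightarrow> (c \<cdot>\<^sub>m A) * B = c \<cdot>\<^sub>m (A * B)"
    "dim_col A = dim_row B \<Longrightarrow> A * (c \<cdot>\<^sub>m B) = c \<cdot>\<^sub>m (A * B)"
    "c \<cdot>\<^sub>m (d \<cdot>\<^sub>m A) = (c * d) \<cdot>\<^sub>m A"
    "(1::complex) \<cdot>\<^sub>m A = A"
     apply (rule mult_smult_assoc_mat; auto)
    apply (rule mult_smult_distrib; auto)
   apply (auto simp: mult.assoc)
  done

lemma mv_distrib:
  fixes A B :: "complex mat"
  shows
  "dim_row A = dim_row B \<Longrightarrow> dim_col A = dim_col B \<Longrightarrow> dim_col A = dim_vec v \<Longrightarrow> (A + B) *\<^sub>v v = A *\<^sub>v v + B *\<^sub>v v"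
  "dim_row A = dim_row B \<Longrightarrow> dim_col A = dim_col B \<Longrightarrow> dim_col A = dim_vec v \<Longrightarrow> (A - B) *\<^sub>v v = A *\<^sub>v v - B *\<^sub>v v"
  "dim_vec v = dim_vec w \<Longrightarrow> dim_col A = dim_vec v \<Longrightarrow> A *\<^sub>v (v + w) = A *\<^sub>v v + A *\<^sub>v w"
  "dim_vec v = dim_vec w \<Longrightarrow> dim_col A = dim_vec v \<Longrightarrow> A *\<^sub>v (v - w) = A *\<^sub>v v - A *\<^sub>v w"
  "dim_col A = dim_vec v \<Longrightarrow> A *\<^sub>v (c \<cdot>\<^sub>v v) = c \<cdot>\<^sub>v (A *\<^sub>v v)"
  "dim_col A = dim_vec v \<Longrightarrow> (c \<cdot>\<^sub>m A) *\<^sub>v v = c \<cdot>\<^sub>v (A *\<^sub>v v)"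
       apply (rule add_mult_distrib_mat_vec; auto)
      apply (rule minus_mult_distrib_mat_vec; auto)
     apply (rule mult_add_distrib_mat_vec; auto)
    apply (rule mult_minus_distrib_mat_vec; auto)
   apply (rule mult_mat_vec; auto)
  apply (intro eq_vecI; auto)
  done

lemma adj_dim [simp]: "dim_row (adj A) = dim_col A" "dim_col (adj A) = dim_row A"
  by (auto simp: adj_def)

lemma adj_index [simp]:
  "i < dim_col A \<Longrightarrow> j < dim_row A \<Longrightarrow> adj A $$ (i,j) = cnj (A $$ (j,i))"
  by (auto simp: adj_def)

lemma adj_adj [simp]: "adj (adj A) = A"
  by (intro eq_matI) auto

lemma mult_index:
  assumes "A \<in> carrier_mat n m" "B \<in> carrier_mat m k" "i < n" "j < k"
  shows "(A * B) $$ (i,j) = (\<Sum>q<m. A $$ (i,q) * B $$ (q,j))"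
  using assms by (simp add: scalar_prod_def atLeast0LessThan)

lemma mult_vec_index:
  assumes "A \<in> carrier_mat n m" "v \<in> carrier_vec m" "i < n"
  shows "(A *\<^sub>v v) $ i = (\<Sum>q<m. A $$ (i,q) * v $ q)"
  using assms by (simp add: scalar_prod_def atLeast0LessThan)

lemma adj_mult:
  assumes "A \<in> carrier_mat n m" "B \<in> carrier_mat m k"
  shows "adj (A * B) = adj B * adj A"
  using assms
  by (intro eq_matI)
    (auto simp: mult_index[of _ k m _ n] mult_index[of _ n m _ k] mult.commute simp del: index_mult_mat(1)
          intro!: sum.cong)

lemma adj_add: "A \<in> carrier_mat n m \<Longrightarrow> B \<in> carrier_mat n m \<Longrightarrow> adj (A + B) = adj A + adj B"
  by (intro eq_matI) auto

lemma adj_minus: "A \<in> carrier_mat n m \<Longrightarrow> B \<in> carrier_mat n m \<Longrightarrow> adj (A - B) = adj A - adj B"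
  by (intro eq_matI) auto

lemma adj_smult: "adj (c \<cdot>\<^sub>m A) = cnj c \<cdot>\<^sub>m adj A"
  by (intro eq_matI) auto

lemma adj_one [simp]: "adj (1\<^sub>m n) = 1\<^sub>m n"
  by (intro eq_matI) auto

lemma adj_zero [simp]: "adj (0\<^sub>m n m) = 0\<^sub>m m n"
  by (intro eq_matI) auto

lemma mult_unit_vec_index:
  fixes C :: "complex mat"
  assumes "C \<in> carrier_mat n m" "i < n" "j < m"
  shows "(C *\<^sub>v unit_vec m j) $ i = C $$ (i,j)"
proof -
  have "(\<Sum>q<m. C $$ (i,q) * unit_vec m j $ q) = (\<Sum>q<m. if q = j then C $$ (i,q) else 0)"
    using assms by (intro sum.cong) auto
  then show ?thesis
    using assms by (simp add: scalar_prod_def atLeast0LessThan)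
qed

lemma zero_mult_vec [simp]: "dim_vec v = m \<Longrightarrow> 0\<^sub>m n m *\<^sub>v v = (0\<^sub>v n :: complex vec)"
  by (intro eq_vecI) auto

lemma mult_zero_mat [simp]:
  fixes A :: "complex mat"
  shows "dim_col A = n \<Longrightarrow> A * 0\<^sub>m n m = 0\<^sub>m (dim_row A) m"
    and "dim_row A = n \<Longrightarrow> 0\<^sub>m m n * A = 0\<^sub>m m (dim_col A)"
  by (rule right_mult_zero_mat left_mult_zero_mat; auto)+

lemma smult_zero_vec' [simp]: "c \<cdot>\<^sub>v 0\<^sub>v n = (0\<^sub>v n :: complex vec)"
  by (intro eq_vecI) auto

lemma mat_eq_vecI:
  fixes A B :: "complex mat"
  assumes A: "A \<in> carrier_mat n m" and B: "B \<in> carrier_mat n m"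
    and eq: "\<And>v. v \<in> carrier_vec m \<Longrightarrow> A *\<^sub>v v = B *\<^sub>v v"
  shows "A = B"
proof (rule eq_matI)
  fix i j assume ij: "i < dim_row B" "j < dim_col B"
  show "A $$ (i,j) = B $$ (i,j)"
    using mult_unit_vec_index[OF A, of i j] mult_unit_vec_index[OF B, of i j] eq[of "unit_vec m j"] ij B by simp
qed (use A B in auto)

lemma mat_eq_zeroI:
  fixes A :: "complex mat"
  assumes "A \<in> carrier_mat n m"
    and "\<And>v. v \<in> carrier_vec m \<Longrightarrow> A *\<^sub>v v = 0\<^sub>v n"
  shows "A = 0\<^sub>m n m"
  by (rule mat_eq_vecI[OF assms(1)]) (use assms in auto)

section \<open>Inner product and rank one matrices\<close>

definition ip :: "complex vec \<Rightarrow> complex vec \<Rightarrow> complex" where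
  "ip v w = (\<Sum>i<dim_vec w. v $ i * cnj (w $ i))"

lemma ip_add_left: "u \<in> carrier_vec n \<Longrightarrow> v \<in> carrier_vec n \<Longrightarrow> w \<in> carrier_vec n \<Longrightarrow>
    ip (u + v) w = ip u w + ip v w"
  by (auto simp: ip_def algebra_simps sum.distrib)

lemma ip_add_right: "u \<in> carrier_vec n \<Longrightarrow> v \<in> carrier_vec n \<Longrightarrow> w \<in> carrier_vec n \<Longrightarrow>
    ip w (u + v) = ip w u + ip w v"
  by (auto simp: ip_def algebra_simps sum.distrib)

lemma ip_minus_left: "u \<in> carrier_vec n \<Longrightarrow> v \<in> carrier_vec n \<Longrightarrow> w \<in> carrier_vec n \<Longrightarrow>
    ip (u - v) w = ip u w - ip v w"
  by (auto simp: ip_def algebra_simps sum_subtractf)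

lemma ip_minus_right: "u \<in> carrier_vec n \<Longrightarrow> v \<in> carrier_vec n \<Longrightarrow> w \<in> carrier_vec n \<Longrightarrow>
    ip w (u - v) = ip w u - ip w v"
  by (auto simp: ip_def algebra_simps sum_subtractf)

lemma ip_smult_left: "v \<in> carrier_vec n \<Longrightarrow> w \<in> carrier_vec n \<Longrightarrow> ip (c \<cdot>\<^sub>v v) w = c * ip v w"
  by (auto simp: ip_def algebra_simps sum_distrib_left)

lemma ip_smult_right: "ip w (c \<cdot>\<^sub>v v) = cnj c * ip w v"
  by (auto simp: ip_def algebra_simps sum_distrib_left)

lemma ip_zero_left [simp]: "w \<in> carrier_vec n \<Longrightarrow> ip (0\<^sub>v n) w = 0"
  by (auto simp: ip_def)

lemma ip_zero_right [simp]: "ip w (0\<^sub>v n) = 0"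
  by (auto simp: ip_def)

lemma ip_cnj: "v \<in> carrier_vec n \<Longrightarrow> w \<in> carrier_vec n \<Longrightarrow> cnj (ip v w) = ip w v"
  by (auto simp: ip_def mult.commute)

lemma ip_self: "ip v v = complex_of_real ((vnorm v)\<^sup>2)"
  by (simp add: ip_def vnorm_def sum_nonneg complex_norm_square[symmetric] del: of_real_power)

lemma vnorm_nonneg [simp]: "0 \<le> vnorm v"
  by (simp add: vnorm_def sum_nonneg)

lemma vnorm_eq_0: "v \<in> carrier_vec n \<Longrightarrow> vnorm v = 0 \<longleftrightarrow> v = 0\<^sub>v n"
  by (auto simp: vnorm_def sum_nonneg_eq_0_iff) (metis index_zero_vec(1))

lemma ip_self_eq_0: "v \<in> carrier_vec n \<Longrightarrow> ip v v = 0 \<longleftrightarrow> v = 0\<^sub>v n"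
  by (simp add: ip_self vnorm_eq_0)

lemma ip_adj:
  assumes A: "A \<in> carrier_mat n m" and v: "v \<in> carrier_vec m" and w: "w \<in> carrier_vec n"
  shows "ip (A *\<^sub>v v) w = ip v (adj A *\<^sub>v w)"
proof -
  have "ip (A *\<^sub>v v) w = (\<Sum>i<n. \<Sum>j<m. A $$ (i,j) * v $ j * cnj (w $ i))"
    using assms
    by (auto simp: ip_def mult_vec_index[of A n m] sum_distrib_right simp del: index_mult_mat_vec intro!: sum.cong)
  also have "\<dots> = (\<Sum>j<m. \<Sum>i<n. A $$ (i,j) * v $ j * cnj (w $ i))"
    by (rule sum.swap)
  also have "\<dots> = ip v (adj A *\<^sub>v w)"
    using assms
    by (auto simp: ip_def mult_vec_index[of "adj A" m n] sum_distrib_left algebra_simps simp del: index_mult_mat_vec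
        intro!: sum.cong)
  finally show ?thesis .
qed

definition outer :: "complex vec \<Rightarrow> complex vec \<Rightarrow> complex mat" where
  "outer x y = mat (dim_vec x) (dim_vec y) (\<lambda>(i,j). x $ i * cnj (y $ j))"

lemma outer_dim [simp]: "dim_row (outer x y) = dim_vec x" "dim_col (outer x y) = dim_vec y"
  by (auto simp: outer_def)

lemma adj_outer: "adj (outer x y) = outer y x"
  by (intro eq_matI) (auto simp: outer_def)

lemma outer_index [simp]: "i < dim_vec x \<Longrightarrow> j < dim_vec y \<Longrightarrow> outer x y $$ (i,j) = x $ i * cnj (y $ j)"
  by (auto simp: outer_def)

lemma outer_mult_vec:
  "dim_vec y = dim_vec z \<Longrightarrow> outer x y *\<^sub>v z = ip z y \<cdot>\<^sub>v x"
  by (intro eq_vecI)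
    (auto simp: mult_vec_index[of "outer x y" "dim_vec x" "dim_vec y"] ip_def
        sum_distrib_left algebra_simps simp del: index_mult_mat_vec intro!: sum.cong)

lemma mult_outer:
  assumes "dim_col A = dim_vec x"
  shows "A * outer x y = outer (A *\<^sub>v x) y"
  using assms
  by (intro mat_eq_vecI[of _ "dim_row A" "dim_vec y"]) (auto simp: mv_assoc mv_distrib outer_mult_vec)

lemma outer_mult:
  assumes "dim_row A = dim_vec y"
  shows "outer x y * A = outer x (adj A *\<^sub>v y)"
  using assms
  by (intro mat_eq_vecI[of _ "dim_vec x" "dim_col A"])
    (auto simp: mv_assoc mv_distrib outer_mult_vec ip_adj[of _ "dim_row A" "dim_col A"])

lemma outer_smult_left: "outer (c \<cdot>\<^sub>v x) y = c \<cdot>\<^sub>m outer x y"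
  by (intro eq_matI) (auto simp: outer_def)

lemma outer_smult_right: "outer x (c \<cdot>\<^sub>v y) = cnj c \<cdot>\<^sub>m outer x y"
  by (intro eq_matI) (auto simp: outer_def)

lemma outer_mult_outer:
  assumes "dim_vec y = dim_vec z"
  shows "outer x y * outer z w = ip z y \<cdot>\<^sub>m outer x w"
  using assms by (simp add: mult_outer outer_mult_vec outer_smult_left)

section \<open>Orthogonal projections\<close>

text \<open>On orthogonal projections this is the rank, the integer that is maximized or minimized
  in all extremal choices below.\<close>

definition trc :: "complex mat \<Rightarrow> complex" where
  "trc A = (\<Sum>i<dim_row A. A $$ (i,i))"

lemma trc_add: "dim_row A = dim_row B \<Longrightarrow> dim_col B = dim_row B \<Longrightarrow> trc (A + B) = trc A + trc B"
  by (auto simp: trc_def sum.distrib)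

lemma trc_minus: "dim_row A = dim_row B \<Longrightarrow> dim_col B = dim_row B \<Longrightarrow> trc (A - B) = trc A - trc B"
  by (auto simp: trc_def sum_subtractf)

lemma trc_one [simp]: "trc (1\<^sub>m n) = of_nat n"
  by (simp add: trc_def)

lemma trc_zero [simp]: "trc (0\<^sub>m n n) = 0"
  by (simp add: trc_def)

lemma trc_outer: "dim_vec x = dim_vec y \<Longrightarrow> trc (outer x y) = ip x y"
  by (simp add: trc_def ip_def)

lemma trc_comm:
  assumes "dim_col A = dim_row B" "dim_col B = dim_row A"
  shows "trc (A * B) = trc (B * A)"
proof -
  define n m where "n = dim_row A" and "m = dim_row B"
  have A: "A \<in> carrier_mat n m" "B \<in> carrier_mat m n" using assms by (auto simp: n_def m_def)
  have "trc (A * B) = (\<Sum>i<n. \<Sum>j<m. A $$ (i,j) * B $$ (j,i))"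
    using A by (simp add: trc_def mult_index[of A n m B n] del: index_mult_mat(1))
  also have "\<dots> = (\<Sum>j<m. \<Sum>i<n. A $$ (i,j) * B $$ (j,i))"
    by (rule sum.swap)
  also have "\<dots> = trc (B * A)"
    using A by (simp add: trc_def mult_index[of B m n A m] mult.commute del: index_mult_mat(1))
  finally show ?thesis .
qed

definition isproj :: "nat \<Rightarrow> complex mat \<Rightarrow> bool" where
  "isproj n p \<longleftrightarrow> p \<in> carrier_mat n n \<and> adj p = p \<and> p * p = p"

lemma isprojD: "isproj n p \<Longrightarrow> dim_row p = n" "isproj n p \<Longrightarrow> dim_col p = n"
    "isproj n p \<Longrightarrow> adj p = p" "isproj n p \<Longrightarrow> p * p = p"
  by (auto simp: isproj_def)

lemma isproj_one: "isproj n (1\<^sub>m n)" and isproj_zero: "isproj n (0\<^sub>m n n)"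
  by (auto simp: isproj_def)

lemma isproj_compl:
  assumes "isproj n p" shows "isproj n (1\<^sub>m n - p)"
proof -
  note p = isprojD[OF assms]
  have "p - (p - p) = p" using p by (intro eq_matI) auto
  moreover have "1\<^sub>m n - p - (p - p) = 1\<^sub>m n - p" using p by (intro eq_matI) auto
  ultimately show ?thesis
    using p by (auto simp: isproj_def adj_minus[of _ n n] mm_distrib)
qed

text \<open>The relation \<open>p * q = q\<close> says that the range of \<open>q\<close> lies in
  that of \<open>p\<close>; taking adjoints gives \<open>q * p = q\<close> as well.\<close>

lemma isproj_diff:
  assumes p: "isproj n p" and q: "isproj n q" and le: "p * q = q"
  shows "isproj n (p - q)"
proof -
  note p = isprojD[OF p] and q = isprojD[OF q]
  have "q * p = q" using adj_mult[of p n n q n] p q le by simp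
  moreover have "p - q - (q - q) = p - q" using p q by (intro eq_matI) auto
  ultimately show ?thesis
    using p q le by (auto simp: isproj_def adj_minus[of _ n n] mm_distrib)
qed

lemma isproj_add:
  assumes p: "isproj n p" and q: "isproj n q" and le: "p * q = 0\<^sub>m n n"
  shows "isproj n (p + q)"
proof -
  note p = isprojD[OF p] and q = isprojD[OF q]
  have "q * p = 0\<^sub>m n n" using adj_mult[of p n n q n] p q le by simp
  then show ?thesis
    using p q le by (auto simp: isproj_def adj_add[of _ n n] mm_distrib)
qed

lemma isproj_outer:
  assumes "u \<in> carrier_vec n" "ip u u = 1"
  shows "isproj n (outer u u)"
  using assms by (auto simp: isproj_def adj_outer outer_mult_outer mm_smult)

text \<open>Since \<open>p = p * adj p\<close>, the trace is the squared Hilbert-Schmidt norm. Hence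
  only the zero projection has trace 0.\<close>

lemma trc_isproj:
  assumes "isproj n p"
  shows "trc p = complex_of_real (\<Sum>i<n. \<Sum>j<n. (cmod (p $$ (i,j)))\<^sup>2)"
proof -
  note p = isprojD[OF assms]
  have "trc p = trc (p * adj p)" using p by simp
  also have "\<dots> = (\<Sum>i<n. \<Sum>j<n. p $$ (i,j) * cnj (p $$ (i,j)))"
    using p(1,2) by (simp add: trc_def mult_index[of p n n "adj p" n] del: index_mult_mat(1))
  finally show ?thesis by (simp only: complex_norm_square[symmetric] of_real_sum)
qed

lemma trc_isproj_eq_0:
  assumes "isproj n p" "trc p = 0"
  shows "p = 0\<^sub>m n n"
proof -
  note p = isprojD[OF assms(1)]
  have "(\<Sum>i<n. \<Sum>j<n. (cmod (p $$ (i,j)))\<^sup>2) = 0"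
    using trc_isproj[OF assms(1)] assms(2) by (metis of_real_eq_0_iff)
  then have "\<forall>i<n. \<forall>j<n. p $$ (i,j) = 0"
    by (simp add: sum_nonneg_eq_0_iff sum_nonneg)
  then show ?thesis using p by (intro eq_matI) auto
qed

text \<open>The difference is a projection of trace 0. This is how equality of ranks is turned into
  equality of nested projections.\<close>

lemma isproj_le_eqI:
  assumes p: "isproj n p" and q: "isproj n q" and le: "p * q = q" and tr: "trc p = trc q"
  shows "p = q"
proof -
  note pD = isprojD[OF p] and qD = isprojD[OF q]
  have "p - q = 0\<^sub>m n n"
    using isproj_diff[OF p q le] tr pD qD by (intro trc_isproj_eq_0) (auto simp: trc_minus)
  then have "(p - q) $$ (i,j) = 0" if "i < n" "j < n" for i j using that by simp
  then show ?thesis using pD qD by (intro eq_matI) auto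
qed

section \<open>Unitary matrices and block sums\<close>

lemma unitaryD: "unitary n U \<Longrightarrow> dim_row U = n" "unitary n U \<Longrightarrow> dim_col U = n"
    "unitary n U \<Longrightarrow> U * adj U = 1\<^sub>m n" "unitary n U \<Longrightarrow> adj U * U = 1\<^sub>m n"
  by (auto simp: unitary_def)

lemma unitary_one: "unitary n (1\<^sub>m n)"
  by (simp add: unitary_def)

lemma unitary_adj: "unitary n U \<Longrightarrow> unitary n (adj U)"
  by (auto simp: unitary_def)

lemma unitary_cancel:
  assumes "unitary n U"
  shows "dim_row A = n \<Longrightarrow> U * (adj U * A) = A" "dim_row A = n \<Longrightarrow> adj U * (U * A) = A"
    "dim_vec v = n \<Longrightarrow> U *\<^sub>v (adj U *\<^sub>v v) = v" "dim_vec v = n \<Longrightarrow> adj U *\<^sub>v (U *\<^sub>v v) = v"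
  using unitaryD[OF assms] by (auto simp: mm_assoc[symmetric] mv_assoc[symmetric])

lemma unitary_mult:
  assumes "unitary n U" "unitary n V"
  shows "unitary n (U * V)"
proof -
  note U = unitaryD[OF assms(1)] unitary_cancel[OF assms(1)] and V = unitaryD[OF assms(2)] unitary_cancel[OF assms(2)]
  show ?thesis using U V by (auto simp: unitary_def adj_mult[of _ n n] mm_assoc)
qed

lemma dsum_dim [simp]: "dim_row (dsum A B) = dim_row A + dim_row B" "dim_col (dsum A B) = dim_col A + dim_col B"
  by (auto simp: dsum_def)

lemma dsum_index:
  "i < dim_row A + dim_row B \<Longrightarrow> j < dim_col A + dim_col B \<Longrightarrow> dsum A B $$ (i,j) =
     (if i < dim_row A then if j < dim_col A then A $$ (i,j) else 0
      else if j < dim_col A then 0 else B $$ (i - dim_row A, j - dim_col A))"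
  by (auto simp: dsum_def)

lemma dsum_mult:
  assumes "dim_col A = dim_row C" "dim_col B = dim_row D"
  shows "dsum A B * dsum C D = dsum (A * C) (B * D)"
  unfolding dsum_def
  using assms
  by (subst mult_four_block_mat[of _ "dim_row A" "dim_col A" _ "dim_col B" _ "dim_row B" _ _ "dim_col C" _ "dim_col D"]) auto

lemma dsum_adj: "adj (dsum A B) = dsum (adj A) (adj B)"
  by (intro eq_matI) (auto simp: dsum_index)

lemma dsum_one: "dsum (1\<^sub>m n) (1\<^sub>m m) = 1\<^sub>m (n + m)"
  by (intro eq_matI) (auto simp: dsum_index)

lemma dsum_smult: "dsum (c \<cdot>\<^sub>m A) (c \<cdot>\<^sub>m B) = c \<cdot>\<^sub>m dsum A B"
  by (intro eq_matI) (auto simp: dsum_index)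

lemma dsum_add:
  "dim_row A = dim_row C \<Longrightarrow> dim_col A = dim_col C \<Longrightarrow> dim_row B = dim_row D \<Longrightarrow> dim_col B = dim_col D \<Longrightarrow>
     dsum (A + C) (B + D) = dsum A B + dsum C D"
  by (intro eq_matI) (auto simp: dsum_index)

lemma unitary_dsum:
  "unitary n U \<Longrightarrow> unitary m V \<Longrightarrow> unitary (n + m) (dsum U V)"
  by (auto simp: unitary_def dsum_adj dsum_mult dsum_one)

lemma trc_dsum: "dim_col A = dim_row A \<Longrightarrow> dim_col B = dim_row B \<Longrightarrow> trc (dsum A B) = trc A + trc B"
proof -
  assume A: "dim_col A = dim_row A" "dim_col B = dim_row B"
  have "trc (dsum A B) = (\<Sum>i<dim_row A + dim_row B. if i < dim_row A then A $$ (i,i) else B $$ (i - dim_row A, i - dim_row A))"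
    by (auto simp: trc_def dsum_def A intro!: sum.cong)
  also have "\<dots> = trc A + trc B"
    unfolding trc_def lessThan_atLeast0
    by (subst sum.atLeastLessThan_concat[of 0 "dim_row A", symmetric])
      (auto simp: sum.shift_bounds_nat_ivl[of _ 0 "dim_row A" "dim_row B", simplified add_0 add.commute[of "dim_row B"]])
  finally show ?thesis .
qed

section \<open>Diagonalization\<close>

lemma vnorm_smult: "vnorm (c \<cdot>\<^sub>v v) = cmod c * vnorm v"
  by (simp add: vnorm_def norm_mult power_mult_distrib sum_distrib_left[symmetric] real_sqrt_mult)

text \<open>The factor is kept real so that scaling does not destroy the real first coordinate that
  the reflection in \<open>unitary_first_column\<close> requires.\<close>

lemma exists_unit_multiple:
  assumes "v \<in> carrier_vec n" "v \<noteq> 0\<^sub>v n"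
  obtains c where "c \<noteq> 0" "ip (c \<cdot>\<^sub>v v) (c \<cdot>\<^sub>v v) = 1" "c \<in> \<real>"
proof -
  let ?c = "complex_of_real (1 / vnorm v)"
  have "vnorm v \<noteq> 0" using assms by (simp add: vnorm_eq_0[of _ n])
  then have "vnorm (?c \<cdot>\<^sub>v v) = 1" "?c \<noteq> 0" unfolding vnorm_smult by (auto simp: norm_divide)
  then show ?thesis using that[of ?c] by (simp add: ip_self)
qed

text \<open>A Householder reflection maps the first basis vector to \<open>u\<close>.\<close>

lemma unitary_first_column:
  fixes u :: "complex vec"
  assumes u: "u \<in> carrier_vec n" and n: "0 < n" and uu: "ip u u = 1" and re: "u $ 0 \<in> \<real>"
  obtains H where "unitary n H" "H *\<^sub>v unit_vec n 0 = u"
proof (cases "u = unit_vec n 0")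
  case True
  then show ?thesis using that[of "1\<^sub>m n"] unitary_one by auto
next
  case False
  define e :: "complex vec" where "e = unit_vec n 0"
  define v where "v = u - e"
  have d: "dim_vec u = n" "dim_vec e = n" "dim_vec v = n" using u by (auto simp: e_def v_def)
  have e1: "ip x e = x $ 0" for x
  proof -
    have "ip x e = (\<Sum>i<n. if i = 0 then x $ 0 else 0)"
      unfolding ip_def using d n by (intro sum.cong) (auto simp: e_def)
    then show ?thesis using n by simp
  qed
  have e2: "ip e x = cnj (x $ 0)" if "dim_vec x = n" for x
    using ip_cnj[of x n e] e1[of x] that d by simp
  have "v \<noteq> 0\<^sub>v n"
  proof
    assume "v = 0\<^sub>v n"
    then have "v $ i = 0" if "i < n" for i using that by simp
    then have "u = e" using d by (intro eq_vecI) (auto simp: v_def)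
    then show False using False by (simp add: e_def)
  qed
  then have vv0: "ip v v \<noteq> 0" using d by (simp add: ip_self_eq_0[of _ n])
  have e0: "e $ 0 = 1" using n by (simp add: e_def)
  have cu: "cnj (u $ 0) = u $ 0" using re by (simp add: Reals_cnj_iff)
  have vv: "ip v v = 2 - 2 * u $ 0"
    unfolding v_def using d uu e0 cu n by (simp add: ip_minus_left[of _ n] ip_minus_right[of _ n] e1 e2)
  have ev: "ip e v = u $ 0 - 1"
    unfolding v_def using d cu e0 by (simp add: ip_minus_right[of _ n] e1 e2)
  \<comment> \<open>Now \<open>ip v v = 2 - 2 * u $ 0\<close> and \<open>ip e v = u $ 0 - 1\<close>,
    so \<open>c * ip e v = - 1\<close> and the reflection sends \<open>e\<close> to
    \<open>e + v = u\<close>. For a non-real \<open>u $ 0\<close> this product would not be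
    \<open>- 1\<close>.\<close>
  define c where "c = 2 / ip v v"
  have cc: "cnj c = c" by (simp add: c_def ip_self)
  define H where "H = 1\<^sub>m n - c \<cdot>\<^sub>m outer v v"
  have aH: "adj H = H" unfolding H_def using d cc
    by (simp add: adj_minus[of _ n n] adj_smult adj_outer)
  have "H * H = 1\<^sub>m n"
  proof -
    have "c * ip v v = 2" using vv0 by (simp add: c_def)
    moreover have "1\<^sub>m n - c \<cdot>\<^sub>m outer v v - c \<cdot>\<^sub>m (outer v v - 2 \<cdot>\<^sub>m outer v v) = 1\<^sub>m n"
      using d by (intro eq_matI) auto
    ultimately show ?thesis
      unfolding H_def using d by (simp add: mm_distrib mm_smult outer_mult_outer)
  qed
  then have "unitary n H" using aH d by (simp add: unitary_def H_def)
  moreover have "H *\<^sub>v e = u"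
  proof -
    have "u $ 0 \<noteq> 1" using vv0 vv by auto
    then have "c * ip e v = - 1" unfolding c_def vv ev by (simp add: field_simps)
    then have "H *\<^sub>v e = e - (- 1) \<cdot>\<^sub>v v"
      unfolding H_def using d by (simp add: mv_distrib outer_mult_vec smult_smult_assoc)
    also have "\<dots> = u" using d by (intro eq_vecI) (auto simp: v_def)
    finally show ?thesis .
  qed
  ultimately show ?thesis using that e_def by blast
qed

text \<open>A unitary whose first column is a normalized eigenvector turns the first column of
  \<open>A\<close> into \<open>c\<close> followed by zeros. Being Hermitian then forces the same for
  the first row, and \<open>c\<close> to be real.\<close>

lemma hermitian_deflation:
  assumes A: "A \<in> carrier_mat (Suc n) (Suc n)" and aA: "adj A = A"
    and v: "v \<in> carrier_vec (Suc n)" "v \<noteq> 0\<^sub>v (Suc n)" and ev: "A *\<^sub>v v = c \<cdot>\<^sub>v v"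
  obtains H B where "unitary (Suc n) H" "B \<in> carrier_mat n n" "adj B = B" "c \<in> \<real>"
    "A = H * dsum (c \<cdot>\<^sub>m 1\<^sub>m 1) B * adj H"
proof -
  \<comment> \<open>Multiplication by \<open>cnj (v $ 0)\<close> makes the first coordinate real;
    the value 1 keeps the factor nonzero when that coordinate vanishes.\<close>
  define ph where "ph = (if v $ 0 = 0 then 1 else cnj (v $ 0))"
  have ph: "ph \<noteq> 0" "ph * v $ 0 \<in> \<real>"
    by (auto simp: ph_def mult.commute[of "cnj _"] complex_mult_cnj simp flip: of_real_power of_real_add)
  have "ph \<cdot>\<^sub>v v \<noteq> 0\<^sub>v (Suc n)"
    using v ph vnorm_smult[of ph v] vnorm_eq_0[of v "Suc n"] vnorm_eq_0[of "ph \<cdot>\<^sub>v v" "Suc n"] by auto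
  then obtain t where t: "t \<noteq> 0" "ip (t \<cdot>\<^sub>v (ph \<cdot>\<^sub>v v)) (t \<cdot>\<^sub>v (ph \<cdot>\<^sub>v v)) = 1" "t \<in> \<real>"
    using exists_unit_multiple[of "ph \<cdot>\<^sub>v v" "Suc n"] v by auto
  define u where "u = t \<cdot>\<^sub>v (ph \<cdot>\<^sub>v v)"
  have "t * (ph * v $ 0) \<in> \<real>" by (rule Reals_mult[OF t(3) ph(2)])
  moreover have "A *\<^sub>v u = t \<cdot>\<^sub>v (ph \<cdot>\<^sub>v (c \<cdot>\<^sub>v v))" using v A ev by (simp add: u_def mv_distrib)
  ultimately have u: "u \<in> carrier_vec (Suc n)" "u $ 0 \<in> \<real>" "ip u u = 1" "A *\<^sub>v u = c \<cdot>\<^sub>v u"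
    using v t by (auto simp: u_def smult_smult_assoc ac_simps)
  from unitary_first_column[OF u(1) _ u(3) u(2)] obtain H
    where H: "unitary (Suc n) H" "H *\<^sub>v unit_vec (Suc n) 0 = u" by auto
  note Hd = unitaryD[OF H(1)] unitary_cancel[OF H(1)]
  define C where "C = adj H * A * H"
  have dC: "dim_row C = Suc n" "dim_col C = Suc n" using Hd by (auto simp: C_def)
  have aC: "adj C = C" using Hd A aA by (simp add: C_def adj_mult[of _ "Suc n" "Suc n"] mm_assoc)
  have "C *\<^sub>v unit_vec (Suc n) 0 = c \<cdot>\<^sub>v unit_vec (Suc n) 0"
  proof -
    have "adj H *\<^sub>v u = unit_vec (Suc n) 0" using Hd(8)[of "unit_vec (Suc n) 0"] unfolding H(2) by simp
    then show ?thesis using Hd(1,2) A u(1,4) H(2) by (simp add: C_def mv_assoc mv_distrib)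
  qed
  then have c0: "C $$ (i,0) = (if i = 0 then c else 0)" if "i < Suc n" for i
    using that dC mult_unit_vec_index[of C "Suc n" "Suc n" i 0] by auto
  have c0': "C $$ (0,j) = (if j = 0 then cnj c else 0)" if "j < Suc n" for j
    using that dC c0[of j] adj_index[of 0 C j] by (auto simp: aC)
  have c: "c \<in> \<real>" using c0[of 0] c0'[of 0] by (simp add: Reals_cnj_iff)
  define B where "B = mat n n (\<lambda>(i,j). C $$ (Suc i, Suc j))"
  have CB: "C = dsum (c \<cdot>\<^sub>m 1\<^sub>m 1) B"
    using dC c0 c0' c by (intro eq_matI) (auto simp: dsum_index B_def Reals_cnj_iff)
  have "adj B = B"
  proof (rule eq_matI)
    fix i j assume "i < dim_row B" "j < dim_col B"
    then show "adj B $$ (i, j) = B $$ (i, j)"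
      using adj_index[of "Suc i" C "Suc j"] dC by (simp add: B_def aC)
  qed (auto simp: B_def)
  moreover have "A = H * dsum (c \<cdot>\<^sub>m 1\<^sub>m 1) B * adj H"
    unfolding CB[symmetric] C_def using Hd A by (simp add: mm_assoc)
  ultimately show ?thesis using that[OF H(1) _ _ c, of B] by (simp add: B_def)
qed

definition diagm :: "nat \<Rightarrow> (nat \<Rightarrow> complex) \<Rightarrow> complex mat" where
  "diagm n d = mat n n (\<lambda>(i,j). if i = j then d i else 0)"

lemma diagm_dim [simp]: "dim_row (diagm n d) = n" "dim_col (diagm n d) = n"
  by (auto simp: diagm_def)

lemma diagm_index [simp]: "i < n \<Longrightarrow> j < n \<Longrightarrow> diagm n d $$ (i,j) = (if i = j then d i else 0)"
  by (auto simp: diagm_def)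

text \<open>Moves the unitaries of the two blocks into the outer one, which is the induction step of
  both diagonalizations below.\<close>

lemma conj_dsum_mult:
  assumes "unitary (n + m) H" "unitary n U" "unitary m V" "A \<in> carrier_mat n n" "B \<in> carrier_mat m m"
  shows "H * dsum (U * A * adj U) (V * B * adj V) * adj H =
    (H * dsum U V) * dsum A B * adj (H * dsum U V)"
  using unitaryD[OF assms(1)] unitaryD(1,2)[OF assms(2)] unitaryD(1,2)[OF assms(3)] assms(4,5)
  by (simp add: adj_mult[of _ "n+m" "n+m"] mm_assoc dsum_adj flip: dsum_mult)

theorem hermitian_diagonalization:
  assumes "A \<in> carrier_mat n n" "adj A = A"
  obtains W and d :: "nat \<Rightarrow> real" where "unitary n W" "A = W * diagm n (\<lambda>i. of_real (d i)) * adj W"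
  using assms
proof (induction n arbitrary: A thesis)
  case 0
  then show ?case using unitary_one[of 0] by (intro "0.prems"(1)[of "1\<^sub>m 0"]) auto
next
  case (Suc n)
  have "spectrum A \<noteq> {}" using spectrum_non_empty[OF Suc.prems(2)] by simp
  then obtain c v where "eigenvector A v c" unfolding spectrum_def eigenvalue_def by auto
  then have v: "v \<in> carrier_vec (Suc n)" "v \<noteq> 0\<^sub>v (Suc n)" "A *\<^sub>v v = c \<cdot>\<^sub>v v"
    using Suc.prems(2) by (auto simp: eigenvector_def)
  obtain H B where H: "unitary (Suc n) H" "B \<in> carrier_mat n n" "adj B = B" "c \<in> \<real>"
    "A = H * dsum (c \<cdot>\<^sub>m 1\<^sub>m 1) B * adj H"
    using hermitian_deflation[OF Suc.prems(2,3) v] by blast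
  obtain W d where W: "unitary n W" "B = W * diagm n (\<lambda>i. of_real (d i)) * adj W"
    using Suc.IH[OF _ H(2,3)] by blast
  define d' where "d' i = (case i of 0 \<Rightarrow> Re c | Suc i \<Rightarrow> d i)" for i
  have "dsum (c \<cdot>\<^sub>m 1\<^sub>m 1) (diagm n (\<lambda>i. of_real (d i))) = diagm (Suc n) (\<lambda>i. of_real (d' i))"
    using H(4) by (intro eq_matI) (auto simp: dsum_index d'_def split: nat.split elim!: Reals_cases)
  moreover have "A = H * dsum (1\<^sub>m 1 * (c \<cdot>\<^sub>m 1\<^sub>m 1) * adj (1\<^sub>m 1)) (W * diagm n (\<lambda>i. of_real (d i)) * adj W) * adj H"
    using H(5) W(2) by simp
  ultimately have "A = (H * dsum (1\<^sub>m 1) W) * diagm (Suc n) (\<lambda>i. of_real (d' i)) * adj (H * dsum (1\<^sub>m 1) W)"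
    using conj_dsum_mult[of 1 n H "1\<^sub>m 1" W] H(1) W(1) unitary_one by simp
  moreover have "unitary (Suc n) (H * dsum (1\<^sub>m 1) W)"
    using unitary_mult[OF H(1)] unitary_dsum[OF unitary_one[of 1] W(1)] by simp
  ultimately show ?case using Suc.prems(1) by blast
qed

text \<open>Deflation is repeated with eigenvectors \<open>p *\<^sub>v w\<close> for the eigenvalue
  1, so the ones come first without reordering the diagonal. The remaining block is again a
  projection, and the process stops when it is zero.\<close>

lemma isproj_diagonalization:
  assumes "isproj n p"
  obtains U r where "unitary n U" "r \<le> n" "p = U * dsum (1\<^sub>m r) (0\<^sub>m (n - r) (n - r)) * adj U"
  using assms
proof (induction n arbitrary: p thesis)
  case 0
  then show ?case using unitary_one[of 0] isprojD[OF 0(2)] by (intro 0(1)[of "1\<^sub>m 0" 0]) auto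
next
  case (Suc n)
  note p = isprojD[OF Suc.prems(2)]
  show ?case
  proof (cases "p = 0\<^sub>m (Suc n) (Suc n)")
    case True
    moreover have "dsum (1\<^sub>m 0) (0\<^sub>m (Suc n) (Suc n)) = (0\<^sub>m (Suc n) (Suc n) :: complex mat)"
      by (intro eq_matI) (auto simp: dsum_index)
    ultimately show ?thesis using unitary_one[of "Suc n"] by (intro Suc.prems(1)[of "1\<^sub>m (Suc n)" 0]) auto
  next
    case False
    then obtain w where w: "w \<in> carrier_vec (Suc n)" "p *\<^sub>v w \<noteq> 0\<^sub>v (Suc n)"
      using mat_eq_zeroI[of p "Suc n" "Suc n"] p by auto
    have "p *\<^sub>v (p *\<^sub>v w) = 1 \<cdot>\<^sub>v (p *\<^sub>v w)" using p w by (simp flip: mv_assoc)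
    then obtain H B where H: "unitary (Suc n) H" "B \<in> carrier_mat n n" "adj B = B"
      "p = H * dsum (1 \<cdot>\<^sub>m 1\<^sub>m 1) B * adj H"
      using hermitian_deflation[of p n "p *\<^sub>v w" 1] p w by auto
    note Hd = unitaryD[OF H(1)] unitary_cancel[OF H(1)]
    have one: "(1::complex) \<cdot>\<^sub>m 1\<^sub>m 1 = 1\<^sub>m 1" by (rule mm_smult(4))
    have *: "dsum (1\<^sub>m 1) B = adj H * p * H"
      unfolding H(4) one using Hd H(2) by (simp add: mm_assoc)
    have "dsum (1\<^sub>m 1) (B * B) = dsum (1\<^sub>m 1) B * dsum (1\<^sub>m 1) B"
      using H(2) by (simp add: dsum_mult)
    also have "\<dots> = adj H * (p * p) * H"
      unfolding * using Hd p(1,2) by (simp add: mm_assoc)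
    also have "\<dots> = dsum (1\<^sub>m 1) B" unfolding * p(4) ..
    finally have **: "dsum (1\<^sub>m 1) (B * B) = dsum (1\<^sub>m 1) B" .
    have "B * B = B"
    proof (rule eq_matI)
      fix i j assume ij: "i < dim_row B" "j < dim_col B"
      then have "dsum (1\<^sub>m 1) (B * B) $$ (Suc i, Suc j) = (B * B) $$ (i,j)"
        "dsum (1\<^sub>m 1) B $$ (Suc i, Suc j) = B $$ (i,j)"
        using H(2) by (auto simp: dsum_index)
      then show "(B * B) $$ (i,j) = B $$ (i,j)" using ** by simp
    qed auto
    then have "isproj n B" using H by (simp add: isproj_def)
    then obtain U r where U: "unitary n U" "r \<le> n" "B = U * dsum (1\<^sub>m r) (0\<^sub>m (n - r) (n - r)) * adj U"
      using Suc.IH by blast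
    have "p = H * dsum (1\<^sub>m 1 * 1\<^sub>m 1 * adj (1\<^sub>m 1)) (U * dsum (1\<^sub>m r) (0\<^sub>m (n - r) (n - r)) * adj U) * adj H"
      using H(4) U(3) one by simp
    also have "\<dots> = (H * dsum (1\<^sub>m 1) U) * dsum (1\<^sub>m 1) (dsum (1\<^sub>m r) (0\<^sub>m (n - r) (n - r))) * adj (H * dsum (1\<^sub>m 1) U)"
      using conj_dsum_mult[of 1 n H "1\<^sub>m 1" U] H(1) U(1,2) unitary_one by simp
    also have "dsum (1\<^sub>m 1) (dsum (1\<^sub>m r) (0\<^sub>m (n - r) (n - r))) = dsum (1\<^sub>m (Suc r)) (0\<^sub>m (n - r) (n - r) :: complex mat)"
      by (intro eq_matI) (auto simp: dsum_index)
    finally show ?thesis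
      using Suc.prems(1)[of "H * dsum (1\<^sub>m 1) U" "Suc r"] U(2)
        unitary_mult[OF H(1)] unitary_dsum[OF unitary_one[of 1] U(1)] by simp
  qed
qed

lemma trc_isproj_nat:
  assumes "isproj n p"
  obtains r where "trc p = of_nat r" "r \<le> n"
proof -
  obtain U r where U: "unitary n U" "r \<le> n" "p = U * dsum (1\<^sub>m r) (0\<^sub>m (n - r) (n - r)) * adj U"
    using isproj_diagonalization[OF assms] .
  have "trc p = of_nat r"
    unfolding U(3) using unitaryD[OF U(1)] U(2)
    by (subst trc_comm) (auto simp: trc_dsum unitary_cancel[OF U(1)])
  then show ?thesis using that U(2) by blast
qed

lemma isproj_trc_le:
  assumes "isproj n p" "isproj n q" "p * q = q" "trc p = of_nat a" "trc q = of_nat b"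
  shows "b \<le> a"
proof -
  obtain r where "trc (p - q) = of_nat r" using trc_isproj_nat[OF isproj_diff[OF assms(1-3)]] by blast
  then have "of_nat a - of_nat b = (of_nat r :: complex)"
    using assms isprojD[OF assms(1)] isprojD[OF assms(2)] by (simp add: trc_minus)
  then have "of_nat a = (of_nat (b + r) :: complex)" by (simp add: algebra_simps)
  then have "a = b + r" by (simp only: of_nat_eq_iff)
  then show ?thesis by simp
qed

text \<open>A projection of maximal rank among those with range in \<open>K\<close> is onto.\<close>

lemma subspace_projection:
  assumes K: "K \<subseteq> carrier_vec n" "0\<^sub>v n \<in> K" "\<And>v w. v \<in> K \<Longrightarrow> w \<in> K \<Longrightarrow> v + w \<in> K" "\<And>c v. v \<in> K \<Longrightarrow> c \<cdot>\<^sub>v v \<in> K"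
  obtains p where "isproj n p" "\<And>v. v \<in> carrier_vec n \<Longrightarrow> p *\<^sub>v v \<in> K" "\<And>v. v \<in> K \<Longrightarrow> p *\<^sub>v v = v"
proof -
  define R where "R r \<longleftrightarrow> (\<exists>p. isproj n p \<and> (\<forall>v\<in>carrier_vec n. p *\<^sub>v v \<in> K) \<and> trc p = of_nat r)" for r :: nat
  have "R 0" unfolding R_def using K(2) isproj_zero by (intro exI[of _ "0\<^sub>m n n"]) auto
  moreover have bd: "r \<le> n" if "R r" for r
    using that unfolding R_def by (metis trc_isproj_nat of_nat_eq_iff)
  ultimately have Rm: "R (GREATEST r. R r)" and Rmax: "\<And>r. R r \<Longrightarrow> r \<le> (GREATEST r. R r)"
    by (blast intro: GreatestI_nat Greatest_le_nat)+
  then obtain p where p: "isproj n p" "\<And>v. v \<in> carrier_vec n \<Longrightarrow> p *\<^sub>v v \<in> K" "trc p = of_nat (GREATEST r. R r)"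
    unfolding R_def by blast
  note pD = isprojD[OF p(1)]
  have "p *\<^sub>v v = v" if v: "v \<in> K" for v
  proof (rule ccontr)
    assume ne: "p *\<^sub>v v \<noteq> v"
    have dv: "dim_vec v = n" using v K(1) by auto
    \<comment> \<open>The component of \<open>v\<close> orthogonal to the range of \<open>p\<close>
      is still in \<open>K\<close>. Adding the rank one projection onto it would give a projection
      of larger rank with range in \<open>K\<close>.\<close>
    define y where "y = v - p *\<^sub>v v"
    have dy: "dim_vec y = n" using dv pD by (simp add: y_def)
    have "y = v + (-1) \<cdot>\<^sub>v (p *\<^sub>v v)" using dv pD by (intro eq_vecI) (auto simp: y_def)
    then have yK: "y \<in> K" using K v p(2) dv by auto
    have "y \<noteq> 0\<^sub>v n"
    proof
      assume "y = 0\<^sub>v n"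
      then have "y $ i = 0" if "i < n" for i using that by simp
      then have "p *\<^sub>v v = v" using dv pD by (intro eq_vecI) (auto simp: y_def)
      then show False using ne by simp
    qed
    then obtain c where c: "c \<noteq> 0" "ip (c \<cdot>\<^sub>v y) (c \<cdot>\<^sub>v y) = 1"
      using exists_unit_multiple[of y n] dy by auto
    define x where "x = c \<cdot>\<^sub>v y"
    have x: "dim_vec x = n" "ip x x = 1" "x \<in> K" using c dy yK K(4) by (auto simp: x_def)
    have "p *\<^sub>v y = p *\<^sub>v v - p *\<^sub>v (p *\<^sub>v v)" unfolding y_def using dv pD by (simp add: mv_distrib)
    also have "\<dots> = 0\<^sub>v n" using dv pD by (simp flip: mv_assoc)
    finally have px: "p *\<^sub>v x = 0\<^sub>v n" using dy pD by (simp add: x_def mv_distrib)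
    have q: "isproj n (outer x x)" using x by (intro isproj_outer) auto
    have "p * outer x x = 0\<^sub>m n n"
      using x pD px by (simp add: mult_outer) (intro eq_matI, auto)
    then have pq: "isproj n (p + outer x x)" by (rule isproj_add[OF p(1) q])
    have "trc (p + outer x x) = of_nat (Suc (GREATEST r. R r))"
      using p(3) x pD by (simp add: trc_add trc_outer)
    moreover have "(p + outer x x) *\<^sub>v z \<in> K" if "z \<in> carrier_vec n" for z
      using that x pD K p(2)[OF that] by (simp add: mv_distrib outer_mult_vec)
    ultimately have "R (Suc (GREATEST r. R r))" using pq unfolding R_def by blast
    then show False using Rmax by fastforce
  qed
  then show ?thesis using that p by blast
qed

section \<open>Functional calculus for Hermitian matrices\<close>

definition herm :: "nat \<Rightarrow> complex mat \<Rightarrow> bool" where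
  "herm n A \<longleftrightarrow> A \<in> carrier_mat n n \<and> adj A = A"

text \<open>One diagonalization is fixed per matrix, before any function \<open>\<psi>\<close> is
  applied, so that algebraic laws and limits of \<open>fc\<close> reduce to the diagonal entries.
  The value of \<open>fc\<close> does not depend on the choice, by \<open>fc_eigvec\<close>.\<close>

definition spec :: "complex mat \<Rightarrow> complex mat \<times> (nat \<Rightarrow> real)" where
  "spec A = (SOME (W,d). unitary (dim_row A) W \<and>
      A = W * diagm (dim_row A) (\<lambda>i. of_real (d i)) * adj W)"

definition fc :: "(real \<Rightarrow> complex) \<Rightarrow> complex mat \<Rightarrow> complex mat" where
  "fc \<psi> A = fst (spec A) * diagm (dim_row A) (\<lambda>i. \<psi> (snd (spec A) i)) * adj (fst (spec A))"

lemma fc_witness: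
  assumes "herm n A"
  obtains W d where "unitary n W" "A = W * diagm n (\<lambda>i. of_real (d i)) * adj W"
    "\<forall>\<psi>. fc \<psi> A = W * diagm n (\<lambda>i. \<psi> (d i)) * adj W"
proof -
  have A: "A \<in> carrier_mat n n" "adj A = A" using assms by (auto simp: herm_def)
  have n: "dim_row A = n" using A(1) by simp
  obtain W0 d0 where W0: "unitary n W0" "A = W0 * diagm n (\<lambda>i. of_real (d0 i)) * adj W0"
    using hermitian_diagonalization[OF A] .
  obtain W d where sp: "spec A = (W,d)" by fastforce
  have "case spec A of (W,d) \<Rightarrow> unitary (dim_row A) W \<and>
      A = W * diagm (dim_row A) (\<lambda>i. of_real (d i)) * adj W"
    unfolding spec_def
    by (rule someI_ex, rule exI[of _ "(W0,d0)"]) (simp only: prod.case n W0(1) W0(2)[symmetric] simp_thms)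
  then have W: "unitary n W" "A = W * diagm n (\<lambda>i. of_real (d i)) * adj W"
    unfolding sp prod.case n by blast+
  show ?thesis by (rule that[OF W]) (simp only: fc_def sp n fst_conv snd_conv simp_thms)
qed

lemma diagm_mult: "diagm n a * diagm n b = diagm n (\<lambda>i. a i * b i)"
  by (intro eq_matI)
    (auto simp: mult_index[of _ n n _ n] if_distrib[of "\<lambda>x. x * _"] if_distrib[of "\<lambda>x. _ * x"] sum.delta'
      simp del: index_mult_mat(1) cong: if_cong)

lemma diagm_add: "diagm n a + diagm n b = diagm n (\<lambda>i. a i + b i)"
  and diagm_const: "diagm n (\<lambda>_. c) = c \<cdot>\<^sub>m 1\<^sub>m n"
  and adj_diagm: "adj (diagm n a) = diagm n (\<lambda>i. cnj (a i))"
  by (intro eq_matI; auto)+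

lemma diagm_mult_vec_index: "i < n \<Longrightarrow> dim_vec v = n \<Longrightarrow> (diagm n a *\<^sub>v v) $ i = a i * v $ i"
  by (auto simp: mult_vec_index[of _ n n] if_distrib[of "\<lambda>x. x * _"] sum.delta'
      simp del: index_mult_mat_vec cong: if_cong)

lemma conj_mult:
  assumes "unitary n W" "A \<in> carrier_mat n n" "B \<in> carrier_mat n n"
  shows "W * A * adj W * (W * B * adj W) = W * (A * B) * adj W"
  using unitaryD[OF assms(1)] unitary_cancel[OF assms(1)] assms(2,3) by (simp add: mm_assoc)

lemma conj_add:
  assumes "unitary n W" "A \<in> carrier_mat n n" "B \<in> carrier_mat n n"
  shows "W * A * adj W + W * B * adj W = W * (A + B) * adj W"
  using unitaryD[OF assms(1)] assms(2,3) by (simp add: mm_distrib)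

lemma fc_dim [simp]: "dim_row (fc \<psi> A) = dim_row (fst (spec A))" "dim_col (fc \<psi> A) = dim_row (fst (spec A))"
  by (auto simp: fc_def)

lemma fc_carrier: assumes "herm n A" shows "fc \<psi> A \<in> carrier_mat n n"
proof -
  obtain W d where W: "unitary n W" "A = W * diagm n (\<lambda>i. of_real (d i)) * adj W"
    "\<forall>\<psi>. fc \<psi> A = W * diagm n (\<lambda>i. \<psi> (d i)) * adj W" using fc_witness[OF assms] .
  show ?thesis unfolding W(3)[rule_format] using unitaryD[OF W(1)] by simp
qed

lemma fc_mult: assumes "herm n A" shows "fc \<psi> A * fc \<phi> A = fc (\<lambda>t. \<psi> t * \<phi> t) A"
proof -
  obtain W d where W: "unitary n W" "A = W * diagm n (\<lambda>i. of_real (d i)) * adj W"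
    "\<forall>\<psi>. fc \<psi> A = W * diagm n (\<lambda>i. \<psi> (d i)) * adj W" using fc_witness[OF assms] .
  show ?thesis unfolding W(3)[rule_format] using conj_mult[OF W(1)] by (simp add: diagm_mult)
qed

lemma fc_add: assumes "herm n A" shows "fc \<psi> A + fc \<phi> A = fc (\<lambda>t. \<psi> t + \<phi> t) A"
proof -
  obtain W d where W: "unitary n W" "A = W * diagm n (\<lambda>i. of_real (d i)) * adj W"
    "\<forall>\<psi>. fc \<psi> A = W * diagm n (\<lambda>i. \<psi> (d i)) * adj W" using fc_witness[OF assms] .
  show ?thesis unfolding W(3)[rule_format] using conj_add[OF W(1)] by (simp add: diagm_add)
qed

lemma fc_const: assumes "herm n A" shows "fc (\<lambda>_. c) A = c \<cdot>\<^sub>m 1\<^sub>m n"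
proof -
  obtain W d where W: "unitary n W" "A = W * diagm n (\<lambda>i. of_real (d i)) * adj W"
    "\<forall>\<psi>. fc \<psi> A = W * diagm n (\<lambda>i. \<psi> (d i)) * adj W" using fc_witness[OF assms] .
  show ?thesis unfolding W(3)[rule_format] using unitaryD[OF W(1)] by (simp add: diagm_const mm_smult)
qed

lemma fc_smult: assumes "herm n A" shows "c \<cdot>\<^sub>m fc \<psi> A = fc (\<lambda>t. c * \<psi> t) A"
  using fc_mult[OF assms, of "\<lambda>_. c" \<psi>] fc_carrier[OF assms, of \<psi>]
  by (simp add: fc_const[OF assms] mm_smult del: fc_dim)

lemma fc_id: assumes "herm n A" shows "fc of_real A = A"
proof -
  obtain W d where W: "unitary n W" "A = W * diagm n (\<lambda>i. of_real (d i)) * adj W"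
    "\<forall>\<psi>. fc \<psi> A = W * diagm n (\<lambda>i. \<psi> (d i)) * adj W" using fc_witness[OF assms] .
  show ?thesis unfolding W(3)[rule_format] W(2)[symmetric] ..
qed

lemma fc_adj: assumes "herm n A" shows "adj (fc \<psi> A) = fc (\<lambda>t. cnj (\<psi> t)) A"
proof -
  obtain W d where W: "unitary n W" "A = W * diagm n (\<lambda>i. of_real (d i)) * adj W"
    "\<forall>\<psi>. fc \<psi> A = W * diagm n (\<lambda>i. \<psi> (d i)) * adj W" using fc_witness[OF assms] .
  show ?thesis unfolding W(3)[rule_format] using unitaryD[OF W(1)] by (simp add: adj_mult[of _ n n] mm_assoc adj_diagm)
qed

lemma fc_isproj:
  assumes "herm n A" shows "isproj n (fc (\<lambda>t. if P t then 1 else 0) A)"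
  unfolding isproj_def using fc_carrier[OF assms]
  by (auto simp: fc_mult[OF assms] fc_adj[OF assms] if_distrib[of cnj] if_distrib[of "\<lambda>x. x * _"] cong: if_cong)

text \<open>In the diagonalizing basis an eigenvector for \<open>\<mu>\<close> is supported on the
  coordinates with \<open>d i = \<mu>\<close>, and there
  \<open>\<psi> (d i) = \<psi> \<mu>\<close>.\<close>

lemma fc_eigvec:
  assumes A: "herm n A" and v: "v \<in> carrier_vec n" and ev: "A *\<^sub>v v = of_real \<mu> \<cdot>\<^sub>v v"
  shows "fc \<psi> A *\<^sub>v v = \<psi> \<mu> \<cdot>\<^sub>v v"
proof -
  obtain W d where W: "unitary n W" "A = W * diagm n (\<lambda>i. of_real (d i)) * adj W"
    "\<forall>\<psi>. fc \<psi> A = W * diagm n (\<lambda>i. \<psi> (d i)) * adj W" using fc_witness[OF A] .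
  note Wd = unitaryD[OF W(1)] unitary_cancel[OF W(1)]
  define y where "y = adj W *\<^sub>v v"
  have dy: "dim_vec y = n" using Wd by (simp add: y_def)
  have "diagm n (\<lambda>i. of_real (d i)) *\<^sub>v y = adj W *\<^sub>v (A *\<^sub>v v)"
    unfolding y_def W(2) using Wd v by (simp add: mv_assoc)
  also have "\<dots> = of_real \<mu> \<cdot>\<^sub>v y" unfolding ev y_def using Wd v by (simp add: mv_distrib)
  finally have *: "diagm n (\<lambda>i. of_real (d i)) *\<^sub>v y = of_real \<mu> \<cdot>\<^sub>v y" .
  have "\<psi> (d i) * y $ i = \<psi> \<mu> * y $ i" if "i < n" for i
  proof -
    have "of_real (d i) * y $ i = of_real \<mu> * y $ i"
      using arg_cong[OF *, of "\<lambda>v. v $ i"] that dy by (simp add: diagm_mult_vec_index del: index_mult_mat_vec)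
    then show ?thesis by auto
  qed
  then have "diagm n (\<lambda>i. \<psi> (d i)) *\<^sub>v y = \<psi> \<mu> \<cdot>\<^sub>v y"
    using dy by (intro eq_vecI) (auto simp: diagm_mult_vec_index simp del: index_mult_mat_vec)
  then have "fc \<psi> A *\<^sub>v v = W *\<^sub>v (\<psi> \<mu> \<cdot>\<^sub>v y)"
    unfolding W(3)[rule_format] using Wd v by (simp add: mv_assoc y_def)
  also have "\<dots> = \<psi> \<mu> \<cdot>\<^sub>v v" unfolding y_def using Wd v by (simp add: mv_distrib)
  finally show ?thesis .
qed

lemma fc_scalar:
  "fc \<psi> (of_real c \<cdot>\<^sub>m 1\<^sub>m n) = \<psi> c \<cdot>\<^sub>m 1\<^sub>m n"
proof -
  have h: "herm n (of_real c \<cdot>\<^sub>m 1\<^sub>m n)" by (simp add: herm_def adj_smult)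
  show ?thesis
    using fc_carrier[OF h] by (intro mat_eq_vecI[of _ n n]) (auto simp: mv_distrib fc_eigvec[OF h] simp del: fc_dim)
qed

lemma conj_diagm_index:
  assumes "W \<in> carrier_mat n n" "i < n" "j < n"
  shows "(W * diagm n a * adj W) $$ (i,j) = (\<Sum>k<n. W $$ (i,k) * a k * cnj (W $$ (j,k)))"
proof -
  have "(W * diagm n a) $$ (i,k) = W $$ (i,k) * a k" if "k < n" for k
    using assms that
    by (simp add: mult_index[of W n n _ n] if_distrib[of "\<lambda>x. _ * x"] sum.delta' del: index_mult_mat(1) cong: if_cong)
  then show ?thesis using assms by (simp add: mult_index[of "W * diagm n a" n n _ n] del: index_mult_mat(1))
qed

lemma fc_tendsto:
  assumes A: "herm n A" and lim: "\<And>t. (\<lambda>m. \<psi> m t) \<longlonglongrightarrow> \<phi> t" and ij: "i < n" "j < n"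
  shows "(\<lambda>m. fc (\<psi> m) A $$ (i,j)) \<longlonglongrightarrow> fc \<phi> A $$ (i,j)"
proof -
  obtain W d where W: "unitary n W" "A = W * diagm n (\<lambda>i. of_real (d i)) * adj W"
    "\<forall>\<psi>. fc \<psi> A = W * diagm n (\<lambda>i. \<psi> (d i)) * adj W" using fc_witness[OF A] .
  show ?thesis unfolding W(3)[rule_format] using unitaryD[OF W(1)] ij
    by (simp add: conj_diagm_index del: index_mult_mat(1)) (intro tendsto_intros lim)
qed

text \<open>The columns of the diagonalizing unitary are eigenvectors, so every \<open>d i\<close>
  that enters \<open>fc\<close> is an eigenvalue covered by the hypothesis.\<close>

lemma fc_cong_eigenvalues:
  assumes A: "herm n A"
    and eq: "\<And>\<mu> v. v \<in> carrier_vec n \<Longrightarrow> v \<noteq> 0\<^sub>v n \<Longrightarrow> A *\<^sub>v v = of_real \<mu> \<cdot>\<^sub>v v \<Longrightarrow> \<psi> \<mu> = \<phi> \<mu>"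
  shows "fc \<psi> A = fc \<phi> A"
proof -
  obtain W d where W: "unitary n W" "A = W * diagm n (\<lambda>i. of_real (d i)) * adj W"
    "\<forall>\<psi>. fc \<psi> A = W * diagm n (\<lambda>i. \<psi> (d i)) * adj W" using fc_witness[OF A] .
  note Wd = unitaryD[OF W(1)] unitary_cancel[OF W(1)]
  have "\<psi> (d i) = \<phi> (d i)" if i: "i < n" for i
  proof (rule eq)
    let ?v = "W *\<^sub>v unit_vec n i"
    show "?v \<in> carrier_vec n" using Wd by simp
    show "?v \<noteq> 0\<^sub>v n"
    proof
      assume "?v = 0\<^sub>v n"
      then have "unit_vec n i = adj W *\<^sub>v 0\<^sub>v n" using Wd(8)[of "unit_vec n i"] by simp
      then have "unit_vec n i $ i = (0 :: complex)" using Wd i by simp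
      then show False using i by simp
    qed
    have "diagm n (\<lambda>i. of_real (d i)) *\<^sub>v unit_vec n i = of_real (d i) \<cdot>\<^sub>v unit_vec n i"
      using i by (intro eq_vecI) (auto simp: diagm_mult_vec_index simp del: index_mult_mat_vec)
    then show "A *\<^sub>v ?v = of_real (d i) \<cdot>\<^sub>v ?v"
      unfolding W(2) using Wd by (simp add: mv_assoc mv_distrib)
  qed
  then have "diagm n (\<lambda>i. \<psi> (d i)) = diagm n (\<lambda>i. \<phi> (d i))" by (intro eq_matI) auto
  then show ?thesis unfolding W(3)[rule_format] by simp
qed

lemma fc_eq_eigenvalue:
  assumes A: "herm n A" and "fc \<psi> A = fc \<phi> A"
    and v: "v \<in> carrier_vec n" "v \<noteq> 0\<^sub>v n" "A *\<^sub>v v = of_real \<mu> \<cdot>\<^sub>v v"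
  shows "\<psi> \<mu> = \<phi> \<mu>"
proof -
  have "\<psi> \<mu> \<cdot>\<^sub>v v = \<phi> \<mu> \<cdot>\<^sub>v v" using fc_eigvec[OF A v(1,3)] assms(2) by metis
  then have "ip (\<psi> \<mu> \<cdot>\<^sub>v v) v = ip (\<phi> \<mu> \<cdot>\<^sub>v v) v" by simp
  then have "\<psi> \<mu> * ip v v = \<phi> \<mu> * ip v v" using v by (simp add: ip_smult_left[of _ n])
  then show ?thesis using v ip_self_eq_0[of v n] by simp
qed

lemma fc_indicator_isproj: "herm n A \<Longrightarrow> isproj n (fc (indicator S) A)"
  using fc_isproj[of n A "\<lambda>t. t \<in> S"] by (simp add: indicator_def[abs_def] of_bool_def)

section \<open>The operator norm\<close>

lemma vnorm_cauchy_schwarz_sum: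
  fixes v w :: "complex vec"
  assumes "v \<in> carrier_vec n" "w \<in> carrier_vec n"
  shows "cmod (\<Sum>i<n. v $ i * w $ i) \<le> vnorm v * vnorm w"
proof -
  have "cmod (\<Sum>i<n. v $ i * w $ i) \<le> (\<Sum>i<n. \<bar>cmod (v $ i)\<bar> * \<bar>cmod (w $ i)\<bar>)"
    by (rule order_trans[OF norm_sum]) (simp add: norm_mult)
  also have "\<dots> \<le> L2_set (\<lambda>i. cmod (v $ i)) {..<n} * L2_set (\<lambda>i. cmod (w $ i)) {..<n}"
    by (rule L2_set_mult_ineq)
  finally show ?thesis using assms by (simp add: vnorm_def L2_set_def)
qed

lemma ip_cauchy_schwarz:
  assumes "v \<in> carrier_vec n" "w \<in> carrier_vec n"
  shows "cmod (ip v w) \<le> vnorm v * vnorm w"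
  using vnorm_cauchy_schwarz_sum[of v n "vec n (\<lambda>i. cnj (w $ i))"] assms
  by (simp add: ip_def vnorm_def)

lemma vnorm_triangle:
  assumes "v \<in> carrier_vec n" "w \<in> carrier_vec n"
  shows "vnorm (v + w) \<le> vnorm v + vnorm w"
proof -
  have "vnorm (v + w) = L2_set (\<lambda>i. cmod (v $ i + w $ i)) {..<n}"
    using assms by (simp add: vnorm_def L2_set_def)
  also have "\<dots> \<le> L2_set (\<lambda>i. cmod (v $ i) + cmod (w $ i)) {..<n}"
    by (intro L2_set_mono norm_triangle_ineq) auto
  also have "\<dots> \<le> L2_set (\<lambda>i. cmod (v $ i)) {..<n} + L2_set (\<lambda>i. cmod (w $ i)) {..<n}"
    by (rule L2_set_triangle_ineq)
  finally show ?thesis using assms by (simp add: vnorm_def L2_set_def)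
qed

lemma vnorm_entry: "i < dim_vec v \<Longrightarrow> cmod (v $ i) \<le> vnorm v"
proof -
  assume i: "i < dim_vec v"
  have "(cmod (v $ i))\<^sup>2 \<le> (\<Sum>i<dim_vec v. (cmod (v $ i))\<^sup>2)"
    using i by (intro member_le_sum) auto
  then show ?thesis unfolding vnorm_def by (simp add: real_le_rsqrt)
qed

lemma vnorm_le_sum: "vnorm v \<le> (\<Sum>i<dim_vec v. cmod (v $ i))"
  unfolding vnorm_def L2_set_def[symmetric] by (rule L2_set_le_sum) auto

lemma vnorm_mult_le_entries:
  assumes "A \<in> carrier_mat n m" "v \<in> carrier_vec m"
  shows "vnorm (A *\<^sub>v v) \<le> (\<Sum>i<n. \<Sum>j<m. cmod (A $$ (i,j))) * vnorm v"
proof -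
  have "vnorm (A *\<^sub>v v) \<le> (\<Sum>i<n. cmod ((A *\<^sub>v v) $ i))"
    using vnorm_le_sum[of "A *\<^sub>v v"] assms by simp
  also have "\<dots> \<le> (\<Sum>i<n. \<Sum>j<m. cmod (A $$ (i,j)) * vnorm v)"
    using assms
    by (intro sum_mono) (auto simp: mult_vec_index[of A n m] norm_mult simp del: index_mult_mat_vec
        intro!: order_trans[OF norm_sum] sum_mono mult_left_mono vnorm_entry)
  finally show ?thesis by (simp add: sum_distrib_right)
qed

lemma opnorm_bdd:
  "bdd_above ((\<lambda>v. vnorm (A *\<^sub>v v)) ` {v \<in> carrier_vec (dim_col A). vnorm v \<le> 1})"
proof (rule bdd_aboveI2)
  fix v :: "complex vec" assume "v \<in> {v \<in> carrier_vec (dim_col A). vnorm v \<le> 1}"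
  then have v: "dim_vec v = dim_col A" "vnorm v \<le> 1" by auto
  let ?C = "\<Sum>i<dim_row A. \<Sum>j<dim_col A. cmod (A $$ (i,j))"
  have "vnorm (A *\<^sub>v v) \<le> ?C * vnorm v" using v by (intro vnorm_mult_le_entries) auto
  also have "\<dots> \<le> ?C * 1" using v by (intro mult_left_mono sum_nonneg) auto
  finally show "vnorm (A *\<^sub>v v) \<le> ?C" by simp
qed

lemma opnorm_nonneg [simp]: "0 \<le> opnorm A"
  unfolding opnorm_def
  by (rule cSUP_upper2[OF opnorm_bdd, of "0\<^sub>v (dim_col A)"]) (auto simp: vnorm_def)

lemma vnorm_mult_le:
  assumes "dim_vec v = dim_col A"
  shows "vnorm (A *\<^sub>v v) \<le> opnorm A * vnorm v"
proof (cases "vnorm v = 0")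
  case True
  then have "v = 0\<^sub>v (dim_col A)" using assms by (simp add: vnorm_eq_0[of _ "dim_col A"])
  then have "A *\<^sub>v v = 0\<^sub>v (dim_row A)" by (intro eq_vecI) auto
  then show ?thesis using True by (simp add: vnorm_eq_0[of _ "dim_row A"] vnorm_def)
next
  case False
  then have pos: "vnorm v > 0" using vnorm_nonneg[of v] by linarith
  let ?c = "complex_of_real (1 / vnorm v)"
  have "vnorm (A *\<^sub>v (?c \<cdot>\<^sub>v v)) \<le> opnorm A"
    unfolding opnorm_def
    by (rule cSUP_upper[OF _ opnorm_bdd]) (use assms pos in \<open>auto simp: vnorm_smult norm_divide\<close>)
  then have "vnorm (A *\<^sub>v v) / vnorm v \<le> opnorm A"
    using assms pos by (simp add: mv_distrib vnorm_smult norm_divide)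
  then show ?thesis using pos by (simp add: field_simps)
qed

lemma opnorm_leI:
  assumes "\<And>v. v \<in> carrier_vec (dim_col A) \<Longrightarrow> vnorm (A *\<^sub>v v) \<le> C * vnorm v" "0 \<le> C"
  shows "opnorm A \<le> C"
  unfolding opnorm_def
proof (rule cSUP_least)
  show "{v \<in> carrier_vec (dim_col A). vnorm v \<le> 1} \<noteq> {}"
    by (auto intro!: exI[of _ "0\<^sub>v (dim_col A)"] simp: vnorm_def)
next
  fix v :: "complex vec" assume "v \<in> {v \<in> carrier_vec (dim_col A). vnorm v \<le> 1}"
  then show "vnorm (A *\<^sub>v v) \<le> C"
    using assms(1)[of v] mult_left_mono[of "vnorm v" 1 C] assms(2) by auto
qed

lemma opnorm_le_entries: "opnorm A \<le> (\<Sum>i<dim_row A. \<Sum>j<dim_col A. cmod (A $$ (i,j)))"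
  by (intro opnorm_leI vnorm_mult_le_entries sum_nonneg) auto

lemma opnorm_entry:
  assumes "i < dim_row A" "j < dim_col A"
  shows "cmod (A $$ (i,j)) \<le> opnorm A"
proof -
  have n1: "vnorm (unit_vec (dim_col A) j) = 1"
  proof -
    have "(\<Sum>i<dim_col A. (cmod (unit_vec (dim_col A) j $ i))\<^sup>2) = (\<Sum>i<dim_col A. if i = j then 1 else 0)"
      using assms by (intro sum.cong) auto
    then show ?thesis using assms by (simp add: vnorm_def)
  qed
  have "cmod (A $$ (i,j)) = cmod ((A *\<^sub>v unit_vec (dim_col A) j) $ i)"
    using mult_unit_vec_index[of A "dim_row A" "dim_col A" i j] assms by simp
  also have "\<dots> \<le> vnorm (A *\<^sub>v unit_vec (dim_col A) j)" using assms by (intro vnorm_entry) simp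
  also have "\<dots> \<le> opnorm A" using vnorm_mult_le[of "unit_vec (dim_col A) j" A] n1 by simp
  finally show ?thesis .
qed

text \<open>Limits are handled entrywise throughout; this gives the convergence in operator norm
  that (E2) asks for.\<close>

lemma opnorm_tendsto_0:
  assumes "\<And>m. A m \<in> carrier_mat n n" "B \<in> carrier_mat n n"
    and "\<And>i j. i < n \<Longrightarrow> j < n \<Longrightarrow> (\<lambda>m. A m $$ (i,j)) \<longlonglongrightarrow> B $$ (i,j)"
  shows "(\<lambda>m. opnorm (A m - B)) \<longlonglongrightarrow> 0"
proof (rule tendsto_sandwich[where f = "\<lambda>_. 0"])
  show "(\<lambda>m. \<Sum>i<n. \<Sum>j<n. cmod (A m $$ (i,j) - B $$ (i,j))) \<longlonglongrightarrow> 0"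
    by (intro tendsto_null_sum tendsto_norm_zero LIM_zero assms(3)) auto
  show "\<forall>\<^sub>F m in sequentially. opnorm (A m - B) \<le> (\<Sum>i<n. \<Sum>j<n. cmod (A m $$ (i,j) - B $$ (i,j)))"
  proof (intro always_eventually allI)
    fix m show "opnorm (A m - B) \<le> (\<Sum>i<n. \<Sum>j<n. cmod (A m $$ (i,j) - B $$ (i,j)))"
      using opnorm_le_entries[of "A m - B"] assms(1)[of m] assms(2) by simp
  qed
  show "\<forall>\<^sub>F m in sequentially. 0 \<le> opnorm (A m - B)" by simp
qed simp

lemma opnorm_mult:
  assumes d: "dim_col A = dim_row B" shows "opnorm (A * B) \<le> opnorm A * opnorm B"
proof (rule opnorm_leI)
  fix v :: "complex vec" assume "v \<in> carrier_vec (dim_col (A * B))"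
  then have v: "dim_vec v = dim_col B" by simp
  have "vnorm (A * B *\<^sub>v v) \<le> opnorm A * vnorm (B *\<^sub>v v)"
    using vnorm_mult_le[of "B *\<^sub>v v" A] d v by (simp add: mv_assoc)
  also have "\<dots> \<le> opnorm A * (opnorm B * vnorm v)"
    using v by (intro mult_left_mono vnorm_mult_le) auto
  finally show "vnorm (A * B *\<^sub>v v) \<le> opnorm A * opnorm B * vnorm v" by simp
qed auto

lemma opnorm_add:
  assumes "dim_row A = dim_row B" "dim_col A = dim_col B" shows "opnorm (A + B) \<le> opnorm A + opnorm B"
proof (rule opnorm_leI)
  fix v :: "complex vec" assume "v \<in> carrier_vec (dim_col (A + B))"
  then have v: "dim_vec v = dim_col A" "dim_vec v = dim_col B" using assms by auto
  have "vnorm ((A + B) *\<^sub>v v) \<le> vnorm (A *\<^sub>v v) + vnorm (B *\<^sub>v v)"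
    using assms v vnorm_triangle[of "A *\<^sub>v v" "dim_row B" "B *\<^sub>v v"] by (simp add: mv_distrib)
  also have "\<dots> \<le> opnorm A * vnorm v + opnorm B * vnorm v"
    using v by (intro add_mono vnorm_mult_le) auto
  finally show "vnorm ((A + B) *\<^sub>v v) \<le> (opnorm A + opnorm B) * vnorm v" by (simp add: algebra_simps)
qed auto

lemma opnorm_smult: "opnorm (c \<cdot>\<^sub>m A) \<le> cmod c * opnorm A"
  by (rule opnorm_leI)
    (auto simp: mv_distrib vnorm_smult mult.assoc intro!: mult_left_mono vnorm_mult_le)

lemma opnorm_one: "opnorm (1\<^sub>m n) \<le> 1"
  by (rule opnorm_leI) auto

lemma opnorm_scalar_le: "opnorm (c \<cdot>\<^sub>m 1\<^sub>m n) \<le> cmod c"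
  using order_trans[OF opnorm_smult mult_left_mono[OF opnorm_one]] by simp

text \<open>With \<open>w = adj A *\<^sub>v v\<close>, the square of \<open>vnorm w\<close> equals
  \<open>ip v (A *\<^sub>v w)\<close>. Apply Cauchy-Schwarz and cancel one factor
  \<open>vnorm w\<close>.\<close>

lemma opnorm_adj_le: "opnorm (adj A) \<le> opnorm A"
proof (rule opnorm_leI)
  fix v :: "complex vec" assume "v \<in> carrier_vec (dim_col (adj A))"
  then have v: "dim_vec v = dim_row A" by simp
  let ?w = "adj A *\<^sub>v v"
  have "(vnorm ?w)\<^sup>2 = cmod (ip ?w ?w)" by (simp add: ip_self norm_power del: of_real_power)
  also have "ip ?w ?w = ip v (A *\<^sub>v ?w)" using ip_adj[of "adj A" "dim_col A" "dim_row A" v ?w] v unfolding adj_adj by simp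
  also have "cmod \<dots> \<le> vnorm v * vnorm (A *\<^sub>v ?w)" using v by (intro ip_cauchy_schwarz[of _ "dim_row A"]) auto
  also have "\<dots> \<le> vnorm v * (opnorm A * vnorm ?w)" by (intro mult_left_mono vnorm_mult_le) auto
  finally have *: "vnorm ?w * vnorm ?w \<le> (opnorm A * vnorm v) * vnorm ?w" by (simp add: power2_eq_square algebra_simps)
  show "vnorm ?w \<le> opnorm A * vnorm v"
  proof (cases "vnorm ?w = 0")
    case False
    then have "vnorm ?w > 0" using vnorm_nonneg[of ?w] by linarith
    then show ?thesis using * by simp
  qed simp
qed auto

lemma vnorm_unitary:
  assumes "unitary n U" "v \<in> carrier_vec n" shows "vnorm (U *\<^sub>v v) = vnorm v"
proof -
  note U = unitaryD[OF assms(1)] unitary_cancel[OF assms(1)]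
  have "ip (U *\<^sub>v v) (U *\<^sub>v v) = ip v v"
    using ip_adj[of U n n v "U *\<^sub>v v"] U(1,2) U(8)[of v] assms(2) by simp
  then have "(vnorm (U *\<^sub>v v))\<^sup>2 = (vnorm v)\<^sup>2" unfolding ip_self of_real_eq_iff .
  then show ?thesis by (simp add: power2_eq_iff_nonneg)
qed

lemma opnorm_unitary: assumes "unitary n U" shows "opnorm U \<le> 1"
  using unitaryD[OF assms] vnorm_unitary[OF assms] by (intro opnorm_leI) auto

lemma opnorm_conj_le:
  assumes U: "unitary n U" and A: "A \<in> carrier_mat n n"
  shows "opnorm (U * A * adj U) \<le> opnorm A"
proof -
  note Ud = unitaryD[OF U]
  have "opnorm (U * A * adj U) \<le> opnorm U * opnorm A * opnorm (adj U)"
    using Ud A by (intro order_trans[OF opnorm_mult] mult_right_mono opnorm_mult) auto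
  also have "\<dots> \<le> 1 * opnorm A * 1"
    by (intro mult_mono opnorm_unitary[OF U] opnorm_unitary[OF unitary_adj[OF U]]) auto
  finally show ?thesis by simp
qed

lemma opnorm_diagm_le:
  assumes "\<And>i. i < n \<Longrightarrow> cmod (a i) \<le> C" "0 \<le> C"
  shows "opnorm (diagm n a) \<le> C"
proof (rule opnorm_leI[OF _ assms(2)])
  fix v :: "complex vec" assume "v \<in> carrier_vec (dim_col (diagm n a))"
  then have v: "dim_vec v = n" by simp
  have "(vnorm (diagm n a *\<^sub>v v))\<^sup>2 = (\<Sum>i<n. (cmod (a i) * cmod (v $ i))\<^sup>2)"
    using v by (simp add: vnorm_def diagm_mult_vec_index norm_mult sum_nonneg del: index_mult_mat_vec)
  also have "\<dots> \<le> (\<Sum>i<n. (C * cmod (v $ i))\<^sup>2)"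
    using assms by (intro sum_mono power_mono mult_right_mono) auto
  also have "\<dots> = (C * vnorm v)\<^sup>2"
    using v by (simp add: vnorm_def power_mult_distrib sum_distrib_left sum_nonneg)
  finally show "vnorm (diagm n a *\<^sub>v v) \<le> C * vnorm v"
    by (rule power2_le_imp_le) (use assms in auto)
qed

lemma opnorm_fc_le:
  assumes A: "herm n A" and "\<And>t. cmod (\<psi> t) \<le> C"
  shows "opnorm (fc \<psi> A) \<le> C"
proof -
  obtain W d where W: "unitary n W" "A = W * diagm n (\<lambda>i. of_real (d i)) * adj W"
    "\<forall>\<psi>. fc \<psi> A = W * diagm n (\<lambda>i. \<psi> (d i)) * adj W" using fc_witness[OF A] .
  have "0 \<le> C" using assms(2)[of 0] norm_ge_zero[of "\<psi> 0"] by linarith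
  then show ?thesis
    unfolding W(3)[rule_format] using assms by (intro order_trans[OF opnorm_conj_le[OF W(1)]] opnorm_diagm_le) auto
qed

lemma opnorm_dsum_le:
  assumes "opnorm A \<le> C" "opnorm B \<le> C"
  shows "opnorm (dsum A B) \<le> C"
proof (rule opnorm_leI)
  show C: "0 \<le> C" using assms(1) opnorm_nonneg[of A] by linarith
  fix v :: "complex vec" assume "v \<in> carrier_vec (dim_col (dsum A B))"
  then have v: "dim_vec v = dim_col A + dim_col B" by simp
  define x y where "x = vec_first v (dim_col A)" and "y = vec_last v (dim_col B)"
  have d: "dim_vec x = dim_col A" "dim_vec y = dim_col B" by (auto simp: x_def y_def)
  have vxy: "v = x @\<^sub>v y" using v by (simp add: x_def y_def)
  have split: "(vnorm (a @\<^sub>v b))\<^sup>2 = (vnorm a)\<^sup>2 + (vnorm b)\<^sup>2" for a b :: "complex vec"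
  proof -
    have "(\<Sum>i<dim_vec a + dim_vec b. (cmod ((a @\<^sub>v b) $ i))\<^sup>2) =
        (\<Sum>i<dim_vec a. (cmod (a $ i))\<^sup>2) + (\<Sum>i<dim_vec b. (cmod (b $ i))\<^sup>2)"
      unfolding lessThan_atLeast0
      by (subst sum.atLeastLessThan_concat[of 0 "dim_vec a", symmetric])
        (auto simp: sum.shift_bounds_nat_ivl[of _ 0 "dim_vec a" "dim_vec b", simplified add_0 add.commute[of "dim_vec b"]])
    then show ?thesis by (simp add: vnorm_def sum_nonneg)
  qed
  have "dsum A B *\<^sub>v v = (A *\<^sub>v x) @\<^sub>v (B *\<^sub>v y)"
    unfolding dsum_def vxy using d
    by (subst four_block_mat_mult_vec[of _ "dim_row A" "dim_col A" _ "dim_col B" _ "dim_row B"]) auto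
  then have "(vnorm (dsum A B *\<^sub>v v))\<^sup>2 = (vnorm (A *\<^sub>v x))\<^sup>2 + (vnorm (B *\<^sub>v y))\<^sup>2" by (simp add: split)
  also have "\<dots> \<le> (C * vnorm x)\<^sup>2 + (C * vnorm y)\<^sup>2"
    using d by (intro add_mono power_mono order_trans[OF vnorm_mult_le] mult_right_mono assms) auto
  also have "\<dots> = (C * vnorm v)\<^sup>2" unfolding vxy by (simp add: split power_mult_distrib algebra_simps)
  finally show "vnorm (dsum A B *\<^sub>v v) \<le> C * vnorm v"
    by (rule power2_le_imp_le) (use C in auto)
qed

section \<open>Compatible Borel functions\<close>

lemma conjm_eq: "conjm U A = U * A * adj U"
  by (simp add: conjm_def)

lemma MtupI:
  assumes "length X = l" "1 \<le> l" "1 \<le> n" "\<And>k. k < l \<Longrightarrow> dim_row (X ! k) = n \<and> dim_col (X ! k) = n"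
  shows "X \<in> Mtup l" "tdim X = n"
proof -
  show "X \<in> Mtup l" using assms unfolding Mtup_def by (auto simp: in_set_conv_nth intro!: exI[of _ n])
  show "tdim X = n" using assms by (cases X) (force simp: tdim_def)+
qed

locale tuple_length =
  fixes l :: nat
  assumes l: "1 \<le> l"
begin

lemma MtupD:
  assumes "X \<in> Mtup l"
  shows "length X = l" "1 \<le> tdim X"
    "k < l \<Longrightarrow> dim_row (X ! k) = tdim X" "k < l \<Longrightarrow> dim_col (X ! k) = tdim X"
proof -
  obtain n where n: "length X = l" "n \<ge> 1" "\<forall>A\<in>set X. A \<in> carrier_mat n n"
    using assms by (auto simp: Mtup_def)
  have "X ! 0 \<in> set X" using n l by auto
  then have "tdim X = n" using n l by (cases X) (auto simp: tdim_def)
  then show "length X = l" "1 \<le> tdim X"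
    "k < l \<Longrightarrow> dim_row (X ! k) = tdim X" "k < l \<Longrightarrow> dim_col (X ! k) = tdim X"
    using n by auto
qed

lemma conjt_Mtup:
  assumes X: "X \<in> Mtup l" and U: "unitary (tdim X) U"
  shows "conjt U X \<in> Mtup l" "tdim (conjt U X) = tdim X"
    "k < l \<Longrightarrow> conjt U X ! k = U * X ! k * adj U"
proof -
  note D = MtupD[OF X] and Ud = unitaryD[OF U]
  have "dim_row (conjt U X ! k) = tdim X \<and> dim_col (conjt U X ! k) = tdim X" if "k < l" for k
    using D that Ud by (simp add: conjt_def conjm_eq)
  then show "conjt U X \<in> Mtup l" "tdim (conjt U X) = tdim X"
    using MtupI[of "conjt U X" l "tdim X"] D l by (simp_all add: conjt_def)
  show "k < l \<Longrightarrow> conjt U X ! k = U * X ! k * adj U" using D by (simp add: conjt_def conjm_eq)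
qed

lemma dsumt_Mtup:
  assumes X: "X \<in> Mtup l" and Y: "Y \<in> Mtup l"
  shows "dsumt X Y \<in> Mtup l" "tdim (dsumt X Y) = tdim X + tdim Y"
    "k < l \<Longrightarrow> dsumt X Y ! k = dsum (X ! k) (Y ! k)"
proof -
  note D = MtupD[OF X] MtupD[OF Y]
  have "dim_row (dsumt X Y ! k) = tdim X + tdim Y \<and> dim_col (dsumt X Y ! k) = tdim X + tdim Y" if "k < l" for k
    using D that by (simp add: dsumt_def)
  then show "dsumt X Y \<in> Mtup l" "tdim (dsumt X Y) = tdim X + tdim Y"
    using MtupI[of "dsumt X Y" l "tdim X + tdim Y"] D l by (simp_all add: dsumt_def)
  show "k < l \<Longrightarrow> dsumt X Y ! k = dsum (X ! k) (Y ! k)" using D by (simp add: dsumt_def)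
qed

lemma conjt_one: assumes "X \<in> Mtup l" shows "conjt (1\<^sub>m (tdim X)) X = X"
  using MtupD[OF assms] conjt_Mtup(3)[OF assms unitary_one] by (intro nth_equalityI) (auto simp: conjt_def conjm_eq)

text \<open>A one-element list gives the conjugation rule, and a two-element list with
  \<open>U = 1\<close> gives the rule for sums. Conversely, longer lists follow by induction along
  \<open>bigsumt\<close>.\<close>

lemma compatible_iff:
  "compatible l f \<longleftrightarrow>
    (\<forall>X\<in>Mtup l. f X \<in> carrier_mat (tdim X) (tdim X)) \<and>
    (\<forall>X\<in>Mtup l. \<forall>U. unitary (tdim X) U \<longrightarrow> f (conjt U X) = U * f X * adj U) \<and>
    (\<forall>X\<in>Mtup l. \<forall>Y\<in>Mtup l. f (dsumt X Y) = dsum (f X) (f Y))" (is "_ \<longleftrightarrow> ?R")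
proof
  assume c: "compatible l f"
  then have 1: "\<And>X. X \<in> Mtup l \<Longrightarrow> f X \<in> carrier_mat (tdim X) (tdim X)"
    and 2: "\<And>ps U. ps \<noteq> [] \<Longrightarrow> set ps \<subseteq> Mtup l \<Longrightarrow> unitary (\<Sum>p\<leftarrow>ps. tdim p) U \<Longrightarrow>
      f (conjt U (bigsumt ps)) = conjm U (bigsum (map f ps))"
    unfolding compatible_def by blast+
  have "f (conjt U X) = U * f X * adj U" if "X \<in> Mtup l" "unitary (tdim X) U" for X U
    using 2[of "[X]" U] that by (simp add: conjm_eq)
  moreover have "f (dsumt X Y) = dsum (f X) (f Y)" if "X \<in> Mtup l" "Y \<in> Mtup l" for X Y
    using 2[of "[X,Y]" "1\<^sub>m (tdim X + tdim Y)"] that unitary_one conjt_one[OF dsumt_Mtup(1)[OF that]]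
      dsumt_Mtup(2)[OF that] 1[OF that(1)] 1[OF that(2)]
    by (simp add: conjm_eq)
  ultimately show ?R using 1 by blast
next
  assume R: ?R
  have "bigsumt ps \<in> Mtup l \<and> tdim (bigsumt ps) = (\<Sum>p\<leftarrow>ps. tdim p) \<and> f (bigsumt ps) = bigsum (map f ps)"
    if "ps \<noteq> []" "set ps \<subseteq> Mtup l" for ps
    using that
  proof (induction ps rule: bigsumt.induct)
    case (2 X Y ps)
    then show ?case using R by (simp add: dsumt_Mtup)
  qed auto
  then show "compatible l f" using R unfolding compatible_def by (auto simp: conjm_eq)
qed

lemma compatibleD:
  assumes "compatible l f" "X \<in> Mtup l"
  shows "dim_row (f X) = tdim X" "dim_col (f X) = tdim X"
    "unitary (tdim X) U \<Longrightarrow> f (conjt U X) = U * f X * adj U"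
    "Y \<in> Mtup l \<Longrightarrow> f (dsumt X Y) = dsum (f X) (f Y)"
  using assms unfolding compatible_iff by auto

lemma compatible_restr: "compatible l (restr l f) \<longleftrightarrow> compatible l f"
  unfolding compatible_iff by (auto simp: restr_def conjt_Mtup dsumt_Mtup)

lemma compatible_add:
  assumes f: "compatible l f" and g: "compatible l g"
  shows "compatible l (\<lambda>X. f X + g X)"
  unfolding compatible_iff using compatibleD[OF f] compatibleD[OF g]
  by (auto simp: dsum_add mm_distrib unitaryD)

lemma compatible_mult:
  assumes f: "compatible l f" and g: "compatible l g"
  shows "compatible l (\<lambda>X. f X * g X)"
  unfolding compatible_iff using compatibleD[OF f] compatibleD[OF g]
  by (auto simp: dsum_mult mm_assoc unitaryD unitary_cancel)

lemma compatible_adj: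
  assumes f: "compatible l f"
  shows "compatible l (\<lambda>X. adj (f X))"
  unfolding compatible_iff
proof (intro conjI ballI allI impI)
  fix X U assume X: "X \<in> Mtup l" and U: "unitary (tdim X) U"
  note Ud = unitaryD[OF U] and D = compatibleD(1,2)[OF f X]
  show "adj (f (conjt U X)) = U * adj (f X) * adj U"
    unfolding compatibleD(3)[OF f X U] using Ud D by (simp add: adj_mult[of _ "tdim X" "tdim X"] mm_assoc)
qed (use compatibleD[OF f] in \<open>auto simp: dsum_adj\<close>)

lemma compatible_one: "compatible l (\<lambda>X. 1\<^sub>m (tdim X))"
  unfolding compatible_iff by (auto simp: conjt_Mtup dsumt_Mtup dsum_one unitaryD)

text \<open>In finite dimension a right inverse is two-sided, so one product identifies the value of
  the description operator.\<close>

lemma minv_eq: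
  fixes A B :: "complex mat"
  assumes "A \<in> carrier_mat n n" "B \<in> carrier_mat n n" "A * B = 1\<^sub>m n"
  shows "minv A = B"
proof -
  have BA: "B * A = 1\<^sub>m n" by (rule mat_mult_left_right_inverse[OF assms])
  have dA: "dim_row A = n" using assms by simp
  show ?thesis unfolding minv_def dA
  proof (rule the_equality)
    fix C assume C: "C \<in> carrier_mat n n \<and> A * C = 1\<^sub>m n \<and> C * A = 1\<^sub>m n"
    have "C = (B * A) * C" using C BA by simp
    also have "\<dots> = B * (A * C)" using C assms by (intro mm_assoc) auto
    also have "\<dots> = B" using C assms by simp
    finally show "C = B" .
  qed (use assms BA in auto)
qed

lemma compatible_inv:
  assumes f: "compatible l f"
    and inv: "\<And>X. X \<in> Mtup l \<Longrightarrow> \<exists>B. B \<in> carrier_mat (tdim X) (tdim X) \<and> f X * B = 1\<^sub>m (tdim X)"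
  shows "compatible l (\<lambda>X. minv (f X))"
proof -
  have m: "dim_row (minv (f X)) = tdim X" "dim_col (minv (f X)) = tdim X" "f X * minv (f X) = 1\<^sub>m (tdim X)"
    if "X \<in> Mtup l" for X
    using inv[OF that] minv_eq[of "f X" "tdim X"] compatibleD(1,2)[OF f that] by auto
  show ?thesis unfolding compatible_iff
  proof (intro conjI ballI allI impI)
    fix X U assume X: "X \<in> Mtup l" and U: "unitary (tdim X) U"
    note Ud = unitaryD[OF U] unitary_cancel[OF U] and D = compatibleD(1,2)[OF f X] and m = m[OF X]
    have fm: "f X * (minv (f X) * C) = C" if "dim_row C = tdim X" for C
      using that m D mm_assoc[of "f X" "minv (f X)" C] by simp
    show "minv (f (conjt U X)) = U * minv (f X) * adj U"
      unfolding compatibleD(3)[OF f X U]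
      by (rule minv_eq[of _ "tdim X"]) (use Ud D m(1,2) fm in \<open>auto simp: mm_assoc\<close>)
  next
    fix X Y assume X: "X \<in> Mtup l" and Y: "Y \<in> Mtup l"
    show "minv (f (dsumt X Y)) = dsum (minv (f X)) (minv (f Y))"
      unfolding compatibleD(4)[OF f X Y]
      by (rule minv_eq[of _ "tdim X + tdim Y"])
        (use compatibleD(1,2)[OF f X] compatibleD(1,2)[OF f Y] m[OF X] m[OF Y] in \<open>auto simp: dsum_mult dsum_one\<close>)
  qed (use m in auto)
qed

lemma tup_of_Mtup:
  assumes "1 \<le> n" shows "tup_of l n x \<in> Mtup l" "tdim (tup_of l n x) = n"
  using MtupI[of "tup_of l n x" l n] l assms by (auto simp: tup_of_def)

lemma borel_funI:
  assumes "\<And>n i j. 1 \<le> n \<Longrightarrow> i < n \<Longrightarrow> j < n \<Longrightarrow>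
    (\<lambda>x. f (tup_of l n x) $$ (i,j)) \<in> borel_measurable (PiM ({..<l} \<times> {..<n} \<times> {..<n}) (\<lambda>_. borel))"
  shows "borel_fun l f"
  using assms unfolding borel_fun_def by blast

lemma borel_funD:
  assumes "borel_fun l f" "1 \<le> n" "i < n" "j < n"
  shows "(\<lambda>x. f (tup_of l n x) $$ (i,j)) \<in> borel_measurable (PiM ({..<l} \<times> {..<n} \<times> {..<n}) (\<lambda>_. borel))"
  using assms unfolding borel_fun_def by blast

lemma borel_fun_cong:
  assumes "\<And>X. X \<in> Mtup l \<Longrightarrow> f X = g X" "borel_fun l f" shows "borel_fun l g"
  using assms unfolding borel_fun_def by (auto simp: tup_of_Mtup)

lemma borel_fun_add:
  assumes "compatible l f" "compatible l g" "borel_fun l f" "borel_fun l g"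
  shows "borel_fun l (\<lambda>X. f X + g X)"
proof (rule borel_funI)
  fix n i j :: nat assume n: "1 \<le> n" "i < n" "j < n"
  note [measurable] = borel_funD[OF assms(3) n] borel_funD[OF assms(4) n]
  show "(\<lambda>x. (f (tup_of l n x) + g (tup_of l n x)) $$ (i,j)) \<in> borel_measurable (PiM ({..<l} \<times> {..<n} \<times> {..<n}) (\<lambda>_. borel))"
    using compatibleD(1,2)[OF assms(2) tup_of_Mtup(1)] tup_of_Mtup(2) n by simp
qed

lemma borel_fun_mult:
  assumes "compatible l f" "compatible l g" "borel_fun l f" "borel_fun l g"
  shows "borel_fun l (\<lambda>X. f X * g X)"
proof (rule borel_funI)
  fix n i j :: nat assume n: "1 \<le> n" "i < n" "j < n"
  have *: "(f (tup_of l n x) * g (tup_of l n x)) $$ (i,j) = (\<Sum>k<n. f (tup_of l n x) $$ (i,k) * g (tup_of l n x) $$ (k,j))" for x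
    using compatibleD(1,2)[OF assms(1) tup_of_Mtup(1)] compatibleD(1,2)[OF assms(2) tup_of_Mtup(1)] tup_of_Mtup(2) n
    by (intro mult_index) auto
  show "(\<lambda>x. (f (tup_of l n x) * g (tup_of l n x)) $$ (i,j)) \<in> borel_measurable (PiM ({..<l} \<times> {..<n} \<times> {..<n}) (\<lambda>_. borel))"
    unfolding * by (intro borel_measurable_sum borel_measurable_times borel_funD assms n) auto
qed

lemma borel_fun_adj:
  assumes "compatible l f" "borel_fun l f"
  shows "borel_fun l (\<lambda>X. adj (f X))"
proof (rule borel_funI)
  fix n i j :: nat assume n: "1 \<le> n" "i < n" "j < n"
  have "(\<lambda>x. cnj (f (tup_of l n x) $$ (j,i))) \<in> borel_measurable (PiM ({..<l} \<times> {..<n} \<times> {..<n}) (\<lambda>_. borel))"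
    by (rule borel_measurable_continuous_onI[THEN measurable_compose_rev[OF _ borel_funD[OF assms(2) n(1,3,2)]]])
      (intro continuous_intros)
  then show "(\<lambda>x. adj (f (tup_of l n x)) $$ (i,j)) \<in> borel_measurable (PiM ({..<l} \<times> {..<n} \<times> {..<n}) (\<lambda>_. borel))"
    using compatibleD(1,2)[OF assms(1) tup_of_Mtup(1)] tup_of_Mtup(2) n by simp
qed

lemma borel_fun_one: "borel_fun l (\<lambda>X. 1\<^sub>m (tdim X))"
  by (rule borel_funI) (simp add: tup_of_Mtup)

lemma borel_measurable_det:
  fixes B :: "'a \<Rightarrow> complex mat"
  assumes "\<And>x. B x \<in> carrier_mat m m"
    and "\<And>i j. i < m \<Longrightarrow> j < m \<Longrightarrow> (\<lambda>x. B x $$ (i,j)) \<in> borel_measurable M"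
  shows "(\<lambda>x. Determinant.det (B x)) \<in> borel_measurable M"
  unfolding det_def'[OF assms(1)]
proof (intro borel_measurable_sum borel_measurable_times borel_measurable_prod borel_measurable_const)
  fix p i assume "p \<in> {p. p permutes {0..<m}}" "i \<in> {0..<m}"
  then have "i < m" "p i < m" using permutes_in_image[of p "{0..<m}" i] by auto
  then show "(\<lambda>x. B x $$ (i, p i)) \<in> borel_measurable M" by (rule assms(2))
qed

text \<open>Cramer's rule: the entries of the inverse are quotients of polynomials in the entries of
  \<open>A\<close>, which yields their measurability in \<open>borel_fun_inv\<close>.\<close>

lemma minv_index:
  fixes A :: "complex mat"
  assumes A: "A \<in> carrier_mat n n" and B: "B \<in> carrier_mat n n" "A * B = 1\<^sub>m n" and ij: "i < n" "j < n"
  shows "minv A $$ (i,j) = (-1) ^ (j + i) * Determinant.det (mat_delete A j i) / Determinant.det A"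
proof -
  have "Determinant.det A * Determinant.det B = 1" using det_mult[OF A B(1)] B(2) by simp
  then have d: "Determinant.det A \<noteq> 0" by auto
  have "A * ((1 / Determinant.det A) \<cdot>\<^sub>m adj_mat A) = 1\<^sub>m n"
    using adj_mat[OF A] A d by (simp add: mm_smult)
  then have "minv A = (1 / Determinant.det A) \<cdot>\<^sub>m adj_mat A"
    using A adj_mat(1)[OF A] by (intro minv_eq[of _ n]) auto
  then show ?thesis using A ij by (simp add: adj_mat_def cofactor_def)
qed

lemma borel_fun_inv:
  assumes f: "compatible l f" "borel_fun l f"
    and inv: "\<And>X. X \<in> Mtup l \<Longrightarrow> \<exists>B. B \<in> carrier_mat (tdim X) (tdim X) \<and> f X * B = 1\<^sub>m (tdim X)"
  shows "borel_fun l (\<lambda>X. minv (f X))"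
proof (rule borel_funI)
  fix n i j :: nat assume n: "1 \<le> n" "i < n" "j < n"
  let ?M = "PiM ({..<l} \<times> {..<n} \<times> {..<n}) (\<lambda>_. borel)"
  have c: "f (tup_of l n x) \<in> carrier_mat n n" for x
    using compatibleD(1,2)[OF f(1) tup_of_Mtup(1)] tup_of_Mtup(2) n by simp
  have *: "minv (f (tup_of l n x)) $$ (i,j) =
      (-1) ^ (j + i) * Determinant.det (mat_delete (f (tup_of l n x)) j i) / Determinant.det (f (tup_of l n x))" for x
    using minv_index[OF c[of x] _ _ n(2,3)] inv[OF tup_of_Mtup(1)[OF n(1)], of x] tup_of_Mtup(2)[OF n(1)] by auto
  have "(\<lambda>x. mat_delete (f (tup_of l n x)) j i $$ (a,b)) \<in> borel_measurable ?M"
    if "a < n - 1" "b < n - 1" for a b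
  proof -
    have "mat_delete (f (tup_of l n x)) j i $$ (a,b) =
        f (tup_of l n x) $$ (if a < j then a else Suc a, if b < i then b else Suc b)" for x
      using that c[of x] by (simp add: mat_delete_def)
    moreover have "(if a < j then a else Suc a) < n" "(if b < i then b else Suc b) < n" using that by auto
    ultimately show ?thesis using borel_funD[OF f(2) n(1)] by simp
  qed
  then show "(\<lambda>x. minv (f (tup_of l n x)) $$ (i,j)) \<in> borel_measurable ?M"
    unfolding *
    by (intro borel_measurable_divide borel_measurable_times borel_measurable_const
        borel_measurable_det[where m = "n - 1"] borel_measurable_det[OF c] borel_funD[OF f(2) n(1)])
      (use c n in \<open>auto simp: mat_delete_def\<close>)
qed

lemma restr_apply: "X \<in> Mtup l \<Longrightarrow> restr l f X = f X"
  by (simp add: restr_def)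

lemma FalgD:
  assumes "f \<in> Falg l" shows "compatible l f" "borel_fun l f" "ext_fun l f"
  using assms by (auto simp: Falg_def)

lemma ext_fun_restr: "ext_fun l (restr l f)"
  by (simp add: ext_fun_def restr_def)

lemma restr_FalgI: "compatible l f \<Longrightarrow> borel_fun l f \<Longrightarrow> restr l f \<in> Falg l"
  by (auto simp: Falg_def compatible_restr ext_fun_restr restr_apply intro: borel_fun_cong[of f])

lemma ext_fun_eqI:
  assumes "ext_fun l f" "ext_fun l g" "\<And>X. X \<in> Mtup l \<Longrightarrow> f X = g X" shows "f = g"
  using assms unfolding ext_fun_def by (metis ext)

end

section \<open>Irreducible tuples\<close>

context tuple_length
begin

text \<open>Both summands lie in \<open>Mtup l\<close> and thus have positive size, so every
  excluded decomposition is into strictly smaller tuples.\<close>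

definition irr :: "complex mat list set" where
  "irr = {Y \<in> Mtup l. \<not> (\<exists>U A B. A \<in> Mtup l \<and> B \<in> Mtup l \<and> unitary (tdim A + tdim B) U \<and>
      Y = conjt U (dsumt A B))}"

lemma irr_Mtup: "Y \<in> irr \<Longrightarrow> Y \<in> Mtup l"
  by (simp add: irr_def)

text \<open>Strong induction on the size: a reducible tuple is conjugate to a sum of two smaller
  ones. The rule carries properties of compatible functions from \<open>irr\<close> to all
  tuples.\<close>

lemma Mtup_irr_induct [consumes 1, case_names irr sum conj]:
  assumes "X \<in> Mtup l"
    and "\<And>Y. Y \<in> irr \<Longrightarrow> P Y"
    and "\<And>A B. A \<in> Mtup l \<Longrightarrow> B \<in> Mtup l \<Longrightarrow> P A \<Longrightarrow> P B \<Longrightarrow> P (dsumt A B)"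
    and "\<And>A U. A \<in> Mtup l \<Longrightarrow> unitary (tdim A) U \<Longrightarrow> P A \<Longrightarrow> P (conjt U A)"
  shows "P X"
  using assms(1)
proof (induction "tdim X" arbitrary: X rule: less_induct)
  case less
  show ?case
  proof (cases "X \<in> irr")
    case False
    then obtain U A B where A: "A \<in> Mtup l" "B \<in> Mtup l" "unitary (tdim A + tdim B) U" "X = conjt U (dsumt A B)"
      using less.prems by (auto simp: irr_def)
    note S = dsumt_Mtup[OF A(1,2)]
    have "tdim X = tdim A + tdim B" using conjt_Mtup(2)[OF S(1)] A(3,4) S(2) by simp
    then have "P A" "P B"
      using less.hyps[of A] less.hyps[of B] A MtupD(2)[OF A(1)] MtupD(2)[OF A(2)] by auto
    then show ?thesis unfolding A(4) using assms(3,4) A S by auto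
  qed (rule assms(2))
qed

lemma compatible_eqI:
  assumes f: "compatible l f" and g: "compatible l g" and eq: "\<And>Y. Y \<in> irr \<Longrightarrow> f Y = g Y"
    and X: "X \<in> Mtup l"
  shows "f X = g X"
  using X
proof (induction rule: Mtup_irr_induct)
  case (sum A B)
  then show ?case using compatibleD(4)[OF f] compatibleD(4)[OF g] by simp
next
  case (conj A U)
  then show ?case using compatibleD(3)[OF f] compatibleD(3)[OF g] by simp
qed (rule eq)

lemma compatible_opnorm_le:
  assumes f: "compatible l f" and le: "\<And>Y. Y \<in> irr \<Longrightarrow> opnorm (f Y) \<le> C"
    and X: "X \<in> Mtup l"
  shows "opnorm (f X) \<le> C"
  using X
proof (induction rule: Mtup_irr_induct)
  case (sum A B)
  then show ?case using compatibleD(4)[OF f] opnorm_dsum_le by simp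
next
  case (conj A U)
  then show ?case
    using compatibleD(1-3)[OF f conj(1)] opnorm_conj_le[OF conj(2), of "f A"] by simp
qed (rule le)

lemma compatible_invertible:
  assumes f: "compatible l f" and inv: "\<And>Y. Y \<in> irr \<Longrightarrow> \<exists>B. B \<in> carrier_mat (tdim Y) (tdim Y) \<and> f Y * B = 1\<^sub>m (tdim Y)"
    and X: "X \<in> Mtup l"
  shows "\<exists>B. B \<in> carrier_mat (tdim X) (tdim X) \<and> f X * B = 1\<^sub>m (tdim X)"
  using X
proof (induction rule: Mtup_irr_induct)
  case (sum A B)
  then obtain C D where "C \<in> carrier_mat (tdim A) (tdim A)" "f A * C = 1\<^sub>m (tdim A)"
    "D \<in> carrier_mat (tdim B) (tdim B)" "f B * D = 1\<^sub>m (tdim B)" by blast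
  then show ?case using compatibleD[OF f sum(1)] compatibleD(1,2)[OF f sum(2)] sum(1,2)
    by (intro exI[of _ "dsum C D"]) (simp add: dsumt_Mtup dsum_mult dsum_one)
next
  case (conj A U)
  then obtain C where C: "C \<in> carrier_mat (tdim A) (tdim A)" "f A * C = 1\<^sub>m (tdim A)" by blast
  note Ud = unitaryD[OF conj(2)] unitary_cancel[OF conj(2)] and D = compatibleD(1-3)[OF f conj(1)]
  have "U * f A * adj U * (U * C * adj U) = U * (f A * C) * adj U"
    using C D by (intro conj_mult[OF conj(2)]) auto
  also have "\<dots> = 1\<^sub>m (tdim A)" using C Ud by simp
  finally show ?case using conj C D Ud
    by (intro exI[of _ "U * C * adj U"]) (simp add: conjt_Mtup)
qed (rule inv)

text \<open>In a basis where \<open>p\<close> is diagonal with its ones first, commuting matrices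
  are block diagonal, so a nontrivial \<open>p\<close> would split \<open>Y\<close> into two
  summands.\<close>

lemma irr_commuting_projection:
  assumes Y: "Y \<in> irr" and p: "isproj (tdim Y) p" and comm: "\<And>k. k < l \<Longrightarrow> p * Y ! k = Y ! k * p"
  shows "p = 0\<^sub>m (tdim Y) (tdim Y) \<or> p = 1\<^sub>m (tdim Y)"
proof (rule ccontr)
  assume nt: "\<not> ?thesis"
  define n where "n = tdim Y"
  note YM = irr_Mtup[OF Y]
  have Yd: "length Y = l" "1 \<le> n" "\<And>k. k < l \<Longrightarrow> dim_row (Y ! k) = n" "\<And>k. k < l \<Longrightarrow> dim_col (Y ! k) = n"
    using MtupD[OF YM] by (auto simp: n_def)
  obtain U r where U: "unitary n U" "r \<le> n" "p = U * dsum (1\<^sub>m r) (0\<^sub>m (n - r) (n - r)) * adj U"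
    using isproj_diagonalization[OF p[folded n_def]] .
  note Ud = unitaryD[OF U(1)] unitary_cancel[OF U(1)]
  define P where "P = dsum (1\<^sub>m r) (0\<^sub>m (n - r) (n - r) :: complex mat)"
  have P: "dim_row P = n" "dim_col P = n" using U(2) by (auto simp: P_def)
  have r: "r \<noteq> 0" "r \<noteq> n"
  proof -
    have "P = 0\<^sub>m n n" if "r = 0" unfolding P_def that by (intro eq_matI) (auto simp: dsum_index)
    moreover have "P = 1\<^sub>m n" if "r = n" unfolding P_def that by (intro eq_matI) (auto simp: dsum_index)
    moreover have "p = U * P * adj U" unfolding P_def by (rule U(3))
    ultimately have "r = 0 \<Longrightarrow> p = 0\<^sub>m n n" "r = n \<Longrightarrow> p = 1\<^sub>m n" using Ud(1-3) by auto
    then show "r \<noteq> 0" "r \<noteq> n" using nt unfolding n_def by blast+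
  qed
  have Pi: "P $$ (i,j) = (if i = j \<and> i < r then 1 else 0)" if "i < n" "j < n" for i j
    using that U(2) by (auto simp: P_def dsum_index)
  define Z where "Z k = adj U * Y ! k * U" for k
  have Z: "dim_row (Z k) = n" "dim_col (Z k) = n" "Y ! k = U * Z k * adj U" if "k < l" for k
    using Ud Yd that by (auto simp: Z_def mm_assoc)
  have ZP: "P * Z k = Z k * P" if k: "k < l" for k
  proof -
    have "P * Z k = adj U * (p * Y ! k) * U" unfolding U(3) P_def[symmetric] Z_def
      using Ud Yd k P by (simp add: mm_assoc)
    also have "\<dots> = Z k * P" unfolding comm[OF k] unfolding U(3) P_def[symmetric] Z_def
      using Ud Yd k P by (simp add: mm_assoc)
    finally show ?thesis .
  qed
  \<comment> \<open>If exactly one of the indices is below \<open>r\<close>, one of the two equal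
    entries of \<open>P * Z k\<close> and \<open>Z k * P\<close> is \<open>Z k $$ (i,j)\<close> and
    the other is 0.\<close>
  have off: "Z k $$ (i,j) = 0" if k: "k < l" and ij: "i < n" "j < n" "i < r \<longleftrightarrow> \<not> j < r" for i j k
  proof -
    have a: "(P * Z k) $$ (i,j) = (if i < r then Z k $$ (i,j) else 0)"
    proof -
      have "(P * Z k) $$ (i,j) = (\<Sum>q<n. P $$ (i,q) * Z k $$ (q,j))"
        using P Z k ij by (intro mult_index) auto
      also have "\<dots> = (\<Sum>q<n. if q = i then (if i < r then Z k $$ (i,j) else 0) else 0)"
        using ij by (intro sum.cong) (auto simp: Pi)
      finally show ?thesis using ij by simp
    qed
    have b: "(Z k * P) $$ (i,j) = (if j < r then Z k $$ (i,j) else 0)"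
    proof -
      have "(Z k * P) $$ (i,j) = (\<Sum>q<n. Z k $$ (i,q) * P $$ (q,j))"
        using P Z k ij by (intro mult_index) auto
      also have "\<dots> = (\<Sum>q<n. if q = j then (if j < r then Z k $$ (i,j) else 0) else 0)"
        using ij by (intro sum.cong) (auto simp: Pi)
      finally show ?thesis using ij by simp
    qed
    show ?thesis using a b ZP[OF k] ij(3) by (auto split: if_splits)
  qed
  define A where "A = map (\<lambda>k. mat r r (\<lambda>(i,j). Z k $$ (i,j))) [0..<l]"
  define B where "B = map (\<lambda>k. mat (n - r) (n - r) (\<lambda>(i,j). Z k $$ (i + r,j + r))) [0..<l]"
  have A: "A \<in> Mtup l" "tdim A = r" using MtupI[of A l r] l r by (auto simp: A_def)
  have B: "B \<in> Mtup l" "tdim B = n - r" using MtupI[of B l "n - r"] l r U(2) by (auto simp: B_def)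
  note S = dsumt_Mtup[OF A(1) B(1)]
  have SZ: "dsumt A B ! k = Z k" if k: "k < l" for k
    unfolding S(3)[OF k] using k U(2) off[OF k] Z[OF k]
    by (intro eq_matI) (auto simp: A_def B_def dsum_index)
  have "unitary (tdim (dsumt A B)) U" using U A B S(2) by simp
  then have "Y = conjt U (dsumt A B)"
    using Yd Z SZ conjt_Mtup[OF S(1)] by (intro nth_equalityI) (auto simp: MtupD)
  moreover have "unitary (tdim A + tdim B) U" using U A B by simp
  ultimately show False using Y A B unfolding irr_def by blast
qed

text \<open>Invariance under the matrices and their adjoints makes the orthogonal projection onto
  \<open>K\<close> commute with \<open>Y\<close>; this projection is then 0 or 1, and
  \<open>v\<close> rules out 0.\<close>

lemma irr_invariant_subspace:
  assumes Y: "Y \<in> irr"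
    and K: "K \<subseteq> carrier_vec (tdim Y)" "0\<^sub>v (tdim Y) \<in> K" "\<And>v w. v \<in> K \<Longrightarrow> w \<in> K \<Longrightarrow> v + w \<in> K" "\<And>c v. v \<in> K \<Longrightarrow> c \<cdot>\<^sub>v v \<in> K"
    and inv: "\<And>k v. k < l \<Longrightarrow> v \<in> K \<Longrightarrow> Y ! k *\<^sub>v v \<in> K" "\<And>k v. k < l \<Longrightarrow> v \<in> K \<Longrightarrow> adj (Y ! k) *\<^sub>v v \<in> K"
    and ne: "v \<in> K" "v \<noteq> 0\<^sub>v (tdim Y)"
  shows "K = carrier_vec (tdim Y)"
proof -
  let ?n = "tdim Y"
  note YD = MtupD[OF irr_Mtup[OF Y]]
  obtain p where p: "isproj ?n p" "\<And>v. v \<in> carrier_vec ?n \<Longrightarrow> p *\<^sub>v v \<in> K" "\<And>v. v \<in> K \<Longrightarrow> p *\<^sub>v v = v"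
    using subspace_projection[OF K] by blast
  note pD = isprojD[OF p(1)]
  have "p * Y ! k = Y ! k * p" if k: "k < l" for k
  proof -
    have 1: "p * (Y ! k * p) = Y ! k * p"
      using pD YD k p inv(1)[OF k] by (intro mat_eq_vecI[of _ ?n ?n]) (auto simp: mv_assoc)
    have 2: "p * (adj (Y ! k) * p) = adj (Y ! k) * p"
      using pD YD k p inv(2)[OF k] by (intro mat_eq_vecI[of _ ?n ?n]) (auto simp: mv_assoc)
    \<comment> \<open>The adjoint of fact \<open>2\<close> says that \<open>Y ! k\<close> also
      preserves the orthogonal complement of \<open>K\<close>.\<close>
    have "adj (p * (adj (Y ! k) * p)) = adj (adj (Y ! k) * p)" using 2 by simp
    then have "p * (Y ! k * p) = p * Y ! k" using pD YD k
      by (simp add: adj_mult[of _ ?n ?n] mm_assoc)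
    then show ?thesis using 1 by simp
  qed
  then have "p = 0\<^sub>m ?n ?n \<or> p = 1\<^sub>m ?n" by (rule irr_commuting_projection[OF Y p(1)])
  then show ?thesis
  proof
    assume "p = 0\<^sub>m ?n ?n"
    then show ?thesis using p(3)[OF ne(1)] ne K(1) by auto
  next
    assume "p = 1\<^sub>m ?n"
    then show ?thesis using p(2) K(1) by auto
  qed
qed

text \<open>Schur's lemma: an eigenspace of \<open>A\<close> is invariant under \<open>Y\<close> and
  its adjoints, hence is the whole space.\<close>

lemma irr_schur:
  assumes Y: "Y \<in> irr" and A: "A \<in> carrier_mat (tdim Y) (tdim Y)"
    and c: "\<And>k. k < l \<Longrightarrow> A * Y ! k = Y ! k * A" "\<And>k. k < l \<Longrightarrow> A * adj (Y ! k) = adj (Y ! k) * A"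
  obtains c where "A = c \<cdot>\<^sub>m 1\<^sub>m (tdim Y)"
proof -
  let ?n = "tdim Y"
  note YD = MtupD[OF irr_Mtup[OF Y]]
  have "spectrum A \<noteq> {}" using spectrum_non_empty[OF A] YD(2) by simp
  then obtain c v where "eigenvector A v c" unfolding spectrum_def eigenvalue_def by auto
  then have v: "v \<in> carrier_vec ?n" "v \<noteq> 0\<^sub>v ?n" "A *\<^sub>v v = c \<cdot>\<^sub>v v"
    using A by (auto simp: eigenvector_def)
  define K where "K = {v \<in> carrier_vec ?n. A *\<^sub>v v = c \<cdot>\<^sub>v v}"
  have inv: "B *\<^sub>v x \<in> K" if "x \<in> K" "A * B = B * A" "dim_row B = ?n" "dim_col B = ?n" for B x
  proof -
    have x: "dim_vec x = ?n" "A *\<^sub>v x = c \<cdot>\<^sub>v x" using that by (auto simp: K_def)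
    have "A *\<^sub>v (B *\<^sub>v x) = B *\<^sub>v (A *\<^sub>v x)" using that x(1) A by (simp flip: mv_assoc)
    then show ?thesis using that x by (simp add: K_def mv_distrib)
  qed
  have "K = carrier_vec ?n"
  proof (rule irr_invariant_subspace[OF Y])
    fix k x assume "k < l" "x \<in> K"
    then show "Y ! k *\<^sub>v x \<in> K" "adj (Y ! k) *\<^sub>v x \<in> K" using inv c YD by auto
  next
    show "v \<in> K" "v \<noteq> 0\<^sub>v ?n" using v by (auto simp: K_def)
  next
    fix x y assume "x \<in> K" "y \<in> K"
    then show "x + y \<in> K" using A by (auto simp: K_def mv_distrib smult_add_distrib_vec[of _ ?n])
  next
    fix d x assume "x \<in> K"
    then show "d \<cdot>\<^sub>v x \<in> K" using A by (auto simp: K_def mv_distrib smult_smult_assoc mult.commute)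
  next
    show "0\<^sub>v ?n \<in> K" using A by (auto simp: K_def)
  qed (auto simp: K_def)
  then have "A *\<^sub>v x = c \<cdot>\<^sub>v x" if "x \<in> carrier_vec ?n" for x using that unfolding K_def by blast
  then have "A = c \<cdot>\<^sub>m 1\<^sub>m ?n" using A by (intro mat_eq_vecI[of _ ?n ?n]) (auto simp: mv_distrib)
  then show ?thesis using that by blast
qed

end

section \<open>A functional monotone class theorem\<close>

text \<open>The sets with property \<open>P\<close> form a sigma-algebra: \<open>P\<close> passes to
  complements by linear combination, to finite unions by products of complements, and to countable
  unions by bounded limits.\<close>

lemma monotone_class_indicator:
  fixes P :: "('a \<Rightarrow> complex) \<Rightarrow> bool"
  assumes one: "P (\<lambda>_. 1)"
    and add: "\<And>f g. P f \<Longrightarrow> P g \<Longrightarrow> P (\<lambda>x. f x + g x)"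
    and mult: "\<And>f g. P f \<Longrightarrow> P g \<Longrightarrow> P (\<lambda>x. f x * g x)"
    and smult: "\<And>c f. P f \<Longrightarrow> P (\<lambda>x. c * f x)"
    and lim: "\<And>F f C. (\<And>n. P (F n)) \<Longrightarrow> (\<And>n x. x \<in> \<Omega> \<Longrightarrow> cmod (F n x) \<le> C) \<Longrightarrow>
       (\<And>x. x \<in> \<Omega> \<Longrightarrow> (\<lambda>n. F n x) \<longlonglongrightarrow> f x) \<Longrightarrow> P f"
    and G: "\<And>A. A \<in> G \<Longrightarrow> P (indicator A)"
    and A: "A \<in> sigma_sets \<Omega> G"
  shows "P (indicator A)"
  using A
proof induction
  case (Basic a)
  then show ?case by (rule G)
next
  case Empty
  have "P (\<lambda>x. 0 * 1)" by (rule smult[OF one])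
  then show ?case by (simp add: indicator_def)
next
  case (Compl a)
  have "P (\<lambda>x. 1 + (-1) * indicator a x)" by (intro add one smult Compl.IH)
  then show ?case
    \<comment> \<open>A constant sequence: \<open>lim\<close> looks only at points of
      \<open>\<Omega>\<close>, so it transfers \<open>P\<close> to a function that agrees there but
      may differ outside.\<close>
    by (rule lim[where F = "\<lambda>_. \<lambda>x. 1 + (-1) * indicator a x" and C = 2])
      (auto simp: indicator_def)
next
  case (Union a)
  \<comment> \<open>The indicator of the complement of the union of the first \<open>n\<close> sets,
    written as a product so that \<open>mult\<close> applies.\<close>
  define F where "F n x = (\<Prod>i<n. (1 + (-1) * indicator (a i) x :: complex))" for n x
  have F: "P (F n)" for n
  proof (induction n)
    case 0 then show ?case using one by (simp add: F_def)
  next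
    case (Suc n)
    have "P (\<lambda>x. F n x * (1 + (-1) * indicator (a n) x))" by (intro mult Suc add one smult Union.IH)
    then show ?case by (simp add: F_def)
  qed
  have val: "F n x = (if \<exists>i<n. x \<in> a i then 0 else 1)" for n x
    by (auto simp: F_def indicator_def intro!: prod.neutral)
  have "P (\<lambda>x. 1 + (-1) * F n x)" for n by (intro add one smult F)
  then show ?case
  proof (rule lim[where C = 1])
    fix n x show "cmod (1 + (-1) * F n x) \<le> 1" by (auto simp: val)
  next
    fix x
    show "(\<lambda>n. 1 + (-1) * F n x) \<longlonglongrightarrow> indicator (\<Union> (range a)) x"
    proof (cases "\<exists>i. x \<in> a i")
      case True
      then obtain i where i: "x \<in> a i" by blast
      have "\<forall>\<^sub>F n in sequentially. 1 + (-1) * F n x = indicator (\<Union> (range a)) x"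
        using eventually_gt_at_top[of i] by eventually_elim (use i in \<open>auto simp: val indicator_def\<close>)
      then show ?thesis by (rule tendsto_eventually)
    qed (auto simp: val indicator_def)
  qed
qed

lemma monotone_class_bounded:
  fixes P :: "('a \<Rightarrow> complex) \<Rightarrow> bool"
  assumes one: "P (\<lambda>_. 1)"
    and add: "\<And>f g. P f \<Longrightarrow> P g \<Longrightarrow> P (\<lambda>x. f x + g x)"
    and mult: "\<And>f g. P f \<Longrightarrow> P g \<Longrightarrow> P (\<lambda>x. f x * g x)"
    and smult: "\<And>c f. P f \<Longrightarrow> P (\<lambda>x. c * f x)"
    and lim: "\<And>F f C. (\<And>n. P (F n)) \<Longrightarrow> (\<And>n x. x \<in> \<Omega> \<Longrightarrow> cmod (F n x) \<le> C) \<Longrightarrow>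
       (\<And>x. x \<in> \<Omega> \<Longrightarrow> (\<lambda>n. F n x) \<longlonglongrightarrow> f x) \<Longrightarrow> P f"
    and G: "\<And>A. A \<in> G \<Longrightarrow> P (indicator A)"
    and GP: "G \<subseteq> Pow \<Omega>"
    and g: "g \<in> borel_measurable (sigma \<Omega> G)" and bd: "\<And>x. x \<in> \<Omega> \<Longrightarrow> cmod (g x) \<le> C"
  shows "P g"
proof -
  let ?M = "sigma \<Omega> G"
  have ind: "P (indicator A)" if "A \<in> sets ?M" for A
    by (rule monotone_class_indicator[of P \<Omega> G, OF one add mult smult lim G])
      (use that GP in \<open>simp_all add: sets_measure_of\<close>)
  have zero: "P (\<lambda>x. 0)" using smult[OF one, of 0] by simp
  \<comment> \<open>The factor 2 in this approximation by simple functions is the reason for the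
    bound \<open>2 * C\<close> in the final limit.\<close>
  obtain F where F: "\<And>i. simple_function ?M (F i)" "\<And>x. x \<in> space ?M \<Longrightarrow> (\<lambda>i. F i x) \<longlonglongrightarrow> g x"
    "\<And>i x. x \<in> space ?M \<Longrightarrow> dist (F i x) 0 \<le> 2 * dist (g x) 0"
    using borel_measurable_implies_sequence_metric[OF g, of 0] by blast
  have sp: "space ?M = \<Omega>" using GP by (simp add: space_measure_of)
  have "P (F i)" for i
  proof -
    have fin: "finite (F i ` \<Omega>)" using F(1)[of i] unfolding simple_function_def sp by blast
    have S: "P (\<lambda>x. \<Sum>y\<in>S. y * indicator (F i -` {y} \<inter> \<Omega>) x)" if "finite S" "S \<subseteq> F i ` \<Omega>" for S
      using that
    proof (induction S)
      case (insert y S)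
      then have "P (\<lambda>x. y * indicator (F i -` {y} \<inter> \<Omega>) x + (\<Sum>y\<in>S. y * indicator (F i -` {y} \<inter> \<Omega>) x))"
        using F(1)[of i] unfolding simple_function_def sp by (intro add smult ind) auto
      then show ?case unfolding sum.insert[OF insert.hyps(1,2)] .
    qed (simp add: zero)
    have eq: "(\<Sum>y\<in>F i ` \<Omega>. y * indicator (F i -` {y} \<inter> \<Omega>) x) = F i x" if "x \<in> \<Omega>" for x
    proof -
      have "(\<Sum>y\<in>F i ` \<Omega>. y * indicator (F i -` {y} \<inter> \<Omega>) x) = (\<Sum>y\<in>F i ` \<Omega>. if y = F i x then y else 0)"
        using that by (intro sum.cong) (auto simp: indicator_def)
      then show ?thesis using that fin by simp
    qed
    obtain B where B: "\<And>y. y \<in> F i ` \<Omega> \<Longrightarrow> cmod y \<le> B"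
      using finite_imp_bounded[OF fin] by (auto simp: bounded_iff)
    show ?thesis
    \<comment> \<open>Again a constant sequence: the sum over level sets equals \<open>F i\<close>
      only on \<open>\<Omega>\<close>.\<close>
    proof (rule lim[where F = "\<lambda>_ x. \<Sum>y\<in>F i ` \<Omega>. y * indicator (F i -` {y} \<inter> \<Omega>) x" and C = B])
      show "P (\<lambda>x. \<Sum>y\<in>F i ` \<Omega>. y * indicator (F i -` {y} \<inter> \<Omega>) x)" by (rule S[OF fin]) simp
    qed (use B in \<open>simp_all only: eq tendsto_const image_eqI\<close>)
  qed
  then show ?thesis
  proof (rule lim[where C = "2 * C"])
    fix n x assume "x \<in> \<Omega>"
    then show "cmod (F n x) \<le> 2 * C" using F(3)[of x n] bd[of x] by (simp add: sp dist_norm)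
  qed (use F(2) sp in auto)
qed

section \<open>Entrywise limits of matrices, and a sequence of functions that detects a sign\<close>

definition mlim :: "nat \<Rightarrow> (nat \<Rightarrow> complex mat) \<Rightarrow> complex mat \<Rightarrow> bool" where
  "mlim d A B \<longleftrightarrow> (\<forall>m. A m \<in> carrier_mat d d) \<and> B \<in> carrier_mat d d \<and>
     (\<forall>i<d. \<forall>j<d. (\<lambda>m. A m $$ (i,j)) \<longlonglongrightarrow> B $$ (i,j))"

lemma mlim_unique: "mlim d A B \<Longrightarrow> mlim d A C \<Longrightarrow> B = C"
  unfolding mlim_def by (intro eq_matI) (metis LIMSEQ_unique carrier_mat_iff)+

lemma mlim_const: "B \<in> carrier_mat d d \<Longrightarrow> mlim d (\<lambda>_. B) B"
  by (auto simp: mlim_def)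

lemma mlim_mult:
  assumes "mlim d A B" "mlim d C D" shows "mlim d (\<lambda>m. A m * C m) (B * D)"
proof -
  have dims: "A m \<in> carrier_mat d d" "C m \<in> carrier_mat d d" "B \<in> carrier_mat d d" "D \<in> carrier_mat d d" for m
    using assms by (auto simp: mlim_def)
  have "(\<lambda>m. (A m * C m) $$ (i,j)) \<longlonglongrightarrow> (B * D) $$ (i,j)" if "i < d" "j < d" for i j
    unfolding mult_index[OF dims(1,2) that] mult_index[OF dims(3,4) that]
    by (intro tendsto_intros) (use assms that in \<open>auto simp: mlim_def\<close>)
  then show ?thesis using dims by (auto simp: mlim_def simp del: index_mult_mat(1))
qed

lemma mlim_dsum:
  assumes "mlim d A B" "mlim e C D" shows "mlim (d + e) (\<lambda>m. dsum (A m) (C m)) (dsum B D)"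
proof -
  have dims: "A m \<in> carrier_mat d d" "C m \<in> carrier_mat e e" "B \<in> carrier_mat d d" "D \<in> carrier_mat e e" for m
    using assms by (auto simp: mlim_def)
  show ?thesis unfolding mlim_def
  proof (intro conjI allI impI)
    fix i j assume ij: "i < d + e" "j < d + e"
    have 1: "dsum (A m) (C m) $$ (i,j) = (if i < d then if j < d then A m $$ (i,j) else 0
        else if j < d then 0 else C m $$ (i - d, j - d))" for m
      using dims(1,2)[of m] ij by (simp add: dsum_index)
    have 2: "dsum B D $$ (i,j) = (if i < d then if j < d then B $$ (i,j) else 0
        else if j < d then 0 else D $$ (i - d, j - d))"
      using dims(3,4) ij by (simp add: dsum_index)
    show "(\<lambda>m. dsum (A m) (C m) $$ (i,j)) \<longlonglongrightarrow> dsum B D $$ (i,j)"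
      unfolding 1 2 using assms ij by (auto simp: mlim_def)
  qed (use dims in auto)
qed

text \<open>The function \<open>s / (1 + s\<^sup>2)\<close> has the sign of \<open>s\<close> and
  modulus at most 1/2. Shifting it by 1 turns the sign into a comparison with 1 and keeps the base
  nonnegative, so that \<open>1 + x ^ m\<close> is at least 1 for its powers.\<close>

lemma sigmoid_base:
  fixes s :: real
  shows "0 \<le> 1 + s * (1 / (1 + s * s))"
    and "1 + s * (1 / (1 + s * s)) > 1 \<longleftrightarrow> s > 0"
    and "1 + s * (1 / (1 + s * s)) = 1 \<longleftrightarrow> s = 0"
proof -
  have p: "0 < 1 + s * s" using add_pos_nonneg[of 1 "s * s"] by simp
  \<comment> \<open>This sum of squares is twice \<open>1 + s + s * s\<close>, the numerator of the
    base.\<close>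
  have "0 \<le> (1 + s) * (1 + s) + (1 + s * s)" by (intro add_nonneg_nonneg) auto
  then have "0 \<le> (1 + s * s + s) / (1 + s * s)" using p by (intro divide_nonneg_pos) (simp add: algebra_simps)
  also have "\<dots> = 1 + s * (1 / (1 + s * s))" using p by (simp add: add_divide_distrib)
  finally show "0 \<le> 1 + s * (1 / (1 + s * s))" .
  show "1 + s * (1 / (1 + s * s)) > 1 \<longleftrightarrow> s > 0" using p by (simp add: zero_less_divide_iff)
  show "1 + s * (1 / (1 + s * s)) = 1 \<longleftrightarrow> s = 0" using p by simp
qed

lemma sigmoid_limit:
  fixes x :: real
  assumes "0 \<le> x"
  shows "(\<lambda>m. 1 / (1 + x ^ m)) \<longlonglongrightarrow> (if x > 1 then 0 else if x = 1 then 1/2 else 1)"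
proof -
  consider "x > 1" | "x = 1" | "x < 1" by linarith
  then show ?thesis
  proof cases
    case 1
    have "(\<lambda>m. (1 / x) ^ m) \<longlonglongrightarrow> 0" using 1 by (intro LIMSEQ_power_zero) auto
    then have "(\<lambda>m. 1 / (1 + x ^ m)) \<longlonglongrightarrow> 0"
    proof (rule tendsto_sandwich[OF _ _ tendsto_const, rotated 2])
      show "\<forall>\<^sub>F m in sequentially. 0 \<le> 1 / (1 + x ^ m)" using assms by simp
      have "1 / (1 + x ^ m) \<le> (1 / x) ^ m" for m
      proof -
        have "0 < x ^ m" using 1 by simp
        then show ?thesis by (simp add: power_divide frac_le)
      qed
      then show "\<forall>\<^sub>F m in sequentially. 1 / (1 + x ^ m) \<le> (1 / x) ^ m" by simp
    qed
    then show ?thesis using 1 by simp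
  next
    case 3
    then have "(\<lambda>m. x ^ m) \<longlonglongrightarrow> 0" using assms by (intro LIMSEQ_power_zero) auto
    then have "(\<lambda>m. 1 / (1 + x ^ m)) \<longlonglongrightarrow> 1 / (1 + 0)" by (intro tendsto_divide tendsto_add tendsto_const) auto
    then show ?thesis using 3 by simp
  qed simp
qed

section \<open>Closed subalgebras\<close>

locale closed_subalgebra = tuple_length +
  fixes loc :: bool and F0 E :: "(complex mat list \<Rightarrow> complex mat) set"
  assumes F0: "F0 = (if loc then Floc l else Falg l)"
    and sub: "unital_star_subalg l F0 E"
    and E0: "\<And>j. 1 \<le> j \<Longrightarrow> j \<le> l \<Longrightarrow> proj l j \<in> E"
    and E1: "\<And>f. f \<in> E \<Longrightarrow> (\<forall>X\<in>Mtup l. invertible_mat (f X)) \<Longrightarrow> finv l f \<in> F0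
               \<Longrightarrow> finv l f \<in> E"
    and E2: "\<And>fs f. (\<forall>n. fs n \<in> E) \<Longrightarrow> (\<exists>C. \<forall>n. \<forall>X\<in>Mtup l. opnorm (fs n X) \<le> C)
               \<Longrightarrow> f \<in> F0 \<Longrightarrow> (\<forall>X\<in>Mtup l. (\<lambda>n. opnorm (fs n X - f X)) \<longlonglongrightarrow> 0)
               \<Longrightarrow> f \<in> E"
begin

lemma F0_Falg: "f \<in> F0 \<Longrightarrow> f \<in> Falg l"
  by (auto simp: F0 Floc_def split: if_splits)

lemma E_F0: "f \<in> E \<Longrightarrow> f \<in> F0"
  using sub by (auto simp: unital_star_subalg_def)

text \<open>This is why both choices of \<open>F0\<close> can be treated together: until the last
  step all memberships in \<open>F0\<close> that have to be proved concern bounded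
  functions.\<close>

lemma F0_boundedI:
  assumes "f \<in> Falg l" "\<And>X. X \<in> Mtup l \<Longrightarrow> opnorm (f X) \<le> C"
  shows "f \<in> F0"
  using assms by (auto simp: F0 Floc_def)

lemma E_compatible: "f \<in> E \<Longrightarrow> compatible l f" and E_borel: "f \<in> E \<Longrightarrow> borel_fun l f"
  using F0_Falg[OF E_F0] FalgD by auto

text \<open>Functions in \<open>E\<close> are determined by their values on irreducible tuples, and \<open>onE k\<close> says
  that \<open>k\<close>, which need only be meaningful there, is the restriction of an element of \<open>E\<close>.\<close>

definition onE :: "(complex mat list \<Rightarrow> complex mat) \<Rightarrow> bool" where
  "onE k \<longleftrightarrow> (\<exists>g\<in>E. \<forall>Y\<in>irr. g Y = k Y)"

lemma onE_mem: "f \<in> E \<Longrightarrow> onE f"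
  by (auto simp: onE_def)

text \<open>Compatible functions that agree on \<open>irr\<close> agree on all tuples, and both
  functions are fixed to \<open>undefined\<close> elsewhere.\<close>

lemma mem_onE: assumes "onE f" "f \<in> F0" shows "f \<in> E"
proof -
  obtain g where g: "g \<in> E" "\<And>Y. Y \<in> irr \<Longrightarrow> g Y = f Y" using assms by (auto simp: onE_def)
  note f = FalgD[OF F0_Falg[OF assms(2)]] and g' = FalgD[OF F0_Falg[OF E_F0[OF g(1)]]]
  have "g = f"
    by (rule ext_fun_eqI[OF g'(3) f(3)]) (rule compatible_eqI[OF g'(1) f(1) g(2)])
  then show ?thesis using g by simp
qed

lemma onE_dim: assumes "onE k" "Y \<in> irr" shows "dim_row (k Y) = tdim Y" "dim_col (k Y) = tdim Y"
proof -
  obtain g where g: "g \<in> E" "g Y = k Y" using assms by (auto simp: onE_def)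
  show "dim_row (k Y) = tdim Y" "dim_col (k Y) = tdim Y"
    using compatibleD(1,2)[OF E_compatible[OF g(1)] irr_Mtup[OF assms(2)]] g(2) by auto
qed

lemma onE_cong: "onE k \<Longrightarrow> (\<And>Y. Y \<in> irr \<Longrightarrow> k Y = k' Y) \<Longrightarrow> onE k'"
  by (auto simp: onE_def)

lemma onE_restr: "restr l f \<in> E \<Longrightarrow> onE f"
  by (rule onE_cong[OF onE_mem[of "restr l f"]]) (auto simp: restr_apply irr_Mtup)

lemma onE_one: "onE (\<lambda>Y. 1\<^sub>m (tdim Y))"
  by (rule onE_restr) (use sub in \<open>simp add: unital_star_subalg_def unitf_def\<close>)

lemma onE_nth: "k < l \<Longrightarrow> onE (\<lambda>Y. Y ! k)"
  by (rule onE_restr) (use E0[of "Suc k"] in \<open>simp add: proj_def\<close>)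

lemma onE_add: assumes "onE f" "onE g" shows "onE (\<lambda>Y. f Y + g Y)"
proof -
  obtain f' g' where "f' \<in> E" "\<forall>Y\<in>irr. f' Y = f Y" "g' \<in> E" "\<forall>Y\<in>irr. g' Y = g Y"
    using assms by (auto simp: onE_def)
  moreover from this have "restr l (\<lambda>X. f' X + g' X) \<in> E" using sub by (simp add: unital_star_subalg_def)
  ultimately show ?thesis by (intro onE_cong[OF onE_restr[of "\<lambda>X. f' X + g' X"]]) auto
qed

lemma onE_mult: assumes "onE f" "onE g" shows "onE (\<lambda>Y. f Y * g Y)"
proof -
  obtain f' g' where "f' \<in> E" "\<forall>Y\<in>irr. f' Y = f Y" "g' \<in> E" "\<forall>Y\<in>irr. g' Y = g Y"
    using assms by (auto simp: onE_def)
  moreover from this have "restr l (\<lambda>X. f' X * g' X) \<in> E" using sub by (simp add: unital_star_subalg_def)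
  ultimately show ?thesis by (intro onE_cong[OF onE_restr[of "\<lambda>X. f' X * g' X"]]) auto
qed

lemma onE_smult: assumes "onE f" shows "onE (\<lambda>Y. c \<cdot>\<^sub>m f Y)"
proof -
  obtain f' where "f' \<in> E" "\<forall>Y\<in>irr. f' Y = f Y"
    using assms by (auto simp: onE_def)
  moreover from this have "restr l (\<lambda>X. c \<cdot>\<^sub>m f' X) \<in> E" using sub by (simp add: unital_star_subalg_def)
  ultimately show ?thesis by (intro onE_cong[OF onE_restr[of "\<lambda>X. c \<cdot>\<^sub>m f' X"]]) auto
qed

lemma onE_adj: assumes "onE f" shows "onE (\<lambda>Y. adj (f Y))"
proof -
  obtain f' where "f' \<in> E" "\<forall>Y\<in>irr. f' Y = f Y"
    using assms by (auto simp: onE_def)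
  moreover from this have "restr l (\<lambda>X. adj (f' X)) \<in> E" using sub by (simp add: unital_star_subalg_def)
  ultimately show ?thesis by (intro onE_cong[OF onE_restr[of "\<lambda>X. adj (f' X)"]]) auto
qed

lemma onE_minus: assumes "onE f" "onE g" shows "onE (\<lambda>Y. f Y - g Y)"
  by (rule onE_cong[OF onE_add[OF assms(1) onE_smult[OF assms(2), of "-1"]]])
    (use onE_dim[OF assms(1)] onE_dim[OF assms(2)] in auto)

lemma onE_zero: "onE (\<lambda>Y. 0\<^sub>m (tdim Y) (tdim Y))"
  by (rule onE_cong[OF onE_smult[OF onE_one, of 0]]) auto

text \<open>Form of (E2) with hypotheses on irreducible tuples only. Decomposition spreads the bound
  and the convergence to all tuples, and the limit is again compatible, Borel and bounded, hence in
  \<open>F0\<close>.\<close>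

lemma onE_lim:
  assumes K: "\<And>n. onE (K n)" and bd: "\<And>n Y. Y \<in> irr \<Longrightarrow> opnorm (K n Y) \<le> C"
    and lim: "\<And>Y. Y \<in> irr \<Longrightarrow> mlim (tdim Y) (\<lambda>n. K n Y) (k Y)"
  shows "onE k"
proof -
  obtain g where g: "\<And>n. g n \<in> E" "\<And>n Y. Y \<in> irr \<Longrightarrow> g n Y = K n Y"
    using K unfolding onE_def by metis
  note c = E_compatible[OF g(1)]
  \<comment> \<open>The hypotheses say nothing about reducible tuples; there the limit is assembled
    from those on the irreducible summands.\<close>
  have "\<exists>B. mlim (tdim X) (\<lambda>n. g n X) B" if "X \<in> Mtup l" for X
    using that
  proof (induction rule: Mtup_irr_induct)
    case (irr Y)
    then show ?case using lim[OF irr] g(2) by auto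
  next
    case (sum A B)
    then obtain C D where "mlim (tdim A) (\<lambda>n. g n A) C" "mlim (tdim B) (\<lambda>n. g n B) D" by blast
    then have "mlim (tdim A + tdim B) (\<lambda>n. dsum (g n A) (g n B)) (dsum C D)" by (rule mlim_dsum)
    then show ?case using compatibleD(4)[OF c sum(1,2)] dsumt_Mtup(2)[OF sum(1,2)] by auto
  next
    case (conj A U)
    then obtain C where C: "mlim (tdim A) (\<lambda>n. g n A) C" by blast
    have "mlim (tdim A) (\<lambda>n. U * g n A * adj U) (U * C * adj U)"
      using unitaryD[OF conj(2)] by (intro mlim_mult mlim_const C) auto
    then show ?case using compatibleD(3)[OF c conj(1,2)] conjt_Mtup(2)[OF conj(1,2)] by auto
  qed
  then obtain f where f: "\<And>X. X \<in> Mtup l \<Longrightarrow> mlim (tdim X) (\<lambda>n. g n X) (f X)" by metis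
  have cf: "compatible l f" unfolding compatible_iff
  proof (intro conjI ballI allI impI)
    fix X assume "X \<in> Mtup l"
    then show "f X \<in> carrier_mat (tdim X) (tdim X)" using f by (auto simp: mlim_def)
  next
    fix X U assume X: "X \<in> Mtup l" "unitary (tdim X) U"
    have "mlim (tdim X) (\<lambda>n. U * g n X * adj U) (U * f X * adj U)"
      using unitaryD[OF X(2)] by (intro mlim_mult mlim_const f X) auto
    moreover have "mlim (tdim X) (\<lambda>n. U * g n X * adj U) (f (conjt U X))"
      using f[OF conjt_Mtup(1)[OF X]] compatibleD(3)[OF c X] conjt_Mtup(2)[OF X] by simp
    ultimately show "f (conjt U X) = U * f X * adj U" by (rule mlim_unique[rotated])
  next
    fix X Y assume X: "X \<in> Mtup l" "Y \<in> Mtup l"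
    have "mlim (tdim X + tdim Y) (\<lambda>n. dsum (g n X) (g n Y)) (dsum (f X) (f Y))"
      by (intro mlim_dsum f X)
    moreover have "mlim (tdim X + tdim Y) (\<lambda>n. dsum (g n X) (g n Y)) (f (dsumt X Y))"
      using f[OF dsumt_Mtup(1)[OF X]] compatibleD(4)[OF c X] dsumt_Mtup(2)[OF X] by simp
    ultimately show "f (dsumt X Y) = dsum (f X) (f Y)" by (rule mlim_unique[rotated])
  qed
  have bf: "borel_fun l f"
  proof (rule borel_funI)
    fix n i j :: nat assume n: "1 \<le> n" "i < n" "j < n"
    show "(\<lambda>x. f (tup_of l n x) $$ (i,j)) \<in> borel_measurable (PiM ({..<l} \<times> {..<n} \<times> {..<n}) (\<lambda>_. borel))"
      by (rule borel_measurable_LIMSEQ_metric[where f = "\<lambda>m x. g m (tup_of l n x) $$ (i,j)", OF borel_funD[OF E_borel[OF g(1)] n]])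
        (use f[OF tup_of_Mtup(1)[OF n(1)]] tup_of_Mtup(2)[OF n(1)] n in \<open>auto simp: mlim_def\<close>)
  qed
  have gb: "opnorm (g n X) \<le> C" if "X \<in> Mtup l" for n X
    by (rule compatible_opnorm_le[OF c _ that]) (use bd g(2) in auto)
  have conv: "(\<lambda>n. opnorm (g n X - f X)) \<longlonglongrightarrow> 0" if "X \<in> Mtup l" for X
    using f[OF that] by (intro opnorm_tendsto_0[of _ "tdim X"]) (auto simp: mlim_def)
  \<comment> \<open>Write \<open>f X\<close> as \<open>g n X\<close> minus the error and let the
    error tend to 0.\<close>
  have fb: "opnorm (f X) \<le> C" if X: "X \<in> Mtup l" for X
  proof (rule LIMSEQ_le_const[of "\<lambda>n. C + opnorm (g n X - f X)" C])
    show "(\<lambda>n. C + opnorm (g n X - f X)) \<longlonglongrightarrow> C"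
      using tendsto_add[OF tendsto_const[of C] conv[OF X]] by simp
    have "opnorm (f X) \<le> C + opnorm (g n X - f X)" for n
    proof -
      have d: "dim_row (f X) = tdim X" "dim_col (f X) = tdim X" "dim_row (g n X) = tdim X" "dim_col (g n X) = tdim X"
        using compatibleD(1,2)[OF cf X] compatibleD(1,2)[OF c X] by auto
      have "f X = g n X + (-1) \<cdot>\<^sub>m (g n X - f X)" using d by (intro eq_matI) auto
      then have "opnorm (f X) \<le> opnorm (g n X) + opnorm ((-1) \<cdot>\<^sub>m (g n X - f X))"
        using opnorm_add[of "g n X" "(-1) \<cdot>\<^sub>m (g n X - f X)"] d by simp
      then show ?thesis using gb[OF X, of n] opnorm_smult[of "-1" "g n X - f X"] by simp
    qed
    then show "\<exists>N. \<forall>n\<ge>N. opnorm (f X) \<le> C + opnorm (g n X - f X)" by blast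
  qed
  have "restr l f \<in> F0"
    by (rule F0_boundedI[OF restr_FalgI[OF cf bf], of C]) (simp add: restr_apply fb)
  moreover have "\<exists>C. \<forall>n. \<forall>X\<in>Mtup l. opnorm (g n X) \<le> C" using gb by blast
  ultimately have "restr l f \<in> E"
    using g(1) conv by (intro E2[of g]) (simp_all add: restr_apply)
  moreover have "f Y = k Y" if "Y \<in> irr" for Y
    using mlim_unique[OF f[OF irr_Mtup[OF that]]] lim[OF that] g(2)[OF that] by simp
  ultimately show ?thesis by (intro onE_cong[OF onE_restr[of f]]) auto
qed

text \<open>Form of (E1) on irreducible tuples. The uniform bound \<open>C\<close> on the inverse
  places it in \<open>F0\<close> for both choices of \<open>F0\<close>.\<close>

lemma onE_inv:
  assumes k: "onE k" and inv: "\<And>Y. Y \<in> irr \<Longrightarrow> k Y * k' Y = 1\<^sub>m (tdim Y)"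
    and dim: "\<And>Y. Y \<in> irr \<Longrightarrow> k' Y \<in> carrier_mat (tdim Y) (tdim Y)"
    and bd: "\<And>Y. Y \<in> irr \<Longrightarrow> opnorm (k' Y) \<le> C"
  shows "onE k'"
proof -
  obtain g where g: "g \<in> E" "\<And>Y. Y \<in> irr \<Longrightarrow> g Y = k Y" using k by (auto simp: onE_def)
  note c = E_compatible[OF g(1)] and b = E_borel[OF g(1)]
  have i: "\<exists>B. B \<in> carrier_mat (tdim X) (tdim X) \<and> g X * B = 1\<^sub>m (tdim X)" if "X \<in> Mtup l" for X
    by (rule compatible_invertible[OF c _ that]) (use g(2) inv dim in metis)
  have mk: "minv (g Y) = k' Y" if "Y \<in> irr" for Y
    using compatibleD(1,2)[OF c irr_Mtup[OF that]] inv[OF that] dim[OF that] g(2)[OF that]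
    by (intro minv_eq[of _ "tdim Y"]) auto
  have cm: "compatible l (\<lambda>X. minv (g X))" by (rule compatible_inv[OF c i])
  have "finv l g \<in> F0" unfolding finv_def
    by (rule F0_boundedI[OF restr_FalgI[OF cm borel_fun_inv[OF c b i]], of C])
      (simp_all add: restr_apply compatible_opnorm_le[OF cm] mk bd)
  moreover have "invertible_mat (g X)" if X: "X \<in> Mtup l" for X
  proof -
    obtain B where B: "B \<in> carrier_mat (tdim X) (tdim X)" "g X * B = 1\<^sub>m (tdim X)" using i[OF X] by blast
    moreover have "B * g X = 1\<^sub>m (tdim X)"
      by (rule mat_mult_left_right_inverse[OF _ B]) (use compatibleD(1,2)[OF c X] in simp)
    ultimately show ?thesis using compatibleD(1,2)[OF c X]
      unfolding invertible_mat_def inverts_mat_def by auto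
  qed
  ultimately have "finv l g \<in> E" using E1 g(1) by blast
  then have "onE (\<lambda>X. minv (g X))" unfolding finv_def by (rule onE_restr)
  then show ?thesis by (rule onE_cong) (rule mk)
qed

section \<open>Functional calculus inside a closed subalgebra\<close>

context
  fixes h assumes h: "onE h" and hh: "\<And>Y. Y \<in> irr \<Longrightarrow> herm (tdim Y) (h Y)"
begin

text \<open>The bound on \<open>r\<close> makes the inverse a contraction even though
  \<open>r\<close> itself may be unbounded.\<close>

lemma onE_fc_inverse:
  assumes "onE (\<lambda>Y. fc (\<lambda>t. of_real (r t)) (h Y))" "\<And>t. 1 \<le> r t"
  shows "onE (\<lambda>Y. fc (\<lambda>t. of_real (1 / r t)) (h Y))"
proof (rule onE_inv[OF assms(1), where C = 1])
  have "r t \<noteq> 0" for t using assms(2)[of t] by auto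
  fix Y assume Y: "Y \<in> irr"
  have "fc (\<lambda>t. of_real (r t)) (h Y) * fc (\<lambda>t. of_real (1 / r t)) (h Y) = fc (\<lambda>t. 1) (h Y)"
    unfolding fc_mult[OF hh[OF Y]] using \<open>\<And>t. r t \<noteq> 0\<close> by simp
  then show "fc (\<lambda>t. of_real (r t)) (h Y) * fc (\<lambda>t. of_real (1 / r t)) (h Y) = 1\<^sub>m (tdim Y)"
    unfolding fc_const[OF hh[OF Y]] mm_smult .
  show "fc (\<lambda>t. of_real (1 / r t)) (h Y) \<in> carrier_mat (tdim Y) (tdim Y)" by (rule fc_carrier[OF hh[OF Y]])
  show "opnorm (fc (\<lambda>t. of_real (1 / r t)) (h Y)) \<le> 1"
  proof (rule opnorm_fc_le[OF hh[OF Y]])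
    fix t show "cmod (of_real (1 / r t)) \<le> 1" unfolding norm_of_real using assms(2)[of t] by (simp add: divide_simps)
  qed
qed

lemma onE_fc_const: "onE (\<lambda>Y. fc (\<lambda>_. c) (h Y))"
  by (rule onE_cong[OF onE_smult[OF onE_one, of c]]) (simp add: fc_const[OF hh])

lemma onE_fc_add: "onE (\<lambda>Y. fc f (h Y)) \<Longrightarrow> onE (\<lambda>Y. fc g (h Y)) \<Longrightarrow> onE (\<lambda>Y. fc (\<lambda>t. f t + g t) (h Y))"
  by (rule onE_cong[OF onE_add[of "\<lambda>Y. fc f (h Y)" "\<lambda>Y. fc g (h Y)"]]) (simp_all add: fc_add[OF hh])

lemma onE_fc_mult: "onE (\<lambda>Y. fc f (h Y)) \<Longrightarrow> onE (\<lambda>Y. fc g (h Y)) \<Longrightarrow> onE (\<lambda>Y. fc (\<lambda>t. f t * g t) (h Y))"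
  by (rule onE_cong[OF onE_mult[of "\<lambda>Y. fc f (h Y)" "\<lambda>Y. fc g (h Y)"]]) (simp_all add: fc_mult[OF hh])

lemma onE_fc_id: "onE (\<lambda>Y. fc of_real (h Y))"
  by (rule onE_cong[OF h]) (simp add: fc_id[OF hh])

lemma onE_fc_lim:
  assumes "\<And>n. onE (\<lambda>Y. fc (F n) (h Y))" "\<And>n t. cmod (F n t) \<le> C" "\<And>t. (\<lambda>n. F n t) \<longlonglongrightarrow> f t"
  shows "onE (\<lambda>Y. fc f (h Y))"
  by (rule onE_lim[where C = C, OF assms(1)])
    (use fc_carrier[OF hh] fc_tendsto[OF hh assms(3)] in \<open>auto simp: opnorm_fc_le[OF hh assms(2)] mlim_def simp del: fc_dim\<close>)

text \<open>With \<open>x = 1 + s / (1 + s\<^sup>2)\<close> and \<open>s = t - q\<close>, the functions \<open>1 / (1 + x ^ m)\<close>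
  converge to \<open>0\<close>, \<open>1/2\<close> or \<open>1\<close> according to the sign of \<open>s\<close>.\<close>

lemma onE_fc_threshold: "onE (\<lambda>Y. fc (indicator {q<..}) (h Y))"
proof -
  let ?P = "\<lambda>r :: real \<Rightarrow> real. onE (\<lambda>Y. fc (\<lambda>t. complex_of_real (r t)) (h Y))"
  have const: "?P (\<lambda>_. c)" for c using onE_fc_const[of "of_real c"] .
  have add: "?P (\<lambda>t. f t + g t)" if "?P f" "?P g" for f g using onE_fc_add[OF that] by simp
  have mult: "?P (\<lambda>t. f t * g t)" if "?P f" "?P g" for f g using onE_fc_mult[OF that] by simp
  define s where "s t = t - q" for t
  have s: "?P s"
  proof -
    have "?P (\<lambda>t. t + - q)" by (rule add[OF onE_fc_id const])
    then show ?thesis by (simp add: s_def[abs_def])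
  qed
  define x where "x t = 1 + s t * (1 / (1 + s t * s t))" for t
  have den: "1 \<le> 1 + s t * s t" for t by simp
  have x: "?P x" unfolding x_def
    by (rule add[OF const mult[OF s onE_fc_inverse[OF add[OF const mult[OF s s]] den]]])
  have xpos: "0 \<le> x t" for t unfolding x_def by (rule sigmoid_base(1))
  have pow: "?P (\<lambda>t. x t ^ m)" for m
  proof (induction m)
    case 0 show ?case using const[of 1] by simp
  next
    case (Suc m) show ?case using mult[OF x Suc] by simp
  qed
  define F where "F m t = 1 / (1 + x t ^ m)" for m t
  have F: "?P (F m)" for m unfolding F_def
    by (rule onE_fc_inverse[OF add[OF const pow]]) (simp add: xpos)
  define \<gamma> :: "real \<Rightarrow> real" where "\<gamma> t = (if t > q then 0 else if t = q then 1/2 else 1)" for t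
  have lim: "(\<lambda>m. F m t) \<longlonglongrightarrow> \<gamma> t" for t
  proof -
    have "x t > 1 \<longleftrightarrow> t > q" "x t = 1 \<longleftrightarrow> t = q"
      unfolding x_def sigmoid_base by (simp_all add: s_def)
    then show ?thesis using sigmoid_limit[OF xpos, of t] unfolding F_def \<gamma>_def by (simp only:)
  qed
  have \<gamma>: "?P \<gamma>"
  proof (rule onE_fc_lim[where C = 1, OF F])
    fix m t
    have "0 \<le> x t ^ m" using xpos by simp
    then show "cmod (complex_of_real (F m t)) \<le> 1" unfolding norm_of_real F_def by (simp add: divide_simps)
  next
    fix t show "(\<lambda>m. complex_of_real (F m t)) \<longlonglongrightarrow> complex_of_real (\<gamma> t)" by (rule tendsto_of_real[OF lim])
  qed
  \<comment> \<open>The polynomial \<open>(1 - \<gamma>) * (1 - 2 * \<gamma>)\<close> is 1 at the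
    value 0 of \<open>\<gamma>\<close> and vanishes at 1/2 and 1, so it leaves exactly the points
    above \<open>q\<close>.\<close>
  have "?P (\<lambda>t. (1 + (-1) * \<gamma> t) * (1 + (-2) * \<gamma> t))"
    by (rule mult[OF add[OF const mult[OF const \<gamma>]] add[OF const mult[OF const \<gamma>]]])
  moreover have "(\<lambda>t. complex_of_real ((1 + (-1) * \<gamma> t) * (1 + (-2) * \<gamma> t))) = indicator {q<..}"
    by (auto simp: \<gamma>_def indicator_def)
  ultimately show ?thesis by simp
qed

text \<open>Open half-lines generate the Borel sets, so the monotone class argument extends the
  thresholds to all bounded Borel functions. No bound on \<open>h\<close> enters.\<close>

lemma onE_fc:
  assumes \<psi>: "\<psi> \<in> borel_measurable borel" and bd: "\<And>t. cmod (\<psi> t) \<le> C"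
  shows "onE (\<lambda>Y. fc \<psi> (h Y))"
proof (rule monotone_class_bounded[where P = "\<lambda>\<psi>. onE (\<lambda>Y. fc \<psi> (h Y))" and \<Omega> = UNIV
      and G = "range greaterThan" and C = C, OF onE_fc_const onE_fc_add onE_fc_mult])
  show "\<psi> \<in> borel_measurable (sigma UNIV (range greaterThan))"
    using \<psi> by (simp add: borel_Ioi)
  show "onE (\<lambda>Y. fc (indicator A) (h Y))" if "A \<in> range greaterThan" for A
    using that onE_fc_threshold by auto
  show "onE (\<lambda>Y. fc (\<lambda>x. c * f x) (h Y))" if "onE (\<lambda>Y. fc f (h Y))" for c f
    using onE_fc_mult[OF onE_fc_const that] .
  show "onE (\<lambda>Y. fc f (h Y))"
    if "\<And>n. onE (\<lambda>Y. fc (F n) (h Y))" "\<And>n x. x \<in> UNIV \<Longrightarrow> cmod (F n x) \<le> C" "\<And>x. x \<in> UNIV \<Longrightarrow> (\<lambda>n. F n x) \<longlonglongrightarrow> f x"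
    for F f C by (rule onE_fc_lim[where F = F and C = C and f = f, OF that(1)]) (rule that(2,3)[OF UNIV_I])+
qed (use bd in auto)

end

end

section \<open>A countable family of functions\<close>

text \<open>\<open>Thr q t\<close> and \<open>Nrm m t\<close> are evaluated to a spectral projection of the Hermitian part
  of \<open>t\<close> and, where \<open>t\<^sup>* t\<close> has spectrum in \<open>{0} \<union> {1 / (m + 1)<..}\<close>, to the partial isometry in the polar
  decomposition of \<open>t\<close>.\<close>

datatype tm = One | Var nat | Add tm tm | Mul tm tm | Adj tm | Iu tm | Thr rat tm | Nrm nat tm

instance tm :: countable
  by countable_datatype

text \<open>The cut-off keeps the inverse square root bounded, as \<open>onE_fc\<close> requires.
  Every fixed positive number is above the cut-off for large \<open>m\<close>.\<close>

definition inv_sqrt_above :: "nat \<Rightarrow> real \<Rightarrow> complex" where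
  "inv_sqrt_above m t = (if t > 1 / real (Suc m) then of_real (1 / sqrt t) else 0)"

lemma inv_sqrt_above_measurable: "inv_sqrt_above m \<in> borel_measurable borel"
  unfolding inv_sqrt_above_def by measurable

lemma inv_sqrt_above_bound: "cmod (inv_sqrt_above m t) \<le> sqrt (real (Suc m))"
proof (cases "t > 1 / real (Suc m)")
  case True
  then have "0 < t" by (smt (verit) divide_nonneg_nonneg of_nat_0_le_iff)
  then have "1 / t \<le> real (Suc m)" using True by (simp add: field_simps)
  then have "sqrt (1 / t) \<le> sqrt (real (Suc m))" by (rule real_sqrt_le_mono)
  then show ?thesis using True \<open>0 < t\<close> by (simp add: inv_sqrt_above_def real_sqrt_divide norm_divide)
next
  case False
  then show ?thesis by (simp add: inv_sqrt_above_def del: of_nat_Suc)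
qed

text \<open>Every term has a value without a well-formedness condition: \<open>mod\<close> keeps
  variable indices in range, and spectral functions are applied only to expressions that are
  Hermitian by construction. Since \<open>Iu (Iu t)\<close> has the value of \<open>t\<close>
  negated, subtraction is available without a constructor for scalars.\<close>

primrec ev :: "tm \<Rightarrow> complex mat list \<Rightarrow> complex mat" where
  "ev One Y = 1\<^sub>m (tdim Y)"
| "ev (Var k) Y = Y ! (k mod length Y)"
| "ev (Add s t) Y = ev s Y + ev t Y"
| "ev (Mul s t) Y = ev s Y * ev t Y"
| "ev (Adj t) Y = adj (ev t Y)"
| "ev (Iu t) Y = \<i> \<cdot>\<^sub>m ev t Y"
| "ev (Thr q t) Y = fc (indicator {real_of_rat q<..}) (ev t Y + adj (ev t Y))"
| "ev (Nrm m t) Y = ev t Y * fc (inv_sqrt_above m) (adj (ev t Y) * ev t Y)"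

lemma herm_add_adj: "A \<in> carrier_mat n n \<Longrightarrow> herm n (A + adj A)"
  by (auto simp: herm_def adj_add[of _ n n] comm_add_mat[of _ n n])

lemma herm_adj_mult: "A \<in> carrier_mat n n \<Longrightarrow> herm n (adj A * A)"
  by (auto simp: herm_def adj_mult[of _ n n])

lemma herm_mult_adj: "A \<in> carrier_mat n n \<Longrightarrow> herm n (A * adj A)"
  by (auto simp: herm_def adj_mult[of _ n n])

lemma herm_add: "herm n A \<Longrightarrow> herm n B \<Longrightarrow> herm n (A + B)"
  by (auto simp: herm_def adj_add[of _ n n])

context closed_subalgebra
begin

lemma onE_ev: "onE (ev t)"
proof (induction t)
  case One show ?case using onE_one by (rule onE_cong) simp
next
  case (Var k)
  show ?case using onE_nth[of "k mod l"] by (rule onE_cong) (use l in \<open>auto simp: MtupD(1)[OF irr_Mtup]\<close>)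
next
  case (Add s t) then show ?case using onE_add by (rule_tac onE_cong) auto
next
  case (Mul s t) then show ?case using onE_mult by (rule_tac onE_cong) auto
next
  case (Adj t) then show ?case using onE_adj by (rule_tac onE_cong) auto
next
  case (Iu t) then show ?case using onE_smult by (rule_tac onE_cong) auto
next
  case (Thr q t)
  have "onE (\<lambda>Y. fc (indicator {real_of_rat q<..}) (ev t Y + adj (ev t Y)))"
    by (rule onE_fc[OF onE_add[OF Thr onE_adj[OF Thr]], where C = 1])
      (auto intro!: herm_add_adj borel_measurable_indicator simp: onE_dim[OF Thr] indicator_def)
  then show ?case by (rule onE_cong) simp
next
  case (Nrm m t)
  have "onE (\<lambda>Y. fc (inv_sqrt_above m) (adj (ev t Y) * ev t Y))"
    by (rule onE_fc[OF onE_mult[OF onE_adj[OF Nrm] Nrm] _ inv_sqrt_above_measurable inv_sqrt_above_bound])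
      (auto intro!: herm_adj_mult simp: onE_dim[OF Nrm])
  from onE_mult[OF Nrm this] show ?case by (rule onE_cong) simp
qed

lemma ev_dim: "Y \<in> irr \<Longrightarrow> dim_row (ev t Y) = tdim Y" "Y \<in> irr \<Longrightarrow> dim_col (ev t Y) = tdim Y"
  using onE_dim[OF onE_ev] by auto

text \<open>The vectors orthogonal to all \<open>ev t Y *\<^sub>v x\<close> form a subspace
  invariant under all terms, because \<open>Adj s\<close> moves \<open>s\<close> across the inner
  product. If it contained a nonzero vector it would be everything and contain \<open>x\<close>,
  which is excluded by the term \<open>One\<close>.\<close>

lemma irr_cyclic:
  assumes Y: "Y \<in> irr" and x: "x \<in> carrier_vec (tdim Y)" "x \<noteq> 0\<^sub>v (tdim Y)" and z: "z \<in> carrier_vec (tdim Y)"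
    and orth: "\<And>t. ip (ev t Y *\<^sub>v x) z = 0"
  shows "z = 0\<^sub>v (tdim Y)"
proof (rule ccontr)
  assume nz: "z \<noteq> 0\<^sub>v (tdim Y)"
  let ?n = "tdim Y"
  note YD = MtupD[OF irr_Mtup[OF Y]]
  define K where "K = {z \<in> carrier_vec ?n. \<forall>t. ip (ev t Y *\<^sub>v x) z = 0}"
  have inv: "ev s Y *\<^sub>v v \<in> K" if v: "v \<in> K" for s v
  proof -
    have "ip (ev (Mul (Adj s) t) Y *\<^sub>v x) v = 0" for t using v unfolding K_def by blast
    then have "ip (ev t Y *\<^sub>v x) (ev s Y *\<^sub>v v) = 0" for t
      using ip_adj[of "adj (ev s Y)" ?n ?n "ev t Y *\<^sub>v x" v] ev_dim[OF Y] x v by (simp add: K_def mv_assoc)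
    then show ?thesis using v ev_dim[OF Y] by (auto simp: K_def)
  qed
  have "K = carrier_vec ?n"
  proof (rule irr_invariant_subspace[OF Y _ _ _ _ _ _ _ nz])
    fix k v assume "k < l" "v \<in> K"
    then show "Y ! k *\<^sub>v v \<in> K" "adj (Y ! k) *\<^sub>v v \<in> K"
      using inv[of v "Var k"] inv[of v "Adj (Var k)"] YD(1) by auto
  next
    fix v w assume "v \<in> K" "w \<in> K"
    then show "v + w \<in> K" using ip_add_right[of v ?n w] ev_dim[OF Y] by (auto simp: K_def)
  qed (use z orth in \<open>auto simp: K_def ip_smult_right\<close>)
  then have "ip (ev One Y *\<^sub>v x) x = 0" using x unfolding K_def by blast
  then show False using x by (simp add: ip_self_eq_0[of _ ?n])
qed

section \<open>Scalar functions\<close>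

definition scalE :: "(complex mat list \<Rightarrow> complex) \<Rightarrow> bool" where
  "scalE g \<longleftrightarrow> onE (\<lambda>Y. g Y \<cdot>\<^sub>m 1\<^sub>m (tdim Y))"

text \<open>Takes the place of a Borel structure on irreducible tuples. Passing to the generated
  sigma-algebra adds no sets, by \<open>onE_indicator\<close>.\<close>

definition irr_alg :: "complex mat list measure" where
  "irr_alg = sigma irr {A. A \<subseteq> irr \<and> scalE (indicator A)}"

lemma scalE_lim:
  assumes "\<And>n. scalE (F n)" "\<And>n x. x \<in> irr \<Longrightarrow> cmod (F n x) \<le> C" "\<And>x. x \<in> irr \<Longrightarrow> (\<lambda>n. F n x) \<longlonglongrightarrow> f x"
  shows "scalE f"
  unfolding scalE_def
proof (rule onE_lim[where C = C and K = "\<lambda>n Y. F n Y \<cdot>\<^sub>m 1\<^sub>m (tdim Y)", OF assms(1)[unfolded scalE_def]])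
  fix n Y assume "Y \<in> irr"
  then show "opnorm (F n Y \<cdot>\<^sub>m 1\<^sub>m (tdim Y)) \<le> C" by (intro order_trans[OF opnorm_scalar_le assms(2)])
next
  fix Y assume "Y \<in> irr"
  then show "mlim (tdim Y) (\<lambda>n. F n Y \<cdot>\<^sub>m 1\<^sub>m (tdim Y)) (f Y \<cdot>\<^sub>m 1\<^sub>m (tdim Y))"
    using tendsto_mult[OF assms(3) tendsto_const] by (auto simp: mlim_def)
qed

lemma space_irr_alg [simp]: "space irr_alg = irr"
  unfolding irr_alg_def by (rule space_measure_of) auto

lemma scalE_measurable:
  assumes g: "g \<in> borel_measurable irr_alg" and bd: "\<And>Y. Y \<in> irr \<Longrightarrow> cmod (g Y) \<le> C"
  shows "scalE g"
proof (rule monotone_class_bounded[where P = scalE and \<Omega> = irr and G = "{A. A \<subseteq> irr \<and> scalE (indicator A)}" and C = C])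
  show "g \<in> borel_measurable (sigma irr {A. A \<subseteq> irr \<and> scalE (indicator A)})" using g by (simp add: irr_alg_def)
  show "scalE (\<lambda>_. 1)" unfolding scalE_def mm_smult by (rule onE_one)
  show "scalE (\<lambda>x. f x + g x)" if "scalE f" "scalE g" for f g
    using onE_add[OF that[unfolded scalE_def]] unfolding scalE_def
    by (rule onE_cong) (auto intro!: eq_matI simp: algebra_simps)
  show "scalE (\<lambda>x. f x * g x)" if "scalE f" "scalE g" for f g
    using onE_mult[OF that[unfolded scalE_def]] unfolding scalE_def
    by (rule onE_cong) (simp add: mm_smult mult.commute)
  show "scalE (\<lambda>x. c * f x)" if "scalE f" for c f
    using onE_smult[OF that[unfolded scalE_def]] unfolding scalE_def
    by (rule onE_cong) (simp add: mm_smult)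
  show "scalE f" if "\<And>n. scalE (F n)" "\<And>n x. x \<in> irr \<Longrightarrow> cmod (F n x) \<le> C" "\<And>x. x \<in> irr \<Longrightarrow> (\<lambda>n. F n x) \<longlonglongrightarrow> f x"
    for F f C using that by (rule scalE_lim)
qed (use bd in auto)

lemma sets_irr_algI:
  assumes "A \<subseteq> irr" "onE (\<lambda>Y. if Y \<in> A then 1\<^sub>m (tdim Y) else 0\<^sub>m (tdim Y) (tdim Y))"
  shows "A \<in> sets irr_alg"
proof -
  have "scalE (indicator A)" unfolding scalE_def
    using assms(2) by (rule onE_cong) (auto simp: indicator_def intro!: eq_matI)
  then show ?thesis unfolding irr_alg_def using assms(1) by (auto simp: sets_measure_of)
qed

lemma onE_indicator:
  assumes A: "A \<in> sets irr_alg"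
  shows "onE (\<lambda>Y. if Y \<in> A then 1\<^sub>m (tdim Y) else 0\<^sub>m (tdim Y) (tdim Y))"
proof -
  have "scalE (indicator A)" by (rule scalE_measurable[where C = 1]) (use A in \<open>auto simp: indicator_def\<close>)
  then show ?thesis unfolding scalE_def by (rule onE_cong) (auto simp: indicator_def intro!: eq_matI)
qed

text \<open>On a scalar matrix \<open>fc\<close> evaluates the function at the scalar, so the
  indicator of \<open>{q<..}\<close> applied to \<open>h\<close> cuts out the superlevel set of
  \<open>c\<close> within \<open>A\<close>.\<close>

lemma real_scalar_measurable:
  assumes h: "onE h" "\<And>Y. Y \<in> irr \<Longrightarrow> adj (h Y) = h Y" and A: "A \<in> sets irr_alg"
    and c: "\<And>Y. Y \<in> A \<Longrightarrow> h Y = of_real (c Y) \<cdot>\<^sub>m 1\<^sub>m (tdim Y)"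
  shows "(\<lambda>Y. if Y \<in> A then c Y else 0) \<in> borel_measurable irr_alg"
proof (subst borel_measurable_iff_greater, intro allI)
  fix q :: real
  have "A \<subseteq> irr" using sets.sets_into_space[OF A] by simp
  have k: "onE (\<lambda>Y. fc (indicator {q<..}) (h Y) * (if Y \<in> A then 1\<^sub>m (tdim Y) else 0\<^sub>m (tdim Y) (tdim Y)))" (is "onE ?k")
    by (rule onE_mult[OF onE_fc[OF h(1), where C = 1] onE_indicator[OF A]])
      (auto intro!: borel_measurable_indicator simp: herm_def onE_dim[OF h(1)] h(2) indicator_def)
  have B: "{Y \<in> A. q < c Y} \<in> sets irr_alg"
  proof (rule sets_irr_algI[OF _ onE_cong[OF k]])
    fix Y assume Y: "Y \<in> irr"
    have d: "fc (indicator {q<..}) (h Y) \<in> carrier_mat (tdim Y) (tdim Y)"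
      by (rule fc_carrier) (use h Y in \<open>auto simp: herm_def onE_dim\<close>)
    show "?k Y = (if Y \<in> {Y \<in> A. q < c Y} then 1\<^sub>m (tdim Y) else 0\<^sub>m (tdim Y) (tdim Y))"
    proof (cases "Y \<in> A")
      case True
      then show ?thesis by (auto simp: c fc_scalar indicator_def simp del: fc_dim intro!: eq_matI)
    next
      case False
      then show ?thesis using d by (simp del: fc_dim)
    qed
  qed (use \<open>A \<subseteq> irr\<close> in auto)
  \<comment> \<open>Outside \<open>A\<close> the default value 0 lies above \<open>q\<close> exactly
    for negative \<open>q\<close>.\<close>
  have "{w \<in> space irr_alg. q < (if w \<in> A then c w else 0)} = {Y \<in> A. q < c Y} \<union> (if q < 0 then space irr_alg - A else {})"
    using \<open>A \<subseteq> irr\<close> by auto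
  also have "\<dots> \<in> sets irr_alg" using sets.compl_sets[OF A] B by auto
  finally show "{w \<in> space irr_alg. q < (if w \<in> A then c w else 0)} \<in> sets irr_alg" .
qed

lemma scalar_measurable:
  assumes k: "onE k" and A: "A \<in> sets irr_alg" and c: "\<And>Y. Y \<in> A \<Longrightarrow> k Y = c Y \<cdot>\<^sub>m 1\<^sub>m (tdim Y)"
  shows "(\<lambda>Y. if Y \<in> A then c Y else 0) \<in> borel_measurable irr_alg"
proof -
  note d = onE_dim[OF k]
  have "A \<subseteq> irr" using sets.sets_into_space[OF A] by simp
  have "(\<lambda>Y. if Y \<in> A then Re (c Y) else 0) \<in> borel_measurable irr_alg"
  proof (rule real_scalar_measurable[OF onE_smult[OF onE_add[OF k onE_adj[OF k]], of "1/2"] _ A])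
    show "adj ((1/2) \<cdot>\<^sub>m (k Y + adj (k Y))) = (1/2) \<cdot>\<^sub>m (k Y + adj (k Y))" if "Y \<in> irr" for Y
      using d[OF that] by (intro eq_matI) auto
    show "(1/2) \<cdot>\<^sub>m (k Y + adj (k Y)) = of_real (Re (c Y)) \<cdot>\<^sub>m 1\<^sub>m (tdim Y)" if "Y \<in> A" for Y
      unfolding c[OF that] by (intro eq_matI) (auto simp: complex_eq_iff)
  qed
  moreover have "(\<lambda>Y. if Y \<in> A then Im (c Y) else 0) \<in> borel_measurable irr_alg"
  proof (rule real_scalar_measurable[OF onE_smult[OF onE_minus[OF k onE_adj[OF k]], of "- \<i>/2"] _ A])
    show "adj ((- \<i>/2) \<cdot>\<^sub>m (k Y - adj (k Y))) = (- \<i>/2) \<cdot>\<^sub>m (k Y - adj (k Y))" if "Y \<in> irr" for Y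
      using d[OF that] by (intro eq_matI) (auto simp: field_simps)
    show "(- \<i>/2) \<cdot>\<^sub>m (k Y - adj (k Y)) = of_real (Im (c Y)) \<cdot>\<^sub>m 1\<^sub>m (tdim Y)" if "Y \<in> A" for Y
      unfolding c[OF that] by (intro eq_matI) (auto simp: complex_eq_iff)
  qed
  ultimately show ?thesis by (simp add: borel_measurable_complex_iff if_distrib cong: if_cong)
qed

section \<open>Zero sets\<close>

text \<open>\<open>zsum a N\<close> is positive, and on an irreducible tuple where \<open>a\<close> does not vanish it is
  invertible for large \<open>N\<close>, because the range of \<open>a\<close> is a cyclic set of vectors.\<close>

primrec zsum :: "(complex mat list \<Rightarrow> complex mat) \<Rightarrow> nat \<Rightarrow> complex mat list \<Rightarrow> complex mat" where
  "zsum a 0 Y = 0\<^sub>m (tdim Y) (tdim Y)"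
| "zsum a (Suc N) Y = zsum a N Y + (ev (from_nat N) Y * a Y) * adj (ev (from_nat N) Y * a Y)"

context
  fixes a assumes a: "onE a"
begin

lemma onE_zsum: "onE (zsum a N)"
proof (induction N)
  case 0
  show ?case using onE_zero by (rule onE_cong) simp
next
  case (Suc N)
  note m = onE_mult[OF onE_ev a]
  show ?case using onE_add[OF Suc onE_mult[OF m onE_adj[OF m]]] by (rule onE_cong) simp
qed

context
  fixes Y assumes Y: "Y \<in> irr"
begin

lemma zsum_dims [simp]: "dim_row (a Y) = tdim Y" "dim_col (a Y) = tdim Y" "dim_row (ev t Y) = tdim Y"
  "dim_col (ev t Y) = tdim Y" "dim_row (zsum a N Y) = tdim Y" "dim_col (zsum a N Y) = tdim Y"
  using onE_dim[OF a Y] ev_dim[OF Y] onE_dim[OF onE_zsum Y] by auto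

lemma herm_zsum: "herm (tdim Y) (zsum a N Y)"
proof (induction N)
  case 0 show ?case by (simp add: herm_def)
next
  case (Suc N) then show ?case by (simp add: herm_add herm_mult_adj)
qed

text \<open>The quadratic form of a sum of matrices \<open>b * adj b\<close> is the sum of the
  squared norms of \<open>adj b *\<^sub>v z\<close>, so it vanishes only on the common
  kernel.\<close>

lemma zsum_kernel:
  assumes z: "z \<in> carrier_vec (tdim Y)"
  shows "zsum a N Y *\<^sub>v z = 0\<^sub>v (tdim Y) \<longleftrightarrow> (\<forall>k<N. adj (ev (from_nat k) Y * a Y) *\<^sub>v z = 0\<^sub>v (tdim Y))"
proof -
  let ?n = "tdim Y" let ?b = "\<lambda>k. adj (ev (from_nat k) Y * a Y)"
  have sum: "ip (zsum a N Y *\<^sub>v z) z = of_real (\<Sum>k<N. (vnorm (?b k *\<^sub>v z))\<^sup>2)"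
  proof (induction N)
    case 0 then show ?case using z by simp
  next
    case (Suc N)
    have "ip (adj (?b N) *\<^sub>v (?b N *\<^sub>v z)) z = ip (?b N *\<^sub>v z) (?b N *\<^sub>v z)"
      using ip_adj[of "adj (?b N)" ?n ?n "?b N *\<^sub>v z" z] z unfolding adj_adj by simp
    then show ?case using z Suc
      by (simp add: mv_distrib mv_assoc ip_add_left[of _ ?n] ip_self)
  qed
  show ?thesis
  proof
    assume "zsum a N Y *\<^sub>v z = 0\<^sub>v ?n"
    then have "complex_of_real (\<Sum>k<N. (vnorm (?b k *\<^sub>v z))\<^sup>2) = 0" unfolding sum[symmetric] using z by simp
    then have "(\<Sum>k<N. (vnorm (?b k *\<^sub>v z))\<^sup>2) = 0" by (simp only: of_real_eq_0_iff)
    then show "\<forall>k<N. ?b k *\<^sub>v z = 0\<^sub>v ?n" by (simp add: sum_nonneg_eq_0_iff vnorm_eq_0[of _ ?n])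
  next
    assume "\<forall>k<N. ?b k *\<^sub>v z = 0\<^sub>v ?n"
    then show "zsum a N Y *\<^sub>v z = 0\<^sub>v ?n"
    proof (induction N)
      case (Suc N)
      have "adj (?b N) *\<^sub>v 0\<^sub>v ?n = 0\<^sub>v ?n" by (intro eq_vecI) auto
      then show ?case using Suc z by (simp add: mv_distrib mv_assoc[of _ "?b N"])
    qed (use z in simp)
  qed
qed

lemma zsum_projection:
  assumes z: "z \<in> carrier_vec (tdim Y)"
  shows "fc (indicator {0}) (zsum a N Y) *\<^sub>v z = z \<longleftrightarrow> zsum a N Y *\<^sub>v z = 0\<^sub>v (tdim Y)"
proof
  let ?n = "tdim Y" and ?G = "zsum a N Y" let ?p = "fc (indicator {0}) ?G"
  note p = fc_carrier[OF herm_zsum, of "indicator {0}" N]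
  assume "?p *\<^sub>v z = z"
  then have "?G *\<^sub>v z = (?G * ?p) *\<^sub>v z" using p z by (simp add: mv_assoc del: fc_dim)
  also have "?G * ?p = fc of_real ?G * ?p" by (simp only: fc_id[OF herm_zsum])
  also have "\<dots> = fc (\<lambda>t. 0) ?G" unfolding fc_mult[OF herm_zsum]
    by (rule arg_cong[of _ _ "\<lambda>f. fc f ?G"]) (auto simp: indicator_def)
  also have "\<dots> = 0\<^sub>m ?n ?n" unfolding fc_const[OF herm_zsum] by (intro eq_matI) auto
  finally show "?G *\<^sub>v z = 0\<^sub>v ?n" using z by simp
next
  assume "zsum a N Y *\<^sub>v z = 0\<^sub>v (tdim Y)"
  also have "\<dots> = of_real 0 \<cdot>\<^sub>v z" using z by (intro eq_vecI) auto
  finally show "fc (indicator {0}) (zsum a N Y) *\<^sub>v z = z"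
    using fc_eigvec[OF herm_zsum z, of N 0 "indicator {0}"] by simp
qed

text \<open>These kernel projections decrease with \<open>N\<close>, so their ranks stabilize. If
  \<open>a Y *\<^sub>v x\<close> is nonzero, a vector in all the kernels is orthogonal to every
  \<open>ev t Y *\<^sub>v (a Y *\<^sub>v x)\<close> and vanishes by
  \<open>irr_cyclic\<close>.\<close>

lemma zsum_projection_limit:
  "mlim (tdim Y) (\<lambda>N. fc (indicator {0}) (zsum a N Y))
    (if a Y = 0\<^sub>m (tdim Y) (tdim Y) then 1\<^sub>m (tdim Y) else 0\<^sub>m (tdim Y) (tdim Y))"
proof -
  let ?n = "tdim Y"
  define p where "p N = fc (indicator {0}) (zsum a N Y)" for N
  have ind: "indicator {0} = (\<lambda>t::real. if t = 0 then 1 else 0 :: complex)" by (auto simp: indicator_def)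
  have p: "isproj ?n (p N)" for N unfolding p_def ind by (rule fc_isproj[OF herm_zsum])
  note pD = isprojD[OF p]
  have pz: "p N *\<^sub>v z = z \<longleftrightarrow> (\<forall>k<N. adj (ev (from_nat k) Y * a Y) *\<^sub>v z = 0\<^sub>v ?n)" if "z \<in> carrier_vec ?n" for N z
    unfolding p_def zsum_projection[OF that] zsum_kernel[OF that] ..
  have mono: "p N * p M = p M" if "N \<le> M" for N M
  proof (rule mat_eq_vecI[of _ ?n ?n])
    fix v :: "complex vec" assume v: "v \<in> carrier_vec ?n"
    have w: "p M *\<^sub>v v \<in> carrier_vec ?n" using pD by simp
    have "p M *\<^sub>v (p M *\<^sub>v v) = p M *\<^sub>v v" using pD v by (simp flip: mv_assoc)
    then have "p N *\<^sub>v (p M *\<^sub>v v) = p M *\<^sub>v v" unfolding pz[OF w] using that by auto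
    then show "p N * p M *\<^sub>v v = p M *\<^sub>v v" using pD v by (simp add: mv_assoc)
  qed (use pD in auto)
  show ?thesis
  proof (cases "a Y = 0\<^sub>m ?n ?n")
    case True
    have "p N = 1\<^sub>m ?n" for N
    proof (rule mat_eq_vecI[of _ ?n ?n])
      fix v :: "complex vec" assume v: "v \<in> carrier_vec ?n"
      show "p N *\<^sub>v v = 1\<^sub>m ?n *\<^sub>v v" using pz[OF v, of N] v by (simp add: True)
    qed (use pD in auto)
    then show ?thesis using True mlim_const[of "1\<^sub>m ?n"] unfolding p_def by simp
  next
    case False
    then obtain x where x: "x \<in> carrier_vec ?n" "a Y *\<^sub>v x \<noteq> 0\<^sub>v ?n" using mat_eq_zeroI[of "a Y" ?n ?n] by auto
    have "\<forall>N. \<exists>r. trc (p N) = of_nat r" using trc_isproj_nat[OF p] by metis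
    then obtain r where r: "\<And>N. trc (p N) = of_nat (r N)" by metis
    \<comment> \<open>At an index of least rank the sequence is already constant: a later projection
      lies below \<open>p N\<close> and cannot have smaller rank.\<close>
    obtain N where N: "\<And>M. r N \<le> r M" using ex_has_least_nat[of "\<lambda>_. True" _ r] by auto
    have "p N = 0\<^sub>m ?n ?n"
    proof (rule ccontr)
      assume "p N \<noteq> 0\<^sub>m ?n ?n"
      then obtain v where v: "v \<in> carrier_vec ?n" "p N *\<^sub>v v \<noteq> 0\<^sub>v ?n" using mat_eq_zeroI[of "p N" ?n ?n] pD by auto
      define z where "z = p N *\<^sub>v v"
      have z: "z \<in> carrier_vec ?n" "z \<noteq> 0\<^sub>v ?n" "p N *\<^sub>v z = z"
        using v pD by (auto simp: z_def simp flip: mv_assoc)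
      obtain k where k: "adj (ev (from_nat k) Y * a Y) *\<^sub>v z \<noteq> 0\<^sub>v ?n"
      proof (rule ccontr)
        assume "\<not> thesis"
        then have 0: "adj (ev (from_nat k) Y * a Y) *\<^sub>v z = 0\<^sub>v ?n" for k using that by blast
        have "ip (ev t Y *\<^sub>v (a Y *\<^sub>v x)) z = 0" for t
          using 0[of "to_nat t"] ip_adj[of "ev t Y * a Y" ?n ?n x z] x(1) z(1) by (simp add: mv_assoc)
        then have "z = 0\<^sub>v ?n" using x z(1) by (intro irr_cyclic[OF Y _ x(2)]) auto
        then show False using z by simp
      qed
      define M where "M = max N (Suc k)"
      have NM: "p N * p M = p M" by (rule mono) (simp add: M_def)
      have "r N = r M" using isproj_trc_le[OF p p NM r r] N[of M] by simp
      then have "p N = p M" using isproj_le_eqI[OF p p NM] r by simp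
      then have "p M *\<^sub>v z = z" using z by simp
      then have "adj (ev (from_nat k) Y * a Y) *\<^sub>v z = 0\<^sub>v ?n" unfolding pz[OF z(1)] by (simp add: M_def)
      then show False using k by simp
    qed
    then have "p M = 0\<^sub>m ?n ?n" if "N \<le> M" for M using mono[OF that] pD by simp
    then have "(\<lambda>M. p M $$ (i,j)) \<longlonglongrightarrow> 0" if "i < ?n" "j < ?n" for i j
      using that by (intro tendsto_eventually eventually_sequentiallyI[of N]) auto
    then show ?thesis using False pD unfolding p_def by (auto simp: mlim_def simp del: fc_dim)
  qed
qed

end

text \<open>Makes every set defined by an equation between elements of \<open>E\<close> measurable,
  which is all that the definition of \<open>good\<close> uses.\<close>

lemma zero_set: "{Y \<in> irr. a Y = 0\<^sub>m (tdim Y) (tdim Y)} \<in> sets irr_alg"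
proof (rule sets_irr_algI)
  have "onE (\<lambda>Y. if a Y = 0\<^sub>m (tdim Y) (tdim Y) then 1\<^sub>m (tdim Y) else 0\<^sub>m (tdim Y) (tdim Y))"
  proof (rule onE_lim[where C = 1 and K = "\<lambda>N Y. fc (indicator {0}) (zsum a N Y)"])
    show "onE (\<lambda>Y. fc (indicator {0}) (zsum a N Y))" for N
      by (rule onE_fc[OF onE_zsum herm_zsum, where C = 1]) (auto simp: indicator_def intro!: borel_measurable_indicator)
    show "opnorm (fc (indicator {0}) (zsum a N Y)) \<le> 1" if "Y \<in> irr" for N Y
      by (rule opnorm_fc_le[OF herm_zsum[OF that]]) (simp add: indicator_def)
  qed (rule zsum_projection_limit)
  then show "onE (\<lambda>Y. if Y \<in> {Y \<in> irr. a Y = 0\<^sub>m (tdim Y) (tdim Y)} then 1\<^sub>m (tdim Y) else 0\<^sub>m (tdim Y) (tdim Y))"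
    by (rule onE_cong) simp
qed auto

end

end

section \<open>Orthonormal lists and the projections onto their spans\<close>

fun onl :: "nat \<Rightarrow> complex vec list \<Rightarrow> bool" where
  "onl n [] = True"
| "onl n (x # xs) \<longleftrightarrow> x \<in> carrier_vec n \<and> ip x x = 1 \<and> (\<forall>y\<in>set xs. ip x y = 0) \<and> onl n xs"

fun psum :: "nat \<Rightarrow> complex vec list \<Rightarrow> complex mat" where
  "psum n [] = 0\<^sub>m n n"
| "psum n (x # xs) = outer x x + psum n xs"

lemma onl_carrier: "onl n xs \<Longrightarrow> x \<in> set xs \<Longrightarrow> dim_vec x = n"
  by (induction xs) auto

lemma psum_dim: "dim_row (psum n xs) = n" "dim_col (psum n xs) = n"
  by (induction xs) auto

lemma psum_orthogonal:
  assumes "onl n xs" "dim_vec z = n" "\<And>x. x \<in> set xs \<Longrightarrow> ip z x = 0"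
  shows "psum n xs *\<^sub>v z = 0\<^sub>v n"
  using assms by (induction xs) (auto simp: psum_dim mv_distrib outer_mult_vec intro!: eq_vecI)

lemma psum_isproj: "onl n xs \<Longrightarrow> isproj n (psum n xs)"
proof (induction xs)
  case (Cons x xs)
  have x: "dim_vec x = n" "ip x x = 1" "onl n xs" "\<And>y. y \<in> set xs \<Longrightarrow> ip x y = 0" using Cons.prems by auto
  have "psum n xs *\<^sub>v x = 0\<^sub>v n" by (rule psum_orthogonal[OF x(3,1,4)])
  then have o: "psum n xs * outer x x = 0\<^sub>m n n"
    using x psum_dim[of n xs] by (simp add: mult_outer) (intro eq_matI, auto)
  have "isproj n (psum n xs + outer x x)"
    by (rule isproj_add[OF Cons.IH[OF x(3)] isproj_outer o]) (use x in auto)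
  then show ?case
    using comm_add_mat[of "outer x x" n n "psum n xs"] x psum_dim[of n xs] by simp
qed (auto simp: isproj_zero)

lemma trc_psum: "onl n xs \<Longrightarrow> trc (psum n xs) = of_nat (length xs)"
  by (induction xs) (auto simp: trc_add trc_outer psum_dim)

lemma psum_member: "onl n xs \<Longrightarrow> x \<in> set xs \<Longrightarrow> psum n xs *\<^sub>v x = x"
proof (induction xs)
  case (Cons y xs)
  have y: "dim_vec y = n" "ip y y = 1" "onl n xs" "\<And>x. x \<in> set xs \<Longrightarrow> ip y x = 0" using Cons.prems by auto
  note d = psum_dim[of n xs]
  show ?case
  proof (cases "x = y")
    case True
    have "psum n xs *\<^sub>v y = 0\<^sub>v n" by (rule psum_orthogonal[OF y(3,1,4)])
    then show ?thesis using True y d by (simp add: mv_distrib outer_mult_vec)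
  next
    case False
    then have x: "x \<in> set xs" using Cons.prems by simp
    have dx: "dim_vec x = n" by (rule onl_carrier[OF y(3) x])
    have "ip x y = 0" using ip_cnj[of y n x] y(4)[OF x] y(1) dx by simp
    then show ?thesis using Cons.IH[OF y(3) x] y(1) d dx
      by (simp add: mv_distrib outer_mult_vec) (intro eq_vecI, auto)
  qed
qed simp

lemma onl_nth: "onl n xs \<Longrightarrow> i < length xs \<Longrightarrow> j < length xs \<Longrightarrow> ip (xs ! i) (xs ! j) = (if i = j then 1 else 0)"
proof (induction xs arbitrary: i j)
  case (Cons x xs)
  have x: "dim_vec x = n" "ip x x = 1" "onl n xs" "\<And>y. y \<in> set xs \<Longrightarrow> ip x y = 0" using Cons.prems by auto
  have x': "ip y x = 0" if "y \<in> set xs" for y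
    using ip_cnj[of x n y] x(4)[OF that] x(1) onl_carrier[OF x(3) that] by simp
  show ?case using Cons.IH[OF x(3)] Cons.prems(2,3) x(2,4) x'
    by (cases i; cases j) auto
qed simp

section \<open>Minimal projections among the values of terms have rank one\<close>

context closed_subalgebra
begin

context
  fixes Y and n :: nat assumes Y: "Y \<in> irr" and n: "tdim Y = n"
begin

lemma dim_ev [simp]: "dim_row (ev t Y) = n" "dim_col (ev t Y) = n"
  using ev_dim[OF Y] by (auto simp: n)

text \<open>The competitors are values of terms. This suffices because spectral projections at
  rational thresholds are themselves values of \<open>Thr\<close>.\<close>

definition min_proj :: "tm \<Rightarrow> bool" where
  "min_proj e \<longleftrightarrow> isproj n (ev e Y) \<and> ev e Y \<noteq> 0\<^sub>m n n \<and>
     (\<forall>p. isproj n (ev p Y) \<longrightarrow> ev p Y \<noteq> 0\<^sub>m n n \<longrightarrow> ev e Y * ev p Y = ev p Y \<longrightarrow> ev p Y = ev e Y)"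

lemma ex_min_proj: "\<exists>e. min_proj e"
proof -
  define R where "R r \<longleftrightarrow> (\<exists>e. isproj n (ev e Y) \<and> ev e Y \<noteq> 0\<^sub>m n n \<and> trc (ev e Y) = of_nat r)" for r
  have "1\<^sub>m n \<noteq> (0\<^sub>m n n :: complex mat)"
  proof
    assume "1\<^sub>m n = (0\<^sub>m n n :: complex mat)"
    then have "1\<^sub>m n $$ (0,0) = (0\<^sub>m n n $$ (0,0) :: complex)" by simp
    then show False using MtupD(2)[OF irr_Mtup[OF Y]] by (simp add: n)
  qed
  then have "R n" unfolding R_def by (intro exI[of _ One]) (auto simp: isproj_one n)
  then have "R (LEAST r. R r)" by (rule LeastI)
  then obtain e where e: "isproj n (ev e Y)" "ev e Y \<noteq> 0\<^sub>m n n" "trc (ev e Y) = of_nat (LEAST r. R r)"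
    unfolding R_def by blast
  have "ev p Y = ev e Y" if p: "isproj n (ev p Y)" "ev p Y \<noteq> 0\<^sub>m n n" "ev e Y * ev p Y = ev p Y" for p
  proof -
    obtain r where r: "trc (ev p Y) = of_nat r" using trc_isproj_nat[OF p(1)] by blast
    then have "R r" unfolding R_def using p by blast
    then have "(LEAST r. R r) \<le> r" by (rule Least_le)
    moreover have "r \<le> (LEAST r. R r)" by (rule isproj_trc_le[OF e(1) p(1,3) e(3) r])
    ultimately show ?thesis using isproj_le_eqI[OF e(1) p(1,3)] e(3) r by simp
  qed
  then show ?thesis using e unfolding min_proj_def by blast
qed

text \<open>For rational \<open>q \<ge> 0\<close> the spectral projection of \<open>A t\<close>
  above \<open>q\<close> lies below that of \<open>e\<close>, so by minimality it is 0 or all of it.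
  Hence there is only one positive eigenvalue \<open>\<mu>\<close>, and \<open>A t\<close> is
  \<open>\<mu>\<close> times the value of \<open>e\<close>.\<close>

lemma min_proj_positive:
  assumes e: "min_proj e"
  defines "A \<equiv> \<lambda>t. ev e Y * (ev t Y + adj (ev t Y)) * ev e Y"
  assumes v: "v \<in> carrier_vec n" "v \<noteq> 0\<^sub>v n" "A t *\<^sub>v v = of_real \<mu> \<cdot>\<^sub>v v" "0 < \<mu>"
  shows "\<exists>c. A t = c \<cdot>\<^sub>m ev e Y"
proof -
  have pe: "isproj n (ev e Y)" using e by (simp add: min_proj_def)
  note ee = isprojD[OF pe]
  have h: "herm n (A t)"
    unfolding A_def herm_def using ee(3)
    by (simp add: adj_mult[of _ n n] adj_add[of _ n n] mm_assoc comm_add_mat[of _ n n])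
  have eA: "ev e Y * A t = A t" "A t * ev e Y = A t"
  proof -
    show "ev e Y * A t = A t" unfolding A_def using ee(4) by (simp flip: mm_assoc)
    show "A t * ev e Y = A t" unfolding A_def using ee(4) by (simp add: mm_assoc)
  qed
  define p where "p q = fc (indicator {real_of_rat q<..}) (A t)" for q
  \<comment> \<open>\<open>Thr\<close> adds the adjoint of its argument, and compression by the
    self-adjoint value of \<open>e\<close> commutes with adding the adjoint.\<close>
  have pev: "p q = ev (Thr q (Mul e (Mul t e))) Y" for q
  proof -
    have "A t = ev e Y * (ev t Y * ev e Y) + adj (ev e Y * (ev t Y * ev e Y))"
      unfolding A_def using ee(3) by (simp add: adj_mult[of _ n n] mm_distrib mm_assoc)
    then show ?thesis by (simp add: p_def)
  qed
  have pe: "p q = ev e Y" if q: "0 \<le> q" and w: "w \<in> carrier_vec n" "w \<noteq> 0\<^sub>v n" "A t *\<^sub>v w = of_real \<nu> \<cdot>\<^sub>v w" "real_of_rat q < \<nu>" for q w \<nu>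
  proof -
    have proj: "isproj n (p q)" unfolding p_def by (rule fc_indicator_isproj[OF h])
    have "p q \<noteq> 0\<^sub>m n n"
    proof
      assume "p q = 0\<^sub>m n n"
      also have "0\<^sub>m n n = fc (\<lambda>_. 0) (A t)" unfolding fc_const[OF h] by (intro eq_matI) auto
      finally have "(indicator {real_of_rat q<..} \<nu> :: complex) = 0"
        unfolding p_def by (rule fc_eq_eigenvalue[OF h _ w(1-3)])
      then show False using w(4) by simp
    qed
    moreover have "ev e Y * p q = p q"
    proof -
      \<comment> \<open>Since 0 is not above the threshold, the indicator is divisible by its
        argument. So \<open>p q\<close> has \<open>A t\<close> as a left factor and its range lies
        in that of \<open>e\<close>.\<close>
      have "0 \<le> real_of_rat q" using q by simp
      then have "(indicator {real_of_rat q<..} t :: complex) = of_real t * (indicator {real_of_rat q<..} t / of_real t)" for t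
        by (cases "real_of_rat q < t") auto
      then have "p q = fc of_real (A t) * fc (\<lambda>t. indicator {real_of_rat q<..} t / of_real t) (A t)"
        unfolding fc_mult[OF h] p_def by presburger
      then have pq: "p q = A t * fc (\<lambda>t. indicator {real_of_rat q<..} t / of_real t) (A t)" unfolding fc_id[OF h] .
      have "ev e Y * p q = (ev e Y * A t) * fc (\<lambda>t. indicator {real_of_rat q<..} t / of_real t) (A t)"
        unfolding pq using fc_carrier[OF h] h by (subst mm_assoc) (auto simp: herm_def simp del: fc_dim)
      then show ?thesis unfolding eA pq[symmetric] .
    qed
    ultimately show ?thesis using proj e unfolding min_proj_def pev by blast
  qed
  have uniq: "\<not> \<nu> < \<nu>'" if w: "w \<in> carrier_vec n" "w \<noteq> 0\<^sub>v n" "A t *\<^sub>v w = of_real \<nu> \<cdot>\<^sub>v w" "0 < \<nu>"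
    and w': "w' \<in> carrier_vec n" "w' \<noteq> 0\<^sub>v n" "A t *\<^sub>v w' = of_real \<nu>' \<cdot>\<^sub>v w'" for w \<nu> w' \<nu>'
  proof
    \<comment> \<open>For a rational \<open>q\<close> between the eigenvalues, \<open>p q\<close>
      and \<open>p 0\<close> both equal the value of \<open>e\<close>, although only
      \<open>p 0\<close> fixes the eigenvector for \<open>\<nu>\<close>.\<close>
    assume "\<nu> < \<nu>'"
    then obtain q where q: "\<nu> < real_of_rat q" "real_of_rat q < \<nu>'" using of_rat_dense by blast
    have "0 \<le> q" using q(1) w(4) by (metis less_eq_real_def less_trans zero_le_of_rat_iff)
    then have "p q = p 0" using pe[OF _ w' q(2)] pe[OF _ w(1-3), of 0] w(4) by simp
    then have "(indicator {real_of_rat q<..} \<nu> :: complex) = indicator {real_of_rat 0<..} \<nu>"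
      unfolding p_def by (rule fc_eq_eigenvalue[OF h _ w(1-3)])
    then show False using q w(4) by simp
  qed
  have "A t = A t * p 0" using pe[OF _ v(1-3), of 0] v(4) eA by simp
  also have "\<dots> = fc of_real (A t) * p 0" unfolding fc_id[OF h] ..
  also have "\<dots> = fc (\<lambda>t. of_real \<mu> * indicator {real_of_rat 0<..} t) (A t)"
    unfolding p_def fc_mult[OF h]
  proof (rule fc_cong_eigenvalues[OF h])
    fix \<nu> w assume w: "w \<in> carrier_vec n" "w \<noteq> 0\<^sub>v n" "A t *\<^sub>v w = of_real \<nu> \<cdot>\<^sub>v w"
    show "of_real \<nu> * indicator {real_of_rat 0<..} \<nu> = of_real \<mu> * (indicator {real_of_rat 0<..} \<nu> :: complex)"
    proof (cases "0 < \<nu>")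
      case True
      then have "\<nu> = \<mu>" using uniq[OF w True v(1-3)] uniq[OF v w] by linarith
      then show ?thesis by simp
    qed simp
  qed
  also have "\<dots> = of_real \<mu> \<cdot>\<^sub>m p 0" unfolding p_def fc_smult[OF h] ..
  also have "p 0 = ev e Y" using pe[OF _ v(1-3), of 0] v(4) by simp
  finally show ?thesis by blast
qed

text \<open>A positive eigenvalue is handled by \<open>min_proj_positive\<close>, a negative one by
  the same lemma for \<open>Iu (Iu t)\<close>. Without either, all eigenvalues are 0 and so is the
  compression.\<close>

lemma min_proj_hermitian_part:
  assumes e: "min_proj e"
  shows "\<exists>c. ev e Y * (ev t Y + adj (ev t Y)) * ev e Y = c \<cdot>\<^sub>m ev e Y"
proof (rule ccontr)
  assume no: "\<not> ?thesis"
  define A where "A t = ev e Y * (ev t Y + adj (ev t Y)) * ev e Y" for t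
  have pe: "isproj n (ev e Y)" using e by (simp add: min_proj_def)
  note ee = isprojD[OF pe]
  have h: "herm n (A t)"
    unfolding A_def herm_def using ee(3)
    by (simp add: adj_mult[of _ n n] adj_add[of _ n n] mm_assoc comm_add_mat[of _ n n])
  have neg: "A (Iu (Iu t)) = (-1) \<cdot>\<^sub>m A t"
  proof -
    have "ev (Iu (Iu t)) Y + adj (ev (Iu (Iu t)) Y) = (-1) \<cdot>\<^sub>m (ev t Y + adj (ev t Y))"
      by (intro eq_matI) auto
    then show ?thesis unfolding A_def by (simp only: mm_smult dim_ev index_smult_mat index_add_mat adj_dim) (simp add: mm_smult)
  qed
  have "A t = fc of_real (A t)" unfolding fc_id[OF h] ..
  also have "\<dots> = fc (\<lambda>_. 0) (A t)"
  proof (rule fc_cong_eigenvalues[OF h])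
    fix \<mu> v assume v: "v \<in> carrier_vec n" "v \<noteq> 0\<^sub>v n" "A t *\<^sub>v v = of_real \<mu> \<cdot>\<^sub>v v"
    have "\<not> 0 < \<mu>" using min_proj_positive[OF e v(1,2), of t \<mu>] v(3) no unfolding A_def by blast
    moreover have "\<not> 0 < - \<mu>"
    proof
      assume m: "0 < - \<mu>"
      have "A (Iu (Iu t)) *\<^sub>v v = of_real (- \<mu>) \<cdot>\<^sub>v v"
        unfolding neg using v h by (simp add: mv_distrib herm_def smult_smult_assoc)
      then obtain c where "A (Iu (Iu t)) = c \<cdot>\<^sub>m ev e Y"
        using min_proj_positive[OF e v(1,2), of "Iu (Iu t)" "- \<mu>"] m unfolding A_def by blast
      then have "(-1) \<cdot>\<^sub>m ((-1) \<cdot>\<^sub>m A t) = (-1) \<cdot>\<^sub>m (c \<cdot>\<^sub>m ev e Y)" unfolding neg by simp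
      then have "A t = (- c) \<cdot>\<^sub>m ev e Y" unfolding mm_smult by (simp add: mm_smult)
      then show False using no unfolding A_def by blast
    qed
    ultimately show "complex_of_real \<mu> = 0" by simp
  qed
  also have "\<dots> = 0 \<cdot>\<^sub>m ev e Y" unfolding fc_const[OF h] using ee by (intro eq_matI) auto
  finally show False using no unfolding A_def by blast
qed

lemma min_proj_scalar:
  assumes e: "min_proj e"
  obtains c where "ev e Y * ev t Y * ev e Y = c \<cdot>\<^sub>m ev e Y"
proof -
  obtain a b where a: "ev e Y * (ev t Y + adj (ev t Y)) * ev e Y = a \<cdot>\<^sub>m ev e Y"
    and b: "ev e Y * (ev (Iu t) Y + adj (ev (Iu t) Y)) * ev e Y = b \<cdot>\<^sub>m ev e Y"
    using min_proj_hermitian_part[OF e] by blast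
  \<comment> \<open>Cartesian decomposition, with \<open>\<i>\<close> times the skew part obtained
    as the Hermitian part of \<open>Iu t\<close>.\<close>
  have eq: "ev t Y = (1/2) \<cdot>\<^sub>m (ev t Y + adj (ev t Y)) + (- \<i>/2) \<cdot>\<^sub>m (ev (Iu t) Y + adj (ev (Iu t) Y))" (is "_ = _ \<cdot>\<^sub>m ?P + _ \<cdot>\<^sub>m ?Q")
    by (intro eq_matI) (auto simp: field_simps)
  have "ev e Y * ev t Y * ev e Y = ev e Y * ((1/2) \<cdot>\<^sub>m ?P + (- \<i>/2) \<cdot>\<^sub>m ?Q) * ev e Y"
    by (rule arg_cong[OF eq, of "\<lambda>M. ev e Y * M * ev e Y"])
  also have "\<dots> = (1/2) \<cdot>\<^sub>m (ev e Y * ?P * ev e Y) + (- \<i>/2) \<cdot>\<^sub>m (ev e Y * ?Q * ev e Y)"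
    by (simp only: mm_distrib(1,2) mm_smult dim_ev index_smult_mat index_add_mat adj_dim index_mult_mat)
  also have "\<dots> = (1/2 * a - \<i>/2 * b) \<cdot>\<^sub>m ev e Y"
    unfolding a b by (intro eq_matI) (auto simp: algebra_simps)
  finally show ?thesis using that by blast
qed

text \<open>Let \<open>w\<close> be in the range of \<open>e\<close> and orthogonal to the unit
  vector \<open>u\<close> of that range. Compressions by \<open>e\<close> are scalar there, so
  \<open>w\<close> is orthogonal to every \<open>ev t Y *\<^sub>v u\<close>, hence zero by
  cyclicity.\<close>

lemma ex_rank_one:
  obtains e u where "u \<in> carrier_vec n" "ip u u = 1" "ev e Y = outer u u"
proof -
  obtain e where e: "min_proj e" using ex_min_proj by blast
  have pe: "isproj n (ev e Y)" "ev e Y \<noteq> 0\<^sub>m n n" using e by (auto simp: min_proj_def)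
  note ee = isprojD[OF pe(1)]
  obtain x where x: "x \<in> carrier_vec n" "ev e Y *\<^sub>v x \<noteq> 0\<^sub>v n" using pe mat_eq_zeroI[of "ev e Y" n n] by auto
  then obtain c where c: "c \<noteq> 0" "ip (c \<cdot>\<^sub>v (ev e Y *\<^sub>v x)) (c \<cdot>\<^sub>v (ev e Y *\<^sub>v x)) = 1"
    using exists_unit_multiple[of "ev e Y *\<^sub>v x" n] by auto
  define u where "u = c \<cdot>\<^sub>v (ev e Y *\<^sub>v x)"
  have u: "dim_vec u = n" "ip u u = 1" "ev e Y *\<^sub>v u = u"
    using x c ee by (auto simp: u_def mv_distrib simp flip: mv_assoc)
  have u0: "u \<noteq> 0\<^sub>v n" using u(2) by auto
  have "ev e Y = outer u u"
  proof (rule mat_eq_vecI[of _ n n])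
    fix v :: "complex vec" assume "v \<in> carrier_vec n"
    then have v: "dim_vec v = n" by simp
    let ?ev = "ev e Y *\<^sub>v v"
    define w where "w = ?ev - ip ?ev u \<cdot>\<^sub>v u"
    have w: "dim_vec w = n" using u by (simp add: w_def)
    have ew: "ev e Y *\<^sub>v w = w"
    proof -
      have "ev e Y *\<^sub>v ?ev = ?ev" using ee v by (simp flip: mv_assoc)
      then show ?thesis unfolding w_def using u v by (simp add: mv_distrib)
    qed
    have "ip w u = 0" unfolding w_def using u v by (simp add: ip_minus_left[of _ n] ip_smult_left[of _ n])
    then have uw: "ip u w = 0" using ip_cnj[of w n u] u w by simp
    have "ip (ev t Y *\<^sub>v u) w = 0" for t
    proof -
      obtain d where d: "ev e Y * ev t Y * ev e Y = d \<cdot>\<^sub>m ev e Y" using min_proj_scalar[OF e] .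
      have "ip (ev t Y *\<^sub>v u) w = ip (ev t Y *\<^sub>v (ev e Y *\<^sub>v u)) (ev e Y *\<^sub>v w)" unfolding u(3) ew ..
      also have "\<dots> = ip ((ev e Y * ev t Y * ev e Y) *\<^sub>v u) w"
        using ip_adj[of "ev e Y" n n "ev t Y *\<^sub>v (ev e Y *\<^sub>v u)" w] ee(3) u(1) w by (simp add: mv_assoc)
      also have "\<dots> = d * ip u w" unfolding d using u w by (simp add: mv_distrib ip_smult_left[of _ n])
      finally show ?thesis using uw by simp
    qed
    then have "w = 0\<^sub>v n" using u w u0 by (intro irr_cyclic[OF Y, unfolded n, OF _ u0]) auto
    then have w0: "w $ i = 0" if "i < n" for i using that by simp
    have "?ev = ip ?ev u \<cdot>\<^sub>v u"
    proof (rule eq_vecI)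
      fix i assume "i < dim_vec (ip ?ev u \<cdot>\<^sub>v u)"
      then have i: "i < n" using u by simp
      show "?ev $ i = (ip ?ev u \<cdot>\<^sub>v u) $ i" using w0[OF i] i u by (simp add: w_def)
    qed (use u in simp)
    also have "ip ?ev u = ip v u" using ip_adj[of "ev e Y" n n v u] ee(3) u v by simp
    finally show "ev e Y *\<^sub>v v = outer u u *\<^sub>v v" using u v by (simp add: outer_mult_vec)
  qed (use u in auto)
  then show ?thesis using that u by auto
qed

end

end

section \<open>Frames\<close>

text \<open>With \<open>w = One\<close> this is the frame operator of \<open>vs\<close>; with
  \<open>w\<close> of the form \<open>v\<^sub>i\<^sup>* g v\<^sub>j\<close> it moves a coefficient
  into the center. The empty case is \<open>1 + \<i>\<^sup>2\<close>, the term for zero.\<close>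

fun csm :: "tm \<Rightarrow> tm list \<Rightarrow> tm" where
  "csm w [] = Add One (Iu (Iu One))"
| "csm w (v # vs) = Add (Mul v (Mul w (Adj v))) (csm w vs)"

context closed_subalgebra
begin

lemma ev_csm_Nil: "ev (csm w []) Y = 0\<^sub>m (tdim Y) (tdim Y)"
  by (intro eq_matI) auto

text \<open>Expansion of a vector along the frame when every \<open>adj v\<close> maps it to a
  multiple of one vector \<open>u\<close>. It is stated for coordinates so that the sum is one of
  complex numbers.\<close>

lemma csm_mult_vec_index:
  assumes Y: "Y \<in> irr" and z: "dim_vec z = tdim Y" and r: "r < tdim Y"
    and c: "\<And>m. m < length vs \<Longrightarrow> adj (ev (vs ! m) Y) *\<^sub>v z = c m \<cdot>\<^sub>v u" and u: "dim_vec u = tdim Y"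
  shows "(ev (csm w vs) Y *\<^sub>v z) $ r = (\<Sum>m<length vs. c m * (ev (vs ! m) Y *\<^sub>v (ev w Y *\<^sub>v u)) $ r)"
  using c
proof (induction vs arbitrary: c)
  case Nil
  then show ?case unfolding ev_csm_Nil using z r by simp
next
  case (Cons v vs)
  note d = ev_dim[OF Y]
  have 0: "adj (ev v Y) *\<^sub>v z = c 0 \<cdot>\<^sub>v u" using Cons.prems[of 0] by simp
  have "(ev (csm w (v # vs)) Y *\<^sub>v z) $ r = (ev v Y *\<^sub>v (ev w Y *\<^sub>v (adj (ev v Y) *\<^sub>v z)) + ev (csm w vs) Y *\<^sub>v z) $ r"
    using d z by (simp add: mv_distrib mv_assoc del: index_mult_mat_vec)
  also have "\<dots> = c 0 * (ev v Y *\<^sub>v (ev w Y *\<^sub>v u)) $ r + (ev (csm w vs) Y *\<^sub>v z) $ r"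
    unfolding 0 using d z r u by (simp add: mv_distrib del: index_mult_mat_vec)
  also have "(ev (csm w vs) Y *\<^sub>v z) $ r = (\<Sum>m<length vs. c (Suc m) * (ev (vs ! m) Y *\<^sub>v (ev w Y *\<^sub>v u)) $ r)"
    by (rule Cons.IH) (use Cons.prems[of "Suc _"] in simp)
  finally show ?case by (simp add: sum.lessThan_Suc_shift del: sum.lessThan_Suc index_mult_mat_vec)
qed

text \<open>For \<open>Y\<close> in \<open>good e vs\<close> the values \<open>v\<^sub>i\<close> of the terms \<open>vs\<close> satisfy \<open>v\<^sub>i\<^sup>* v\<^sub>j = \<delta>\<^sub>i\<^sub>j e\<close> and \<open>\<Sum> v\<^sub>i v\<^sub>i\<^sup>* = 1\<close>,
  and \<open>phi vs g i j\<close>, the sum of the \<open>v\<^sub>m (v\<^sub>i\<^sup>* g v\<^sub>j) v\<^sub>m\<^sup>*\<close>, commutes with \<open>Y\<close> and \<open>Y\<^sup>*\<close>, so that it is the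
  scalar matrix of the \<open>(i,j)\<close> coefficient of \<open>g\<close>.\<close>

definition phi :: "tm list \<Rightarrow> tm \<Rightarrow> nat \<Rightarrow> nat \<Rightarrow> tm" where
  "phi vs g i j = csm (Mul (Adj (vs ! i)) (Mul g (vs ! j))) vs"

definition gens :: "tm set" where
  "gens = Var ` {..<l} \<union> (Adj \<circ> Var) ` {..<l}"

definition good :: "tm \<Rightarrow> tm list \<Rightarrow> complex mat list set" where
  "good e vs = {Y \<in> irr. ev (Mul e e) Y = ev e Y \<and> ev (csm One vs) Y = ev One Y \<and>
     (\<forall>i<length vs. ev (Mul (vs ! i) e) Y = ev (vs ! i) Y \<and>
        (\<forall>j<length vs. ev (Mul (Adj (vs ! i)) (vs ! j)) Y = ev (if i = j then e else csm One []) Y \<and>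
           (\<forall>g\<in>gens. \<forall>h\<in>gens. ev (Mul (phi vs g i j) h) Y = ev (Mul h (phi vs g i j)) Y)))}"

lemma eq_set: "{Y \<in> space irr_alg. ev s Y = ev t Y} \<in> sets irr_alg"
proof -
  have "{Y \<in> space irr_alg. ev s Y = ev t Y} = {Y \<in> irr. ev s Y - ev t Y = 0\<^sub>m (tdim Y) (tdim Y)}"
  proof (rule Collect_cong, unfold space_irr_alg, intro conj_cong refl iffI)
    fix Y assume Y: "Y \<in> irr"
    note d = ev_dim[OF Y]
    show "ev s Y - ev t Y = 0\<^sub>m (tdim Y) (tdim Y)" if "ev s Y = ev t Y"
      using that d by (intro eq_matI) auto
    show "ev s Y = ev t Y" if "ev s Y - ev t Y = 0\<^sub>m (tdim Y) (tdim Y)"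
    proof (rule eq_matI)
      fix i j assume "i < dim_row (ev t Y)" "j < dim_col (ev t Y)"
      then have ij: "i < tdim Y" "j < tdim Y" using d by auto
      then have "(ev s Y - ev t Y) $$ (i,j) = 0" unfolding that by simp
      then show "ev s Y $$ (i,j) = ev t Y $$ (i,j)" using ij d by simp
    qed (use d in auto)
  qed
  then show ?thesis using zero_set[OF onE_minus[OF onE_ev onE_ev]] by simp
qed

lemma finite_gens: "finite gens"
  by (simp add: gens_def)

text \<open>Membership is a finite conjunction of equations between terms, and each such equation
  defines a measurable set by \<open>eq_set\<close>.\<close>

lemma good_sets: "good e vs \<in> sets irr_alg"
proof -
  have "good e vs = {Y \<in> space irr_alg. ev (Mul e e) Y = ev e Y \<and> ev (csm One vs) Y = ev One Y \<and>
     (\<forall>i\<in>{..<length vs}. ev (Mul (vs ! i) e) Y = ev (vs ! i) Y \<and>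
        (\<forall>j\<in>{..<length vs}. ev (Mul (Adj (vs ! i)) (vs ! j)) Y = ev (if i = j then e else csm One []) Y \<and>
           (\<forall>g\<in>gens. \<forall>h\<in>gens. ev (Mul (phi vs g i j) h) Y = ev (Mul h (phi vs g i j)) Y)))}"
    unfolding good_def by (simp add: Ball_def)
  also have "\<dots> \<in> sets irr_alg"
    by (intro sets.sets_Collect_conj sets.sets_Collect_finite_All eq_set) (auto simp: finite_gens eq_set)
  finally show ?thesis .
qed

text \<open>Every irreducible tuple lies in some \<open>good e vs\<close>: the list \<open>vs\<close> is obtained from
  a rank one projection by the Gram-Schmidt process.\<close>

context
  fixes Y assumes Y: "Y \<in> irr"
begin

text \<open>Gram-Schmidt step: with \<open>q\<close> the projection onto the complement of the span,
  cyclicity of \<open>u\<close> provides a term \<open>t\<close> for which \<open>q t u\<close> is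
  nonzero. The polar part of \<open>q t e\<close> is then \<open>outer x u\<close> with a new unit
  vector \<open>x\<close>.\<close>

lemma frame_extend:
  assumes u: "u \<in> carrier_vec (tdim Y)" "ip u u = 1" "ev e Y = outer u u"
    and vs: "onl (tdim Y) xs" "map (\<lambda>v. ev v Y) vs = map (\<lambda>x. outer x u) xs"
    and csm: "ev (csm One vs) Y = psum (tdim Y) xs" and ne: "psum (tdim Y) xs \<noteq> 1\<^sub>m (tdim Y)"
  obtains v x where "onl (tdim Y) (x # xs)" "ev v Y = outer x u"
proof -
  let ?n = "tdim Y"
  note d = ev_dim[OF Y]
  define s where "s = psum ?n xs"
  have s: "isproj ?n s" unfolding s_def by (rule psum_isproj[OF vs(1)])
  define q where "q = 1\<^sub>m ?n - s"
  have q: "isproj ?n q" unfolding q_def by (rule isproj_compl[OF s])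
  note sD = isprojD[OF s] and qD = isprojD[OF q]
  have "q \<noteq> 0\<^sub>m ?n ?n"
  proof
    assume q0: "q = 0\<^sub>m ?n ?n"
    have "s = 1\<^sub>m ?n"
    proof (rule eq_matI)
      fix i j assume "i < dim_row (1\<^sub>m ?n)" "j < dim_col (1\<^sub>m ?n)"
      then have ij: "i < ?n" "j < ?n" by auto
      then have "q $$ (i,j) = 0" unfolding q0 by simp
      then show "s $$ (i,j) = 1\<^sub>m ?n $$ (i,j)" using ij sD unfolding q_def by simp
    qed (use sD in auto)
    then show False using ne by (simp add: s_def)
  qed
  then obtain z where z: "z \<in> carrier_vec ?n" "q *\<^sub>v z \<noteq> 0\<^sub>v ?n" using mat_eq_zeroI[of q ?n ?n] qD by auto
  have u0: "u \<noteq> 0\<^sub>v ?n" using u by auto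
  obtain t where t: "ip (ev t Y *\<^sub>v u) (q *\<^sub>v z) \<noteq> 0"
    using irr_cyclic[OF Y u(1) u0, of "q *\<^sub>v z"] z qD by auto
  define y where "y = q *\<^sub>v (ev t Y *\<^sub>v u)"
  have y: "dim_vec y = ?n" using qD by (simp add: y_def)
  have "ip y z \<noteq> 0" using t ip_adj[of q ?n ?n "ev t Y *\<^sub>v u" z] qD d z by (simp add: y_def)
  then have y0: "y \<noteq> 0\<^sub>v ?n" using z by auto
  then have pos: "vnorm y > 0" using vnorm_eq_0[of y ?n] vnorm_nonneg[of y] y by (simp add: less_le)
  \<comment> \<open>Places the eigenvalue \<open>(vnorm y)\<^sup>2\<close> above the cut-off of
    \<open>inv_sqrt_above m\<close>.\<close>
  obtain m where m: "1 / real (Suc m) < (vnorm y)\<^sup>2"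
    using pos reals_Archimedean[of "(vnorm y)\<^sup>2"] by (auto simp: inverse_eq_divide)
  define a where "a = Mul (Add One (Iu (Iu (csm One vs)))) (Mul t e)"
  have a: "ev a Y = outer y u"
  proof -
    have "ev (Add One (Iu (Iu (csm One vs)))) Y = q"
      using csm sD unfolding q_def s_def by (intro eq_matI) auto
    then show ?thesis using qD d u y unfolding a_def by (simp add: mult_outer y_def)
  qed
  let ?c = "complex_of_real (1 / vnorm y)"
  define x where "x = ?c \<cdot>\<^sub>v y"
  let ?H = "adj (ev a Y) * ev a Y"
  have H: "herm ?n ?H" using d by (intro herm_adj_mult) auto
  \<comment> \<open>On \<open>u\<close> the matrix \<open>?H\<close> acts as the squared norm of
    \<open>y\<close>, so its inverse square root divides \<open>outer y u\<close> by that
    norm.\<close>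
  have "?H = ip y y \<cdot>\<^sub>m outer u u" unfolding a using y u by (simp add: adj_outer outer_mult_outer)
  then have "?H *\<^sub>v u = of_real ((vnorm y)\<^sup>2) \<cdot>\<^sub>v u" using u
    by (simp add: mv_distrib outer_mult_vec ip_self[of y])
  then have "adj (fc (inv_sqrt_above m) ?H) *\<^sub>v u = cnj (inv_sqrt_above m ((vnorm y)\<^sup>2)) \<cdot>\<^sub>v u"
    unfolding fc_adj[OF H] by (rule fc_eigvec[OF H u(1)])
  moreover have "inv_sqrt_above m ((vnorm y)\<^sup>2) = ?c" using m pos by (simp add: inv_sqrt_above_def)
  ultimately have "outer y u * fc (inv_sqrt_above m) ?H = outer y (cnj ?c \<cdot>\<^sub>v u)"
    using fc_carrier[OF H] u y by (simp add: outer_mult del: fc_dim)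
  then have "ev (Nrm m a) Y = outer x u"
    using a by (simp add: outer_smult_right outer_smult_left x_def)
  moreover have "onl ?n (x # xs)"
  proof -
    have "vnorm x = 1" unfolding x_def vnorm_smult using pos by (simp add: norm_divide)
    moreover have "ip x w = 0" if w: "w \<in> set xs" for w
    proof -
      have dw: "dim_vec w = ?n" by (rule onl_carrier[OF vs(1) w])
      have "q *\<^sub>v w = w - s *\<^sub>v w" unfolding q_def using sD dw by (simp add: mv_distrib)
      also have "\<dots> = 0\<^sub>v ?n" unfolding s_def psum_member[OF vs(1) w] using dw by (intro eq_vecI) auto
      finally have "ip y w = 0" using ip_adj[of q ?n ?n "ev t Y *\<^sub>v u" w] qD d dw by (simp add: y_def)
      then show ?thesis using y dw by (simp add: x_def ip_smult_left[of _ ?n])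
    qed
    ultimately show ?thesis using vs(1) y by (simp add: ip_self x_def)
  qed
  ultimately show ?thesis using that by blast
qed

text \<open>Take an orthonormal list of maximal length; lengths are bounded by the size because the
  trace of the span projection is the length. By \<open>frame_extend\<close> a maximal list spans
  everything.\<close>

lemma ex_frame:
  assumes u: "u \<in> carrier_vec (tdim Y)" "ip u u = 1" "ev e Y = outer u u"
  obtains vs xs where "onl (tdim Y) xs" "map (\<lambda>v. ev v Y) vs = map (\<lambda>x. outer x u) xs"
    "ev (csm One vs) Y = 1\<^sub>m (tdim Y)"
proof -
  let ?n = "tdim Y"
  note d = ev_dim[OF Y]
  define R where "R r \<longleftrightarrow> (\<exists>vs xs. length xs = r \<and> onl ?n xs \<and> map (\<lambda>v. ev v Y) vs = map (\<lambda>x. outer x u) xs \<and>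
     ev (csm One vs) Y = psum ?n xs)" for r
  have "R 0" unfolding R_def by (intro exI[of _ "[]"]) (auto simp: ev_csm_Nil simp del: csm.simps)
  moreover have bd: "r \<le> ?n" if R: "R r" for r
  proof -
    obtain xs where xs: "length xs = r" "onl ?n xs" using R unfolding R_def by blast
    obtain k where k: "trc (psum ?n xs) = of_nat k" "k \<le> ?n" using trc_isproj_nat[OF psum_isproj[OF xs(2)]] .
    have "of_nat k = (of_nat r :: complex)" using k(1) trc_psum[OF xs(2)] xs(1) by simp
    then show ?thesis using k(2) by simp
  qed
  ultimately have Rm: "R (GREATEST r. R r)" and Rmax: "\<And>r. R r \<Longrightarrow> r \<le> (GREATEST r. R r)"
    by (blast intro: GreatestI_nat Greatest_le_nat)+
  then obtain vs xs where f: "length xs = (GREATEST r. R r)" "onl ?n xs" "map (\<lambda>v. ev v Y) vs = map (\<lambda>x. outer x u) xs"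
    "ev (csm One vs) Y = psum ?n xs" unfolding R_def by blast
  have "psum ?n xs = 1\<^sub>m ?n"
  proof (rule ccontr)
    assume "psum ?n xs \<noteq> 1\<^sub>m ?n"
    from frame_extend[OF u f(2,3,4) this] obtain v x where v: "onl ?n (x # xs)" "ev v Y = outer x u" .
    have "ev (csm One (v # vs)) Y = psum ?n (x # xs)"
      using v f(4) u by (simp add: adj_outer outer_mult_outer mm_smult)
    then have "R (Suc (length xs))" unfolding R_def using v f(3)
      by (intro exI[of _ "v # vs"] exI[of _ "x # xs"]) (auto simp del: csm.simps)
    then show False using Rmax f(1) by fastforce
  qed
  then show ?thesis using that f by simp
qed

text \<open>For \<open>v\<^sub>i = outer x\<^sub>i u\<close>, the inner matrix in
  \<open>phi vs g i j\<close> is \<open>ip (g x\<^sub>j) x\<^sub>i\<close> times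
  \<open>outer u u\<close>, and the sum of the \<open>v\<^sub>m v\<^sub>m\<^sup>*\<close> is 1. So
  \<open>phi\<close> is a scalar matrix and commutes with everything.\<close>

lemma ex_good: obtains e vs where "Y \<in> good e vs"
proof -
  let ?n = "tdim Y"
  note d = ev_dim[OF Y] and YD = MtupD[OF irr_Mtup[OF Y]]
  obtain e u where u: "u \<in> carrier_vec ?n" "ip u u = 1" "ev e Y = outer u u" using ex_rank_one[OF Y refl] .
  obtain vs xs where f: "onl ?n xs" "map (\<lambda>v. ev v Y) vs = map (\<lambda>x. outer x u) xs" "ev (csm One vs) Y = 1\<^sub>m ?n"
    using ex_frame[OF u] .
  have len: "length xs = length vs" using f(2) by (metis length_map)
  have v: "ev (vs ! i) Y = outer (xs ! i) u" if "i < length vs" for i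
    using arg_cong[OF f(2), of "\<lambda>z. z ! i"] that len by simp
  have x: "dim_vec (xs ! i) = ?n" if "i < length vs" for i using onl_carrier[OF f(1)] that len by simp
  have "ev (phi vs g i j) Y = ip (ev g Y *\<^sub>v (xs ! j)) (xs ! i) \<cdot>\<^sub>m 1\<^sub>m ?n" if "i < length vs" "j < length vs" for g i j
  proof -
    define c where "c = ip (ev g Y *\<^sub>v (xs ! j)) (xs ! i)"
    have w: "ev (Mul (Adj (vs ! i)) (Mul g (vs ! j))) Y = c \<cdot>\<^sub>m outer u u"
      using that x u d by (simp add: v adj_outer mult_outer outer_mult_vec outer_smult_left c_def)
    \<comment> \<open>Each summand is \<open>c\<close> times the corresponding one for
      \<open>One\<close>, because \<open>outer u u\<close> acts as the unit between \<open>v\<close>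
      and its adjoint.\<close>
    have "ev (csm w vs') Y = c \<cdot>\<^sub>m ev (csm One vs') Y"
      if "ev w Y = c \<cdot>\<^sub>m outer u u" "\<And>v. v \<in> set vs' \<Longrightarrow> v \<in> set vs" for w vs'
      using that(2)
    proof (induction vs')
      case Nil
      show ?case unfolding ev_csm_Nil by (intro eq_matI) auto
    next
      case (Cons a vs')
      obtain i where i: "i < length vs" "a = vs ! i" using Cons.prems[of a] by (auto simp: in_set_conv_nth)
      have "ev a Y * (ev w Y * adj (ev a Y)) = c \<cdot>\<^sub>m (ev a Y * adj (ev a Y))"
        unfolding that(1) i(2) v[OF i(1)] using u x[OF i(1)]
        by (simp add: adj_outer mm_smult outer_mult_outer)
      moreover have "ev (csm w vs') Y = c \<cdot>\<^sub>m ev (csm One vs') Y" using Cons by simp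
      ultimately show ?case using d by (simp add: add_smult_distrib_left_mat[of _ ?n ?n])
    qed
    from this[OF w, of vs] show ?thesis unfolding phi_def c_def[symmetric] using f(3) by simp
  qed
  then have "Y \<in> good e vs"
    unfolding good_def using Y f(3) u x onl_nth[OF f(1)] len d
    by (auto simp: v adj_outer outer_mult_outer mm_smult ev_csm_Nil simp del: csm.simps intro!: eq_matI)
  then show ?thesis using that by blast
qed

end

section \<open>Reconstruction of a function from its frame coefficients\<close>

text \<open>On \<open>good\<close> sets these values of \<open>phi\<close> are scalar matrices by
  \<open>good_scalar\<close>, so the corner entry is the scalar.\<close>

definition coef :: "tm list \<Rightarrow> complex mat list \<Rightarrow> nat \<times> nat \<times> nat \<Rightarrow> complex" where
  "coef vs Y = (\<lambda>(k,i,j). ev (phi vs (Var k) i j) Y $$ (0,0))"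

lemma ev_gens:
  assumes "Y \<in> irr" "k < l"
  shows "ev (Var k) Y = Y ! k" "ev (Adj (Var k)) Y = adj (Y ! k)"
  using assms MtupD(1)[OF irr_Mtup[OF assms(1)]] by auto

lemma good_scalar:
  assumes G: "Y \<in> good e vs" and "i < length vs" "j < length vs" "g \<in> gens"
  shows "ev (phi vs g i j) Y = (ev (phi vs g i j) Y $$ (0,0)) \<cdot>\<^sub>m 1\<^sub>m (tdim Y)"
proof -
  have Y: "Y \<in> irr" using G by (simp add: good_def)
  note d = ev_dim[OF Y] and YD = MtupD[OF irr_Mtup[OF Y]]
  have comm: "ev (phi vs g i j) Y * ev h Y = ev h Y * ev (phi vs g i j) Y" if "h \<in> gens" for h
    using G assms that unfolding good_def by simp
  obtain c where c: "ev (phi vs g i j) Y = c \<cdot>\<^sub>m 1\<^sub>m (tdim Y)"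
  proof (rule irr_schur[OF Y])
    show "ev (phi vs g i j) Y \<in> carrier_mat (tdim Y) (tdim Y)" using d by simp
    show "ev (phi vs g i j) Y * Y ! k = Y ! k * ev (phi vs g i j) Y" if "k < l" for k
      using comm[of "Var k"] that ev_gens[OF Y that] by (simp add: gens_def)
    show "ev (phi vs g i j) Y * adj (Y ! k) = adj (Y ! k) * ev (phi vs g i j) Y" if "k < l" for k
      using comm[of "Adj (Var k)"] that ev_gens[OF Y that] by (simp add: gens_def)
  qed
  show ?thesis unfolding c using YD(2) by simp
qed

text \<open>Fix a unit vector \<open>u\<close> in the range of \<open>e\<close>. The vectors
  \<open>v\<^sub>i u\<close> are orthonormal and their span is invariant under \<open>Y\<close> and
  \<open>Y\<^sup>*\<close>, hence is the whole space. They are the columns of \<open>V\<close>,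
  relative to which the \<open>v\<^sub>i v\<^sub>j\<^sup>*\<close> are the matrix units.\<close>

lemma good_unitary:
  assumes G: "Y \<in> good e vs"
  obtains V where "unitary (tdim Y) V" "length vs = tdim Y"
    "\<And>k. k < l \<Longrightarrow> Y ! k = V * mat (tdim Y) (tdim Y) (\<lambda>(i,j). coef vs Y (k,i,j)) * adj V"
    "\<And>i j m r. i < tdim Y \<Longrightarrow> j < tdim Y \<Longrightarrow> m < tdim Y \<Longrightarrow> r < tdim Y \<Longrightarrow>
      (ev (vs ! i) Y * adj (ev (vs ! j) Y) * V) $$ (r,m) = (if j = m then V $$ (r,i) else 0)"
proof -
  let ?d = "tdim Y" let ?n = "length vs"
  have Y: "Y \<in> irr" using G by (simp add: good_def)
  note d = ev_dim[OF Y] and YD = MtupD[OF irr_Mtup[OF Y]]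
  define v where "v i = ev (vs ! i) Y" for i
  define P where "P = ev e Y"
  have PP: "P * P = P" and one: "ev (csm One vs) Y = 1\<^sub>m ?d"
    and vP: "\<And>i. i < ?n \<Longrightarrow> v i * P = v i"
    and vv: "\<And>i j. i < ?n \<Longrightarrow> j < ?n \<Longrightarrow> adj (v i) * v j = (if i = j then P else 0\<^sub>m ?d ?d)"
    using G unfolding good_def v_def P_def by (auto simp: ev_csm_Nil simp del: csm.simps)
  have dv: "dim_row (v i) = ?d" "dim_col (v i) = ?d" "dim_row P = ?d" "dim_col P = ?d" for i
    using d by (auto simp: v_def P_def)
  have ne: "vs \<noteq> []"
  proof
    assume "vs = []"
    then have "1\<^sub>m ?d $$ (0,0) = (0\<^sub>m ?d ?d $$ (0,0) :: complex)" using one by (simp add: ev_csm_Nil del: csm.simps)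
    then show False using YD(2) by simp
  qed
  have aP: "adj P = P"
  proof -
    have "P = adj (v 0) * v 0" using vv[of 0 0] ne by simp
    then show ?thesis using dv by (simp add: adj_mult[of _ ?d ?d])
  qed
  have Pv: "P * adj (v i) = adj (v i)" if "i < ?n" for i
    using arg_cong[OF vP[OF that], of adj] dv aP by (simp add: adj_mult[of _ ?d ?d])
  \<comment> \<open>If \<open>P\<close> vanished, so would every \<open>v i\<close>, contradicting
    that the frame operator is 1.\<close>
  have "P \<noteq> 0\<^sub>m ?d ?d"
  proof
    assume P0: "P = 0\<^sub>m ?d ?d"
    have "v i = 0\<^sub>m ?d ?d" if "i < ?n" for i using vP[OF that, unfolded P0] dv(1,2)[of i] by simp
    then have a: "adj (ev (vs ! i) Y) *\<^sub>v unit_vec ?d 0 = 0 \<cdot>\<^sub>v 0\<^sub>v ?d" if "i < ?n" for i using that by (simp add: v_def)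
    have "(ev (csm One vs) Y *\<^sub>v unit_vec ?d 0) $ 0 = (\<Sum>m<?n. 0 * (ev (vs ! m) Y *\<^sub>v (ev One Y *\<^sub>v 0\<^sub>v ?d)) $ 0)"
      by (rule csm_mult_vec_index[OF Y _ _ a]) (use YD(2) in auto)
    then show False unfolding one using YD(2) by simp
  qed
  then obtain x where x: "x \<in> carrier_vec ?d" "P *\<^sub>v x \<noteq> 0\<^sub>v ?d" using mat_eq_zeroI[of P ?d ?d] dv by auto
  have "P *\<^sub>v x \<in> carrier_vec ?d" using dv by simp
  then obtain t where t: "t \<noteq> 0" "ip (t \<cdot>\<^sub>v (P *\<^sub>v x)) (t \<cdot>\<^sub>v (P *\<^sub>v x)) = 1" "t \<in> \<real>"
    using exists_unit_multiple[OF _ x(2)] by blast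
  define u where "u = t \<cdot>\<^sub>v (P *\<^sub>v x)"
  have u: "dim_vec u = ?d" "ip u u = 1" "P *\<^sub>v u = u"
    using x t dv PP by (auto simp: u_def mv_distrib simp flip: mv_assoc)
  define V where "V = mat ?d ?n (\<lambda>(r,m). (v m *\<^sub>v u) $ r)"
  have dV: "dim_row V = ?d" "dim_col V = ?n" by (auto simp: V_def)
  have Vi: "V $$ (r,m) = (v m *\<^sub>v u) $ r" if "r < ?d" "m < ?n" for r m using that by (simp add: V_def)
  have vvu: "adj (v i) *\<^sub>v (v j *\<^sub>v u) = (if i = j then 1 else 0) \<cdot>\<^sub>v u" if "i < ?n" "j < ?n" for i j
  proof -
    have "adj (v i) *\<^sub>v (v j *\<^sub>v u) = (if i = j then P else 0\<^sub>m ?d ?d) *\<^sub>v u"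
      unfolding vv[OF that, symmetric] using dv u by (simp add: mv_assoc)
    then show ?thesis using u by (auto intro!: eq_vecI)
  qed
  have mult_V: "(A * V) $$ (r,m) = (A *\<^sub>v (v m *\<^sub>v u)) $ r" if "dim_row A = ?d" "dim_col A = ?d" "r < ?d" "m < ?n" for A :: "complex mat" and r m
  proof -
    have "(A * V) $$ (r,m) = (\<Sum>q<?d. A $$ (r,q) * V $$ (q,m))" using that dV by (intro mult_index) auto
    also have "\<dots> = (\<Sum>q<?d. A $$ (r,q) * (v m *\<^sub>v u) $ q)" using that by (intro sum.cong) (auto simp: Vi simp del: index_mult_mat_vec)
    also have "\<dots> = (A *\<^sub>v (v m *\<^sub>v u)) $ r" using that dv by (intro mult_vec_index[symmetric]) auto
    finally show ?thesis .
  qed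
  have VV: "adj V * V = 1\<^sub>m ?n"
  proof (rule eq_matI)
    fix i j assume "i < dim_row (1\<^sub>m ?n)" "j < dim_col (1\<^sub>m ?n)"
    then have ij: "i < ?n" "j < ?n" by auto
    have "(adj V * V) $$ (i,j) = (\<Sum>q<?d. adj V $$ (i,q) * V $$ (q,j))" using ij dV by (intro mult_index) auto
    also have "\<dots> = ip (v j *\<^sub>v u) (v i *\<^sub>v u)"
      unfolding ip_def using ij dV dv by (auto simp: Vi mult.commute simp del: index_mult_mat_vec intro!: sum.cong)
    also have "\<dots> = ip (adj (v i) *\<^sub>v (v j *\<^sub>v u)) u"
      using ip_adj[of "adj (v i)" ?d ?d "v j *\<^sub>v u" u] dv u by simp
    also have "\<dots> = 1\<^sub>m ?n $$ (i,j)" unfolding vvu[OF ij] using u ij by (simp add: ip_smult_left[of _ ?d])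
    finally show "(adj V * V) $$ (i,j) = 1\<^sub>m ?n $$ (i,j)" .
  qed (use dV in auto)
  define C where "C g = mat ?n ?n (\<lambda>(i,j). ev (phi vs g i j) Y $$ (0,0))" for g
  have gV: "ev g Y * V = V * C g" if g: "g \<in> gens" for g
  proof (rule eq_matI)
    fix r j assume "r < dim_row (V * C g)" "j < dim_col (V * C g)"
    then have rj: "r < ?d" "j < ?n" using dV by (auto simp: C_def)
    \<comment> \<open>Apply \<open>phi vs g i j\<close> to \<open>v i *\<^sub>v u\<close> twice: by
      definition it gives \<open>v i\<close> applied to the compressed \<open>g\<close>, and as a
      scalar matrix it gives the multiple \<open>C g $$ (i,j)\<close>. Multiplying by
      \<open>adj (v i)\<close> isolates the coefficient.\<close>
    have key: "adj (v i) *\<^sub>v (ev g Y *\<^sub>v (v j *\<^sub>v u)) = C g $$ (i,j) \<cdot>\<^sub>v u" if i: "i < ?n" for i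
    proof -
      let ?w = "Mul (Adj (vs ! i)) (Mul g (vs ! j))"
      have w: "ev ?w Y = adj (v i) * (ev g Y * v j)" by (simp add: v_def)
      have "(ev (phi vs g i j) Y *\<^sub>v (v i *\<^sub>v u)) $ s = (v i *\<^sub>v (ev ?w Y *\<^sub>v u)) $ s" if s: "s < ?d" for s
      proof -
        have "(ev (phi vs g i j) Y *\<^sub>v (v i *\<^sub>v u)) $ s =
            (\<Sum>m<?n. (if m = i then 1 else 0) * (ev (vs ! m) Y *\<^sub>v (ev ?w Y *\<^sub>v u)) $ s)"
          unfolding phi_def
          by (rule csm_mult_vec_index[OF Y _ s]) (use dv u vvu i in \<open>auto simp flip: v_def\<close>)
        also have "\<dots> = (\<Sum>m<?n. if m = i then (v i *\<^sub>v (ev ?w Y *\<^sub>v u)) $ s else 0)"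
          by (intro sum.cong) (auto simp: v_def)
        finally show ?thesis using i by simp
      qed
      then have "ev (phi vs g i j) Y *\<^sub>v (v i *\<^sub>v u) = v i *\<^sub>v (ev ?w Y *\<^sub>v u)"
        using d dv by (intro eq_vecI) (auto simp del: index_mult_mat_vec)
      moreover have "ev (phi vs g i j) Y *\<^sub>v (v i *\<^sub>v u) = C g $$ (i,j) \<cdot>\<^sub>v (v i *\<^sub>v u)"
        by (subst good_scalar[OF G i rj(2) g]) (use dv i rj in \<open>simp add: C_def mv_distrib\<close>)
      ultimately have "adj (v i) *\<^sub>v (v i *\<^sub>v (ev ?w Y *\<^sub>v u)) = adj (v i) *\<^sub>v (C g $$ (i,j) \<cdot>\<^sub>v (v i *\<^sub>v u))" by simp
      also have "\<dots> = C g $$ (i,j) \<cdot>\<^sub>v u" using vvu[OF i i] dv u by (simp add: mv_distrib)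
      also have "adj (v i) *\<^sub>v (v i *\<^sub>v (ev ?w Y *\<^sub>v u)) = (adj (v i) * v i) *\<^sub>v (ev ?w Y *\<^sub>v u)"
        using dv d by (intro mv_assoc[symmetric]) auto
      also have "\<dots> = (P * adj (v i) * (ev g Y * v j)) *\<^sub>v u"
        unfolding vv[OF i i] w using dv d u by (simp add: mv_assoc)
      also have "\<dots> = adj (v i) *\<^sub>v (ev g Y *\<^sub>v (v j *\<^sub>v u))"
        unfolding Pv[OF i] using dv d u by (simp add: mv_assoc)
      finally show ?thesis .
    qed
    \<comment> \<open>Insert the frame operator, which is 1, and expand with the coefficients from
      \<open>key\<close>.\<close>
    have "(ev g Y * V) $$ (r,j) = (ev (csm One vs) Y *\<^sub>v (ev g Y *\<^sub>v (v j *\<^sub>v u))) $ r"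
      unfolding one using mult_V[OF _ _ rj] d by simp
    also have "\<dots> = (\<Sum>m<?n. C g $$ (m,j) * (ev (vs ! m) Y *\<^sub>v (ev One Y *\<^sub>v u)) $ r)"
      by (rule csm_mult_vec_index[OF Y _ rj(1)]) (use key d u in \<open>auto simp: v_def\<close>)
    also have "\<dots> = (\<Sum>m<?n. V $$ (r,m) * C g $$ (m,j))"
      using rj u by (intro sum.cong) (auto simp: Vi v_def mult.commute simp del: index_mult_mat_vec)
    also have "\<dots> = (V * C g) $$ (r,j)"
      using rj dV by (intro mult_index[symmetric]) (auto simp: C_def)
    finally show "(ev g Y * V) $$ (r,j) = (V * C g) $$ (r,j)" .
  qed (use dV d in \<open>auto simp: C_def\<close>)
  \<comment> \<open>The column space of \<open>V\<close>; invariance follows from \<open>gV\<close>,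
    and irreducibility then makes \<open>V\<close> onto.\<close>
  define K where "K = {V *\<^sub>v a | a. dim_vec a = ?n}"
  have inv: "ev g Y *\<^sub>v z \<in> K" if z: "z \<in> K" and g: "g \<in> gens" for z g
  proof -
    obtain a where a: "z = V *\<^sub>v a" "dim_vec a = ?n" using z by (auto simp: K_def)
    have "ev g Y *\<^sub>v z = (ev g Y * V) *\<^sub>v a" unfolding a using a(2) d dV by (simp add: mv_assoc)
    also have "\<dots> = V *\<^sub>v (C g *\<^sub>v a)" unfolding gV[OF g] using a(2) dV by (simp add: mv_assoc C_def)
    finally show ?thesis unfolding K_def by (auto simp: C_def)
  qed
  have Kd: "K = carrier_vec ?d"
  proof (rule irr_invariant_subspace[OF Y])
    show "K \<subseteq> carrier_vec ?d" using dV by (auto simp: K_def)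
    show "0\<^sub>v ?d \<in> K" unfolding K_def using dV
      by (intro CollectI exI[of _ "0\<^sub>v ?n"]) (auto intro!: eq_vecI)
    show "x + y \<in> K" if xy: "x \<in> K" "y \<in> K" for x y
    proof -
      obtain a b where "x = V *\<^sub>v a" "dim_vec a = ?n" "y = V *\<^sub>v b" "dim_vec b = ?n" using xy by (auto simp: K_def)
      then have "x + y = V *\<^sub>v (a + b)" "dim_vec (a + b) = ?n" using dV by (auto simp: mv_distrib)
      then show ?thesis unfolding K_def by blast
    qed
    show "c \<cdot>\<^sub>v x \<in> K" if x: "x \<in> K" for c x
    proof -
      obtain a where "x = V *\<^sub>v a" "dim_vec a = ?n" using x by (auto simp: K_def)
      then have "c \<cdot>\<^sub>v x = V *\<^sub>v (c \<cdot>\<^sub>v a)" "dim_vec (c \<cdot>\<^sub>v a) = ?n" using dV by (auto simp: mv_distrib)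
      then show ?thesis unfolding K_def by blast
    qed
    show "Y ! k *\<^sub>v z \<in> K" if "k < l" "z \<in> K" for k z
      using inv[OF that(2), of "Var k"] that(1) ev_gens[OF Y that(1)] by (simp add: gens_def)
    show "adj (Y ! k) *\<^sub>v z \<in> K" if "k < l" "z \<in> K" for k z
      using inv[OF that(2), of "Adj (Var k)"] that(1) ev_gens[OF Y that(1)] by (simp add: gens_def)
    show "V *\<^sub>v unit_vec ?n 0 \<in> K" unfolding K_def by auto
    show "V *\<^sub>v unit_vec ?n 0 \<noteq> 0\<^sub>v ?d"
    proof
      assume "V *\<^sub>v unit_vec ?n 0 = 0\<^sub>v ?d"
      then have "(adj V * V) *\<^sub>v unit_vec ?n 0 = adj V *\<^sub>v 0\<^sub>v ?d" using dV by (simp add: mv_assoc)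
      then have "unit_vec ?n 0 $ 0 = (adj V *\<^sub>v 0\<^sub>v ?d) $ 0" unfolding VV by simp
      then show False using ne dV by simp
    qed
  qed
  have VV': "V * adj V = 1\<^sub>m ?d"
  proof (rule mat_eq_vecI[of _ ?d ?d])
    fix z :: "complex vec" assume "z \<in> carrier_vec ?d"
    then have "z \<in> K" unfolding Kd .
    then obtain a where a: "z = V *\<^sub>v a" "dim_vec a = ?n" by (auto simp: K_def)
    have "V * adj V *\<^sub>v z = V *\<^sub>v ((adj V * V) *\<^sub>v a)" unfolding a using a(2) dV by (simp add: mv_assoc)
    then show "V * adj V *\<^sub>v z = 1\<^sub>m ?d *\<^sub>v z" unfolding VV using a dV by simp
  qed (use dV in auto)
  \<comment> \<open>Comparing the traces of \<open>V * adj V\<close> and \<open>adj V * V\<close>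
    shows that the frame has as many members as the size of \<open>Y\<close>.\<close>
  have "of_nat ?n = (of_nat ?d :: complex)"
    using trc_comm[of V "adj V"] dV unfolding VV VV' by simp
  then have n: "?n = ?d" by simp
  have "unitary ?d V" using dV VV VV' n by (simp add: unitary_def)
  moreover have "Y ! k = V * mat ?d ?d (\<lambda>(i,j). coef vs Y (k,i,j)) * adj V" if k: "k < l" for k
  proof -
    have "C (Var k) = mat ?d ?d (\<lambda>(i,j). coef vs Y (k,i,j))"
      unfolding C_def n coef_def by (intro eq_matI) auto
    then have "Y ! k * V = V * mat ?d ?d (\<lambda>(i,j). coef vs Y (k,i,j))"
      using gV[of "Var k"] k ev_gens[OF Y k] by (simp add: gens_def)
    then have "Y ! k * V * adj V = V * mat ?d ?d (\<lambda>(i,j). coef vs Y (k,i,j)) * adj V" by simp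
    moreover have "Y ! k * V * adj V = Y ! k" using VV' dV YD k by (simp add: mm_assoc)
    ultimately show ?thesis by simp
  qed
  moreover have "(ev (vs ! i) Y * adj (ev (vs ! j) Y) * V) $$ (r,m) = (if j = m then V $$ (r,i) else 0)"
    if "i < ?d" "j < ?d" "m < ?d" "r < ?d" for i j m r
  proof -
    have "(v i * adj (v j) * V) $$ (r,m) = (v i *\<^sub>v (adj (v j) *\<^sub>v (v m *\<^sub>v u))) $ r"
      using mult_V[of "v i * adj (v j)" r m] that n dv u by (simp add: mv_assoc del: index_mult_mat_vec)
    also have "\<dots> = (if j = m then V $$ (r,i) else 0)"
      using that n dv u by (simp add: vvu mv_distrib Vi del: index_mult_mat_vec)
    finally show ?thesis by (simp add: v_def)
  qed
  ultimately show ?thesis using that n by blast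
qed

text \<open>The size is an explicit argument so that the empty sum is defined.\<close>

definition msum :: "nat \<Rightarrow> 'i set \<Rightarrow> ('i \<Rightarrow> complex mat) \<Rightarrow> complex mat" where
  "msum d I A = mat d d (\<lambda>(r,s). \<Sum>i\<in>I. A i $$ (r,s))"

lemma onE_msum:
  assumes "finite I" "\<And>i. i \<in> I \<Longrightarrow> onE (k i)"
  shows "onE (\<lambda>Y. msum (tdim Y) I (\<lambda>i. k i Y))"
  using assms
proof (induction I)
  case empty
  show ?case using onE_zero by (rule onE_cong) (auto simp: msum_def intro!: eq_matI)
next
  case (insert i I)
  have "onE (\<lambda>Y. k i Y + msum (tdim Y) I (\<lambda>i. k i Y))" using insert by (intro onE_add) auto
  then show ?case
    by (rule onE_cong) (use insert onE_dim[of "k i"] in \<open>auto simp: msum_def intro!: eq_matI\<close>)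
qed

text \<open>Points of the product measure space are extensional functions; restricting the
  coordinates to the index set leaves the tuple unchanged.\<close>

lemma tup_of_restrict: "tup_of l n (restrict x ({..<l} \<times> {..<n} \<times> {..<n})) = tup_of l n x"
  unfolding tup_of_def by (intro map_cong refl eq_matI) auto

text \<open>\<open>Y\<close> is the conjugate by \<open>V\<close> of its coefficient tuple, so
  compatibility determines \<open>f Y\<close> from the entries of \<open>f\<close> there. These
  entries are bounded measurable scalar functions of \<open>Y\<close>, hence central elements of
  \<open>E\<close>, and they multiply the matrix units
  \<open>v\<^sub>i v\<^sub>j\<^sup>*\<close>.\<close>

lemma onE_bounded_good:
  assumes f: "f \<in> Falg l" and bd: "\<And>X. X \<in> Mtup l \<Longrightarrow> opnorm (f X) \<le> C"
  shows "onE (\<lambda>Y. if Y \<in> good e vs then f Y else 0\<^sub>m (tdim Y) (tdim Y))"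
proof -
  note cf = FalgD(1)[OF f] and bf = FalgD(2)[OF f]
  define n where "n = length vs"
  define I where "I = {..<l} \<times> {..<n} \<times> {..<n}"
  \<comment> \<open>Outside the \<open>good\<close> set the coordinates are 0, which still describes
    a tuple in \<open>Mtup l\<close> when \<open>n\<close> is positive. So the entries of
    \<open>f\<close> at \<open>x Y\<close> are bounded by \<open>C\<close> for every
    \<open>Y\<close>.\<close>
  define x where "x Y = (\<lambda>q\<in>I. if Y \<in> good e vs then coef vs Y q else 0)" for Y
  have sc: "(\<lambda>Y. if Y \<in> good e vs then coef vs Y q else 0) \<in> borel_measurable irr_alg" if q: "q \<in> I" for q
  proof -
    obtain k i j where q': "q = (k,i,j)" "k < l" "i < n" "j < n" using q by (auto simp: I_def)
    show ?thesis
    proof (rule scalar_measurable[OF onE_ev[of "phi vs (Var k) i j"] good_sets])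
      fix Y assume "Y \<in> good e vs"
      then show "ev (phi vs (Var k) i j) Y = coef vs Y q \<cdot>\<^sub>m 1\<^sub>m (tdim Y)"
        using good_scalar[of Y e vs i j "Var k"] q' by (simp add: coef_def gens_def n_def)
    qed
  qed
  have xm: "x \<in> measurable irr_alg (PiM I (\<lambda>_. borel))"
    unfolding x_def by (rule measurable_restrict) (rule sc)
  define F where "F i j Y = f (tup_of l n (x Y)) $$ (i,j)" for i j Y
  have F: "onE (\<lambda>Y. F i j Y \<cdot>\<^sub>m 1\<^sub>m (tdim Y))" if ij: "i < n" "j < n" for i j
  proof -
    have n: "1 \<le> n" using ij by simp
    have "F i j \<in> borel_measurable irr_alg"
      unfolding F_def using measurable_compose[OF xm[unfolded I_def] borel_funD[OF bf n ij]] .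
    moreover have "cmod (F i j Y) \<le> C" for Y
    proof -
      have "cmod (F i j Y) \<le> opnorm (f (tup_of l n (x Y)))" unfolding F_def
        using compatibleD(1,2)[OF cf tup_of_Mtup(1)[OF n]] tup_of_Mtup(2)[OF n] ij
        by (intro opnorm_entry) auto
      also have "\<dots> \<le> C" by (rule bd[OF tup_of_Mtup(1)[OF n]])
      finally show ?thesis .
    qed
    ultimately show ?thesis using scalE_measurable[of "F i j" C] by (simp add: scalE_def)
  qed
  let ?T = "\<lambda>Y. msum (tdim Y) ({..<n} \<times> {..<n})
      (\<lambda>(i,j). F i j Y \<cdot>\<^sub>m 1\<^sub>m (tdim Y) * (ev (vs ! i) Y * adj (ev (vs ! j) Y)))"
  have "onE (\<lambda>Y. msum (tdim Y) ({..<n} \<times> {..<n})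
      (\<lambda>q. F (fst q) (snd q) Y \<cdot>\<^sub>m 1\<^sub>m (tdim Y) * (ev (vs ! fst q) Y * adj (ev (vs ! snd q) Y))))"
    by (intro onE_msum onE_mult F onE_ev onE_adj) auto
  then have T: "onE ?T" by (simp add: case_prod_unfold)
  have TY: "?T Y = f Y" if G: "Y \<in> good e vs" for Y
  proof -
    let ?d = "tdim Y"
    have Y: "Y \<in> irr" using G by (simp add: good_def)
    note d = ev_dim[OF Y] and YD = MtupD[OF irr_Mtup[OF Y]]
    obtain V where V: "unitary ?d V" "length vs = ?d"
      and YV: "\<And>k. k < l \<Longrightarrow> Y ! k = V * mat ?d ?d (\<lambda>(i,j). coef vs Y (k,i,j)) * adj V"
      and vV: "\<And>i j m r. i < ?d \<Longrightarrow> j < ?d \<Longrightarrow> m < ?d \<Longrightarrow> r < ?d \<Longrightarrow>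
        (ev (vs ! i) Y * adj (ev (vs ! j) Y) * V) $$ (r,m) = (if j = m then V $$ (r,i) else 0)"
      using good_unitary[OF G] by blast
    note Vd = unitaryD[OF V(1)] unitary_cancel[OF V(1)]
    have nd: "n = ?d" by (simp add: n_def V(2))
    define X where "X = tup_of l ?d (coef vs Y)"
    have "tup_of l n (x Y) = tup_of l n (restrict (coef vs Y) I)"
      unfolding x_def using G by simp
    then have Xx: "tup_of l n (x Y) = X" unfolding I_def tup_of_restrict by (simp add: X_def nd)
    note XM = tup_of_Mtup[OF YD(2), of "coef vs Y", folded X_def]
    have uX: "unitary (tdim X) V" using V(1) XM by simp
    have "Y = conjt V X"
    proof (rule nth_equalityI)
      show "length Y = length (conjt V X)" using YD MtupD(1)[OF conjt_Mtup(1)[OF XM(1) uX]] by simp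
      fix k assume "k < length Y"
      then have k: "k < l" using YD by simp
      show "Y ! k = conjt V X ! k" unfolding conjt_Mtup(3)[OF XM(1) uX k] YV[OF k] using k by (simp add: X_def tup_of_def)
    qed
    then have fY: "f Y = V * f X * adj V" using compatibleD(3)[OF cf XM(1) uX] by simp
    have dX: "dim_row (f X) = ?d" "dim_col (f X) = ?d" using compatibleD(1,2)[OF cf XM(1)] XM(2) by auto
    have dT: "dim_row (?T Y) = ?d" "dim_col (?T Y) = ?d" by (auto simp: msum_def)
    \<comment> \<open>Both sides are compared after multiplication by the unitary \<open>V\<close>,
      where the \<open>v\<^sub>i v\<^sub>j\<^sup>*\<close> act as matrix units.\<close>
    have TV: "?T Y * V = V * f X"
    proof (rule eq_matI)
      fix r m assume "r < dim_row (V * f X)" "m < dim_col (V * f X)"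
      then have rm: "r < ?d" "m < ?d" using Vd dX by auto
      let ?w = "\<lambda>i j. ev (vs ! i) Y * adj (ev (vs ! j) Y)"
      have "(?T Y * V) $$ (r,m) = (\<Sum>s<?d. ?T Y $$ (r,s) * V $$ (s,m))"
        using rm Vd dT by (intro mult_index) auto
      also have "\<dots> = (\<Sum>s<?d. \<Sum>(i,j)\<in>{..<n}\<times>{..<n}. F i j Y * (?w i j $$ (r,s) * V $$ (s,m)))"
        using rm d by (intro sum.cong refl)
          (auto simp: msum_def sum_distrib_right mm_smult case_prod_unfold mult.assoc simp del: index_mult_mat(1) intro!: sum.cong)
      also have "\<dots> = (\<Sum>(i,j)\<in>{..<n}\<times>{..<n}. \<Sum>s<?d. F i j Y * (?w i j $$ (r,s) * V $$ (s,m)))"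
        unfolding case_prod_unfold by (rule sum.swap)
      also have "\<dots> = (\<Sum>i<n. \<Sum>j<n. \<Sum>s<?d. F i j Y * (?w i j $$ (r,s) * V $$ (s,m)))"
        by (rule sum.cartesian_product[symmetric])
      also have "\<dots> = (\<Sum>i<n. \<Sum>j<n. F i j Y * (if j = m then V $$ (r,i) else 0))"
      proof (intro sum.cong refl)
        fix i j assume ij: "i \<in> {..<n}" "j \<in> {..<n}"
        have "(\<Sum>s<?d. ?w i j $$ (r,s) * V $$ (s,m)) = (?w i j * V) $$ (r,m)"
          using rm d Vd by (intro mult_index[symmetric]) auto
        also have "\<dots> = (if j = m then V $$ (r,i) else 0)" using ij rm nd by (intro vV) auto
        finally show "(\<Sum>s<?d. F i j Y * (?w i j $$ (r,s) * V $$ (s,m))) = F i j Y * (if j = m then V $$ (r,i) else 0)"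
          unfolding sum_distrib_left[symmetric] by (rule arg_cong)
      qed
      also have "\<dots> = (\<Sum>i<n. \<Sum>j<n. if j = m then F i j Y * V $$ (r,i) else 0)"
        by (intro sum.cong) auto
      also have "\<dots> = (\<Sum>i<?d. V $$ (r,i) * f X $$ (i,m))"
        using rm by (simp add: nd F_def Xx[unfolded nd] mult.commute)
      also have "\<dots> = (V * f X) $$ (r,m)" using rm Vd dX by (intro mult_index[symmetric]) auto
      finally show "(?T Y * V) $$ (r,m) = (V * f X) $$ (r,m)" .
    qed (use Vd dX dT in auto)
    have "?T Y = ?T Y * (V * adj V)" unfolding Vd(3) using dT by simp
    also have "\<dots> = ?T Y * V * adj V" using dT Vd by (simp add: mm_assoc)
    finally show ?thesis unfolding TV fY .
  qed
  have "onE (\<lambda>Y. (if Y \<in> good e vs then 1\<^sub>m (tdim Y) else 0\<^sub>m (tdim Y) (tdim Y)) * ?T Y)"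
    by (rule onE_mult[OF onE_indicator[OF good_sets] T])
  then show ?thesis
  proof (rule onE_cong)
    fix Y assume Y: "Y \<in> irr"
    have "dim_row (?T Y) = tdim Y" "dim_col (?T Y) = tdim Y" by (simp_all add: msum_def)
    then show "(if Y \<in> good e vs then 1\<^sub>m (tdim Y) else 0\<^sub>m (tdim Y) (tdim Y)) * ?T Y =
        (if Y \<in> good e vs then f Y else 0\<^sub>m (tdim Y) (tdim Y))"
      using TY[of Y] by (cases "Y \<in> good e vs") simp_all
  qed
qed

text \<open>The countably many \<open>good\<close> sets cover \<open>irr\<close>. Cutting
  \<open>f\<close> off to the union of the first \<open>N\<close> of them gives a sequence bounded
  by \<open>C\<close> that at each \<open>Y\<close> is eventually equal to
  \<open>f Y\<close>.\<close>

lemma onE_bounded: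
  assumes f: "f \<in> Falg l" and bd: "\<And>X. X \<in> Mtup l \<Longrightarrow> opnorm (f X) \<le> C"
  shows "onE f"
proof -
  note cf = FalgD(1)[OF f]
  define g where "g m = (case from_nat m of (e,vs) \<Rightarrow> good e vs)" for m :: nat
  define A where "A N = (\<Union>m<N. g m)" for N
  have gs: "g m \<in> sets irr_alg" for m by (simp add: g_def good_sets split: prod.split)
  then have As: "A N \<in> sets irr_alg" for N unfolding A_def by auto
  have gf: "onE (\<lambda>Y. if Y \<in> g m then f Y else 0\<^sub>m (tdim Y) (tdim Y))" for m
  proof -
    obtain e :: tm and vs :: "tm list" where "from_nat m = (e, vs)" by fastforce
    then show ?thesis unfolding g_def using onE_bounded_good[OF f bd, of e vs] by simp
  qed
  have Af: "onE (\<lambda>Y. if Y \<in> A N then f Y else 0\<^sub>m (tdim Y) (tdim Y))" for N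
  proof (induction N)
    case 0
    show ?case using onE_zero by (rule onE_cong) (simp add: A_def)
  next
    case (Suc N)
    \<comment> \<open>The factor \<open>1 - 1\<^sub>A\<close> removes the part of the new set that
      is already covered, so that nothing is counted twice.\<close>
    have "onE (\<lambda>Y. (if Y \<in> A N then f Y else 0\<^sub>m (tdim Y) (tdim Y)) +
      (1\<^sub>m (tdim Y) - (if Y \<in> A N then 1\<^sub>m (tdim Y) else 0\<^sub>m (tdim Y) (tdim Y))) * (if Y \<in> g N then f Y else 0\<^sub>m (tdim Y) (tdim Y)))"
      by (intro onE_add Suc onE_mult onE_minus onE_one onE_indicator As gf)
    then show ?case
    proof (rule onE_cong)
      fix Y assume "Y \<in> irr"
      note d = compatibleD(1,2)[OF cf irr_Mtup[OF this]]
      have "1\<^sub>m (tdim Y) - 1\<^sub>m (tdim Y) = (0\<^sub>m (tdim Y) (tdim Y) :: complex mat)"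
        "1\<^sub>m (tdim Y) - 0\<^sub>m (tdim Y) (tdim Y) = (1\<^sub>m (tdim Y) :: complex mat)"
        by (auto intro!: eq_matI)
      then show "(if Y \<in> A N then f Y else 0\<^sub>m (tdim Y) (tdim Y)) +
          (1\<^sub>m (tdim Y) - (if Y \<in> A N then 1\<^sub>m (tdim Y) else 0\<^sub>m (tdim Y) (tdim Y))) * (if Y \<in> g N then f Y else 0\<^sub>m (tdim Y) (tdim Y)) =
          (if Y \<in> A (Suc N) then f Y else 0\<^sub>m (tdim Y) (tdim Y))"
        using d by (auto simp: A_def less_Suc_eq)
    qed
  qed
  show ?thesis
  proof (rule onE_lim[where C = C, OF Af])
    fix N Y assume Y: "Y \<in> irr"
    have "opnorm (0\<^sub>m (tdim Y) (tdim Y)) \<le> C"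
      using order_trans[OF opnorm_smult[of 0 "0\<^sub>m (tdim Y) (tdim Y)"]] order_trans[OF opnorm_nonneg bd[OF irr_Mtup[OF Y]]] by simp
    then show "opnorm (if Y \<in> A N then f Y else 0\<^sub>m (tdim Y) (tdim Y)) \<le> C" using bd[OF irr_Mtup[OF Y]] by simp
  next
    fix Y assume Y: "Y \<in> irr"
    obtain e vs where G: "Y \<in> good e vs" using ex_good[OF Y] .
    have "Y \<in> A N" if "N > to_nat (e,vs)" for N
      unfolding A_def using that G by (intro UN_I[of "to_nat (e,vs)"]) (auto simp: g_def)
    then have ev: "\<forall>\<^sub>F N in sequentially. Y \<in> A N" using eventually_gt_at_top by (rule eventually_mono[rotated])
    show "mlim (tdim Y) (\<lambda>N. if Y \<in> A N then f Y else 0\<^sub>m (tdim Y) (tdim Y)) (f Y)"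
      unfolding mlim_def
    proof (intro conjI allI impI)
      fix i j
      show "(\<lambda>N. (if Y \<in> A N then f Y else 0\<^sub>m (tdim Y) (tdim Y)) $$ (i,j)) \<longlonglongrightarrow> f Y $$ (i,j)"
        by (rule tendsto_eventually, rule eventually_mono[OF ev]) simp
    qed (use compatibleD(1,2)[OF cf irr_Mtup[OF Y]] in auto)
  qed
qed

end

section \<open>Unbounded functions\<close>

text \<open>With \<open>y = B *\<^sub>v v\<close> one has
  \<open>v = y + adj A * A *\<^sub>v y\<close>, so \<open>ip v y\<close> is the sum of the squared
  norms of \<open>y\<close> and \<open>A *\<^sub>v y\<close>. Cauchy-Schwarz and
  \<open>vnorm y \<le> vnorm v\<close> bound this by the square of \<open>vnorm v\<close>.\<close>

lemma one_plus_adj_mult: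
  assumes A: "A \<in> carrier_mat n n"
  obtains B where "B \<in> carrier_mat n n" "(1\<^sub>m n + adj A * A) * B = 1\<^sub>m n" "opnorm B \<le> 1" "opnorm (A * B) \<le> 1"
proof -
  let ?H = "adj A * A"
  have H: "herm n ?H" by (rule herm_adj_mult[OF A])
  have nonneg: "0 \<le> \<mu>" if v: "v \<in> carrier_vec n" "v \<noteq> 0\<^sub>v n" "?H *\<^sub>v v = of_real \<mu> \<cdot>\<^sub>v v" for \<mu> v
  proof -
    have "of_real (\<mu> * (vnorm v)\<^sup>2) = ip (?H *\<^sub>v v) v"
      unfolding v(3) using v(1) by (simp add: ip_smult_left[of _ n] ip_self)
    also have "\<dots> = ip (A *\<^sub>v v) (A *\<^sub>v v)"
      using ip_adj[of "adj A" n n "A *\<^sub>v v" v] A v(1) by (simp add: mv_assoc)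
    also have "\<dots> = of_real ((vnorm (A *\<^sub>v v))\<^sup>2)" by (rule ip_self)
    finally have "\<mu> * (vnorm v)\<^sup>2 = (vnorm (A *\<^sub>v v))\<^sup>2" by (simp only: of_real_eq_iff)
    then have "0 \<le> \<mu> * (vnorm v)\<^sup>2" by simp
    moreover have "0 < (vnorm v)\<^sup>2" using v vnorm_eq_0[of v n] by simp
    ultimately show ?thesis by (simp add: zero_le_mult_iff)
  qed
  \<comment> \<open>The absolute value makes \<open>r\<close> bounded by 1 on the whole line. On the
    eigenvalues of \<open>adj A * A\<close>, which are nonnegative, it agrees with the inverse of
    \<open>1 + t\<close>.\<close>
  define r where "r t = 1 / (1 + \<bar>t\<bar>)" for t :: real
  define B where "B = fc (\<lambda>t. of_real (r t)) ?H"
  have B: "B \<in> carrier_mat n n" unfolding B_def by (rule fc_carrier[OF H])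
  have "1\<^sub>m n + ?H = fc (\<lambda>t. 1 + of_real t) ?H"
    using fc_add[OF H, of "\<lambda>_. 1" of_real] by (simp add: fc_const[OF H] fc_id[OF H] mm_smult)
  then have "(1\<^sub>m n + ?H) * B = fc (\<lambda>t. (1 + of_real t) * of_real (r t)) ?H"
    unfolding B_def by (simp add: fc_mult[OF H])
  also have "\<dots> = fc (\<lambda>_. 1) ?H"
    by (rule fc_cong_eigenvalues[OF H]) (use nonneg in \<open>force simp: r_def complex_eq_iff Re_divide Im_divide\<close>)
  also have "\<dots> = 1\<^sub>m n" by (simp add: fc_const[OF H] mm_smult)
  finally have inv: "(1\<^sub>m n + ?H) * B = 1\<^sub>m n" .
  have nB: "opnorm B \<le> 1" unfolding B_def
  proof (rule opnorm_fc_le[OF H])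
    show "cmod (complex_of_real (r t)) \<le> 1" for t unfolding norm_of_real r_def by (simp add: divide_simps)
  qed
  have "opnorm (A * B) \<le> 1"
  proof (rule opnorm_leI)
    fix v :: "complex vec" assume "v \<in> carrier_vec (dim_col (A * B))"
    then have v: "dim_vec v = n" using B by simp
    define y where "y = B *\<^sub>v v"
    have y: "dim_vec y = n" using B by (simp add: y_def)
    have "vnorm y \<le> opnorm B * vnorm v" unfolding y_def using B v by (intro vnorm_mult_le) simp
    also have "\<dots> \<le> 1 * vnorm v" by (intro mult_right_mono nB) simp
    finally have ny: "vnorm y \<le> vnorm v" by simp
    have "v = (1\<^sub>m n + ?H) *\<^sub>v y" unfolding y_def using inv A B v by (simp flip: mv_assoc)
    also have "\<dots> = y + ?H *\<^sub>v y" using A y by (simp add: mv_distrib)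
    finally have "ip v y = ip (y + ?H *\<^sub>v y) y" by (rule arg_cong)
    also have "\<dots> = ip y y + ip (A *\<^sub>v y) (A *\<^sub>v y)"
      using ip_adj[of "adj A" n n "A *\<^sub>v y" y] A y by (simp add: ip_add_left[of _ n] mv_assoc)
    finally have "ip v y = of_real ((vnorm y)\<^sup>2 + (vnorm (A *\<^sub>v y))\<^sup>2)" by (simp add: ip_self)
    then have "cmod (ip v y) = \<bar>(vnorm y)\<^sup>2 + (vnorm (A *\<^sub>v y))\<^sup>2\<bar>" by (simp only: norm_of_real)
    then have "(vnorm y)\<^sup>2 + (vnorm (A *\<^sub>v y))\<^sup>2 = cmod (ip v y)" by simp
    also have "\<dots> \<le> vnorm v * vnorm y" using v y by (intro ip_cauchy_schwarz[of _ n]) auto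
    also have "\<dots> \<le> vnorm v * vnorm v" by (intro mult_left_mono ny) auto
    finally have "(vnorm y)\<^sup>2 + (vnorm (A *\<^sub>v y))\<^sup>2 \<le> (vnorm v)\<^sup>2" by (simp only: power2_eq_square)
    then have "(vnorm (A *\<^sub>v y))\<^sup>2 \<le> (vnorm v)\<^sup>2" using zero_le_power2[of "vnorm y"] by linarith
    then have "vnorm (A *\<^sub>v y) \<le> vnorm v" by (rule power2_le_imp_le) simp
    then show "vnorm (A * B *\<^sub>v v) \<le> 1 * vnorm v"
      using A B v by (simp add: mv_assoc y_def)
  qed simp
  then show ?thesis using that B inv nB by blast
qed

context closed_subalgebra
begin

text \<open>Membership of \<open>f\<close> in \<open>E\<close> is still open, so
  \<open>1 + f\<^sup>* f\<close> cannot be formed inside \<open>E\<close>. Its bounded inverse is in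
  \<open>E\<close> by \<open>onE_bounded\<close>, and (E1) then recovers it, provided that it lies
  in \<open>F0\<close>.\<close>

lemma F0_subset_E:
  assumes f: "f \<in> F0" shows "f \<in> E"
proof -
  note F = FalgD[OF F0_Falg[OF f]]
  have dim: "f X \<in> carrier_mat (tdim X) (tdim X)" if "X \<in> Mtup l" for X
    using compatibleD(1,2)[OF F(1) that] by simp
  let ?k = "\<lambda>X. 1\<^sub>m (tdim X) + adj (f X) * f X"
  have ck: "compatible l ?k"
    by (intro compatible_add compatible_one compatible_mult compatible_adj F(1))
  have bk: "borel_fun l ?k"
    by (intro borel_fun_add borel_fun_one borel_fun_mult borel_fun_adj compatible_one compatible_mult compatible_adj F)
  have kF: "restr l ?k \<in> Falg l" by (rule restr_FalgI[OF ck bk])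
  \<comment> \<open>Here an unbounded function must be placed in \<open>F0\<close>; in the locally
    bounded case the bound is \<open>1 + C * C\<close> wherever \<open>f\<close> is bounded by
    \<open>C\<close>.\<close>
  have kF0: "restr l ?k \<in> F0"
  proof (cases loc)
    case True
    have "\<exists>C. \<forall>X\<in>Mtup l. tnorm X \<le> R \<longrightarrow> opnorm (restr l ?k X) \<le> C" for R
    proof -
      have "\<exists>C. \<forall>X\<in>Mtup l. tnorm X \<le> R \<longrightarrow> opnorm (f X) \<le> C"
        using f True by (simp add: F0 Floc_def)
      then obtain C where C: "\<And>X. X \<in> Mtup l \<Longrightarrow> tnorm X \<le> R \<Longrightarrow> opnorm (f X) \<le> C" by blast
      have "opnorm (?k X) \<le> 1 + C * C" if X: "X \<in> Mtup l" "tnorm X \<le> R" for X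
      proof -
        have "opnorm (?k X) \<le> opnorm (1\<^sub>m (tdim X)) + opnorm (adj (f X) * f X)"
          using dim[OF X(1)] by (intro opnorm_add) auto
        also have "\<dots> \<le> 1 + opnorm (adj (f X)) * opnorm (f X)"
          using dim[OF X(1)] by (intro add_mono opnorm_one opnorm_mult) auto
        also have "\<dots> \<le> 1 + C * C"
          using C[OF X] order_trans[OF opnorm_nonneg C[OF X]]
          by (intro add_left_mono mult_mono order_trans[OF opnorm_adj_le]) auto
        finally show ?thesis .
      qed
      then show ?thesis by (auto simp: restr_apply)
    qed
    then show ?thesis using kF True by (simp add: F0 Floc_def)
  qed (use kF F0 in simp)
  have "\<exists>B. B \<in> carrier_mat (tdim X) (tdim X) \<and> ?k X * B = 1\<^sub>m (tdim X) \<and> opnorm B \<le> 1 \<and> opnorm (f X * B) \<le> 1"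
    if X: "X \<in> Mtup l" for X
    by (rule one_plus_adj_mult[OF dim[OF X]]) blast
  then have "\<exists>B. \<forall>X\<in>Mtup l. B X \<in> carrier_mat (tdim X) (tdim X) \<and> ?k X * B X = 1\<^sub>m (tdim X) \<and>
      opnorm (B X) \<le> 1 \<and> opnorm (f X * B X) \<le> 1"
    by (intro bchoice ballI)
  then obtain B where B: "\<And>X. X \<in> Mtup l \<Longrightarrow> B X \<in> carrier_mat (tdim X) (tdim X)"
    "\<And>X. X \<in> Mtup l \<Longrightarrow> ?k X * B X = 1\<^sub>m (tdim X)" "\<And>X. X \<in> Mtup l \<Longrightarrow> opnorm (B X) \<le> 1"
    "\<And>X. X \<in> Mtup l \<Longrightarrow> opnorm (f X * B X) \<le> 1" by blast
  have inv: "\<exists>B. B \<in> carrier_mat (tdim X) (tdim X) \<and> ?k X * B = 1\<^sub>m (tdim X)" if "X \<in> Mtup l" for X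
    using B(1,2)[OF that] by blast
  have kB: "minv (?k X) = B X" if "X \<in> Mtup l" for X
    by (rule minv_eq[of _ "tdim X"]) (use B(1,2)[OF that] dim[OF that] in auto)
  let ?h = "\<lambda>X. minv (?k X)"
  have ch: "compatible l ?h" by (rule compatible_inv[OF ck inv])
  have bh: "borel_fun l ?h" by (rule borel_fun_inv[OF ck bk inv])
  have hF: "restr l ?h \<in> Falg l" by (rule restr_FalgI[OF ch bh])
  have hE: "restr l ?h \<in> E"
  proof (rule mem_onE)
    show "onE (restr l ?h)" by (rule onE_bounded[OF hF, of 1]) (simp add: restr_apply kB B(3))
    show "restr l ?h \<in> F0" by (rule F0_boundedI[OF hF, of 1]) (simp add: restr_apply kB B(3))
  qed
  have hk: "minv (restr l ?h X) = ?k X" "invertible_mat (restr l ?h X)" if X: "X \<in> Mtup l" for X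
  proof -
    note B' = B(1,2)[OF X] and D = dim[OF X]
    have "B X * ?k X = 1\<^sub>m (tdim X)"
      by (rule mat_mult_left_right_inverse[OF _ B']) (use D in simp)
    then show "minv (restr l ?h X) = ?k X" "invertible_mat (restr l ?h X)"
      using B' D by (auto simp: restr_apply X kB intro!: minv_eq[of _ "tdim X"])
        (auto simp: invertible_mat_def inverts_mat_def intro!: exI[of _ "?k X"])
  qed
  have "finv l (restr l ?h) = restr l ?k"
    unfolding finv_def restr_def[of l "\<lambda>X. minv (restr l ?h X)"] using hk(1) by (auto simp: restr_def)
  \<comment> \<open>(E1) is applied to the inverse \<open>?h\<close>, whose own inverse is
    \<open>?k\<close>.\<close>
  then have kE: "restr l ?k \<in> E" using E1[OF hE] hk(2) kF0 by simp
  have gF: "restr l (\<lambda>X. f X * ?h X) \<in> Falg l"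
    by (rule restr_FalgI) (intro compatible_mult borel_fun_mult F ch bh)+
  have gE: "restr l (\<lambda>X. f X * ?h X) \<in> E"
  proof (rule mem_onE)
    show "onE (restr l (\<lambda>X. f X * ?h X))"
      by (rule onE_bounded[OF gF, of 1]) (simp add: restr_apply kB B(4))
    show "restr l (\<lambda>X. f X * ?h X) \<in> F0"
      by (rule F0_boundedI[OF gF, of 1]) (simp add: restr_apply kB B(4))
  qed
  have "onE (\<lambda>Y. restr l (\<lambda>X. f X * ?h X) Y * restr l ?k Y)" by (intro onE_mult onE_mem gE kE)
  then have "onE f"
  proof (rule onE_cong)
    fix Y assume "Y \<in> irr"
    then have Y: "Y \<in> Mtup l" by (rule irr_Mtup)
    note B' = B(1,2)[OF Y] and D = dim[OF Y]
    have "B Y * ?k Y = 1\<^sub>m (tdim Y)"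
      by (rule mat_mult_left_right_inverse[OF _ B']) (use D in simp)
    moreover have "f Y * B Y * ?k Y = f Y * (B Y * ?k Y)" using B'(1) D by (intro mm_assoc) auto
    ultimately show "restr l (\<lambda>X. f X * ?h X) Y * restr l ?k Y = f Y"
      unfolding restr_apply[OF Y] kB[OF Y] using D by simp
  qed
  then show ?thesis using f by (rule mem_onE)
qed

end

theorem theorem2p1:
  fixes l :: nat and loc :: bool
    and E :: "(complex mat list \<Rightarrow> complex mat) set"
  defines "F0 \<equiv> (if loc then Floc l else Falg l)"
  assumes l: "l \<ge> 1"
    and sub: "unital_star_subalg l F0 E"
    and E0: "\<And>j. 1 \<le> j \<Longrightarrow> j \<le> l \<Longrightarrow> proj l j \<in> E"
    and E1: "\<And>f. f \<in> E \<Longrightarrow> (\<forall>X\<in>Mtup l. invertible_mat (f X)) \<Longrightarrow> finv l f \<in> F0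
               \<Longrightarrow> finv l f \<in> E"
    and E2: "\<And>fs f. (\<forall>n. fs n \<in> E) \<Longrightarrow> (\<exists>C. \<forall>n. \<forall>X\<in>Mtup l. opnorm (fs n X) \<le> C)
               \<Longrightarrow> f \<in> F0 \<Longrightarrow> (\<forall>X\<in>Mtup l. (\<lambda>n. opnorm (fs n X - f X)) \<longlonglongrightarrow> 0)
               \<Longrightarrow> f \<in> E"
  shows "E = F0"
proof -
  interpret closed_subalgebra l loc F0 E
    by (unfold_locales; (rule l sub E0 E1 E2 F0_def[THEN meta_eq_to_obj_eq]; assumption?))
  show ?thesis using E_F0 F0_subset_E by blast
qed

end
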